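(* Let $s>\frac12$. The Peregrine breather $$P(t,x)=e^{it}\Big(1-\frac{4(1+2it)}{1+4t^2+2x^2}\Big),$$ a solution of the focusing cubic nonlinear Schrödinger equation $i\partial_tu+\partial_x^2u+|u|^2u=0$ on $\mathbb{R}$, is unstable under small $H^s$ perturbations; that is, $P$ is not orbitally stable in $H^s(\mathbb{R})$ (in the sense defined in the context).
   Context: Consider perturbations $u(t,x)=e^{it}(1+w(t,x))$ of the Stokes wave $e^{it}$ in $i\partial_tu+\partial_x^2u+|u|^2u=0$; then $w$ satisfies $$i\partial_tw+\partial_x^2w+2\operatorname{Re}w=G[w],\qquad G[w]=-\big(2|w|^2+w^2+|w|^2w\big). \tag{$*$}$$ For $s>\frac12$, $( * )$ is locally well-posed in $H^s(\mathbb{R})$: for each $t_0\in\mathbb{R}$ and $w_0\in H^s(\mathbb{R})$ there is a unique maximal solution $w$, continuous in time with values in $H^s$, with $w(t_0)=w_0$, where solutions are understood in the integral (Duhamel) sense. Definition (orbital stability). Fix $s>\frac12$ and $t_0\in\mathbb{R}$. A globally defined solution $U=e^{it}(1+W)$ of $i\partial_tu+\partial_x^2u+|u|^2u=0$ is orbitally stable in $H^s$ if there are constants $C_0,\varepsilon_0>0$ such that for any $0<\varepsilon<\varepsilon_0$ and any $w_0\in H^s(\mathbb{R})$: if $\|w_0-W(t_0)\|_{H^s}<\varepsilon$, then there exists $x_0(t)\in\mathbb{R}$ ($t\in\mathbb{R}$) such that $$\sup_{t\in\mathbb{R}}\|w(t)-W(t,\cdot-x_0(t))\|_{H^s}<C_0\,\varepsilon,$$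 where $w(t)$ is the solution of $( * )$ with $w(t_0)=w_0$. This condition requires $w$ to be globally defined. If the condition is not satisfied, $U$ is called unstable. For $U=P$ one has $W(t,x)=-\frac{4(1+2it)}{1+4t^2+2x^2}$. *)

theory Defs
  imports "HOL-Analysis.Analysis"
begin

text \<open>
  Elements of \<open>L\<^sup>2(\<real>; \<complex>)\<close> and \<open>H\<^sup>s(\<real>; \<complex>)\<close> are represented by Borel functions; identities between
  such elements are stated almost everywhere or through the norm.
\<close>

definition L2 :: "(real \<Rightarrow> complex) set" where
  "L2 = {f. f \<in> borel_measurable lborel \<and> integrable lborel (\<lambda>x. (cmod (f x))\<^sup>2)}"

definition truncated_fourier :: "real \<Rightarrow> (real \<Rightarrow> complex) \<Rightarrow> real \<Rightarrow> complex" where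
  "truncated_fourier R f \<xi> =
     complex_of_real (1 / sqrt (2 * pi)) * (LINT x:{-R..R}|lborel. f x * cis (- (\<xi> * x)))"

text \<open>
  The (unitary) Fourier--Plancherel transform on \<open>L\<^sup>2\<close>: the \<open>L\<^sup>2\<close>-limit of the transforms of
  the truncations of \<open>f\<close> to \<open>[-R, R]\<close>. By Plancherel's theorem \<open>g\<close> exists for every \<open>f\<close> in \<open>L\<^sup>2\<close>
  and is unique up to null sets.
\<close>

definition is_fourier :: "(real \<Rightarrow> complex) \<Rightarrow> (real \<Rightarrow> complex) \<Rightarrow> bool" where
  "is_fourier f g \<longleftrightarrow> f \<in> L2 \<and> g \<in> L2 \<and>
     ((\<lambda>R. \<integral>\<^sup>+ \<xi>. ennreal ((cmod (g \<xi> - truncated_fourier R f \<xi>))\<^sup>2) \<partial>lborel) \<longlongrightarrow> 0) at_top"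

definition fourier :: "(real \<Rightarrow> complex) \<Rightarrow> real \<Rightarrow> complex" where
  "fourier f = (SOME g. is_fourier f g)"

text \<open>The Sobolev space for \<open>s \<ge> 0\<close>.\<close>

definition sobolev :: "real \<Rightarrow> (real \<Rightarrow> complex) set" where
  "sobolev s = {f \<in> L2. integrable lborel (\<lambda>\<xi>. (1 + \<xi>\<^sup>2) powr s * (cmod (fourier f \<xi>))\<^sup>2)}"

text \<open>The norm is extended by \<open>\<infinity>\<close> outside the space, so that a finite bound entails membership.\<close>

definition sobolev_norm :: "real \<Rightarrow> (real \<Rightarrow> complex) \<Rightarrow> ennreal" where
  "sobolev_norm s f =
     (if f \<in> sobolev s
      then ennreal (sqrt (LINT \<xi>|lborel. (1 + \<xi>\<^sup>2) powr s * (cmod (fourier f \<xi>))\<^sup>2))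
      else \<infinity>)"

text \<open>The free Schroedinger group \<open>exp (i t \<partial>\<^sub>x\<^sup>2)\<close>, i.e. the Fourier multiplier \<open>exp (- i t \<xi>\<^sup>2)\<close>.\<close>

definition schroedinger_group :: "real \<Rightarrow> (real \<Rightarrow> complex) \<Rightarrow> real \<Rightarrow> complex" where
  "schroedinger_group t f = (SOME h. is_fourier h (\<lambda>\<xi>. cis (- (t * \<xi>\<^sup>2)) * fourier f \<xi>))"

text \<open>
  The \<open>H\<^sup>s\<close>-valued integral over \<open>[a, b]\<close>. This is the library's \<open>has_integral\<close> with the norm
  of the target space replaced by the \<open>H\<^sup>s\<close> norm (functions modulo null sets do not form
  a type to which \<open>has_integral\<close> would apply).
\<close>

definition has_sobolev_integral ::
    "real \<Rightarrow> (real \<Rightarrow> real \<Rightarrow> complex) \<Rightarrow> (real \<Rightarrow> complex) \<Rightarrow> real \<Rightarrow> real \<Rightarrow> bool" where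
  "has_sobolev_integral s F J a b \<longleftrightarrow>
     J \<in> sobolev s \<and> (\<forall>\<tau>\<in>{a..b}. F \<tau> \<in> sobolev s) \<and>
     (\<forall>e>0. \<exists>\<gamma>. gauge \<gamma> \<and>
        (\<forall>D. D tagged_division_of {a..b} \<and> \<gamma> fine D \<longrightarrow>
           sobolev_norm s (\<lambda>x. (\<Sum>(\<tau>, K)\<in>D. Henstock_Kurzweil_Integration.content K *\<^sub>R F \<tau> x) - J x) < ennreal e))"

definition has_oriented_sobolev_integral ::
    "real \<Rightarrow> (real \<Rightarrow> real \<Rightarrow> complex) \<Rightarrow> (real \<Rightarrow> complex) \<Rightarrow> real \<Rightarrow> real \<Rightarrow> bool" where
  "has_oriented_sobolev_integral s F J a b \<longleftrightarrow>
     (if a \<le> b then has_sobolev_integral s F J a b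
      else has_sobolev_integral s F (\<lambda>x. - J x) b a)"

definition G :: "complex \<Rightarrow> complex" where
  "G w = - (2 * (complex_of_real (cmod w))\<^sup>2 + w\<^sup>2 + (complex_of_real (cmod w))\<^sup>2 * w)"

text \<open>
  Solutions on an interval \<open>I\<close>, with datum \<open>w0\<close> at time \<open>t0\<close>, of
  \<open>i \<partial>\<^sub>t w + \<partial>\<^sub>x\<^sup>2 w + 2 Re w = G[w]\<close> in \<open>C(I; H\<^sup>s)\<close>, in Duhamel's sense
  \<open>w(t) = S(t - t0) w0 - i \<integral> S(t - \<tau>) (G[w(\<tau>)] - 2 Re w(\<tau>)) d\<tau>\<close>, the integral running
  from \<open>t0\<close> to \<open>t\<close>.
\<close>

definition duhamel_solution ::
    "real \<Rightarrow> real set \<Rightarrow> real \<Rightarrow> (real \<Rightarrow> complex) \<Rightarrow> (real \<Rightarrow> real \<Rightarrow> complex) \<Rightarrow> bool" where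
  "duhamel_solution s I t0 w0 w \<longleftrightarrow>
     is_interval I \<and> t0 \<in> I \<and>
     (\<forall>t\<in>I. w t \<in> sobolev s) \<and>
     (\<forall>t\<in>I. ((\<lambda>\<tau>. sobolev_norm s (\<lambda>x. w \<tau> x - w t x)) \<longlongrightarrow> 0) (at t within I)) \<and>
     (\<forall>t\<in>I. \<exists>J.
        has_oriented_sobolev_integral s
          (\<lambda>\<tau>. schroedinger_group (t - \<tau>)
                  (\<lambda>x. G (w \<tau> x) - complex_of_real (2 * Re (w \<tau> x)))) J t0 t \<and>
        (AE x in lborel. w t x = schroedinger_group (t - t0) w0 x - \<i> * J x))"

text \<open>The function \<open>W\<close> with \<open>U(t, x) = exp (i t) (1 + W(t, x))\<close>.\<close>

definition perturbation_part :: "(real \<Rightarrow> real \<Rightarrow> complex) \<Rightarrow> real \<Rightarrow> real \<Rightarrow> complex" where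
  "perturbation_part U t x = cis (- t) * U t x - 1"

text \<open>
  By uniqueness for the Cauchy problem, the maximal solution with datum \<open>w0\<close> is globally defined
  iff there is a solution on the whole real line, and the two then coincide.
\<close>

definition orbitally_stable :: "real \<Rightarrow> real \<Rightarrow> (real \<Rightarrow> real \<Rightarrow> complex) \<Rightarrow> bool" where
  "orbitally_stable s t0 U \<longleftrightarrow>
     (\<exists>C0>0. \<exists>\<epsilon>0>0. \<forall>\<epsilon>. 0 < \<epsilon> \<and> \<epsilon> < \<epsilon>0 \<longrightarrow>
        (\<forall>w0 \<in> sobolev s.
           sobolev_norm s (\<lambda>x. w0 x - perturbation_part U t0 x) < ennreal \<epsilon> \<longrightarrow>
           (\<exists>w. duhamel_solution s UNIV t0 w0 w \<and>
              (\<exists>x0 :: real \<Rightarrow> real.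
                 (SUP t. sobolev_norm s (\<lambda>x. w t x - perturbation_part U t (x - x0 t)))
                   < ennreal (C0 * \<epsilon>)))))"

definition nls_classical_solution :: "(real \<Rightarrow> real \<Rightarrow> complex) \<Rightarrow> bool" where
  "nls_classical_solution U \<longleftrightarrow>
     (\<exists>Ut Ux Uxx. \<forall>t x.
        ((\<lambda>\<tau>. U \<tau> x) has_vector_derivative Ut t x) (at t) \<and>
        (U t has_vector_derivative Ux t x) (at x) \<and>
        (Ux t has_vector_derivative Uxx t x) (at x) \<and>
        \<i> * Ut t x + Uxx t x + (complex_of_real (cmod (U t x)))\<^sup>2 * U t x = 0)"

definition peregrine :: "real \<Rightarrow> real \<Rightarrow> complex" where
  "peregrine t x =
     cis t * (1 - 4 * (1 + 2 * \<i> * complex_of_real t) / complex_of_real (1 + 4 * t\<^sup>2 + 2 * x\<^sup>2))"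

end

theory Submission
  imports Defs "HOL-Real_Asymp.Real_Asymp"
begin

text \<open>
  The proof of instability sets a conserved quantity against the definition of stability. In the
  variable \<open>w\<close> of \<open>u = e\<^sup>i\<^sup>t (1 + w)\<close>, the momentum \<open>P(w) = \<integral> \<xi> |F w(\<xi>)|\<^sup>2 d\<xi>\<close>, where \<open>F\<close> is the
  Fourier transform (formally \<open>P(w) = Im \<integral> cnj w * w\<^sub>x dx\<close>), does not change along the flow. Since
  \<open>|\<xi>| \<le> (1 + \<xi>\<^sup>2)\<^sup>s\<close> for \<open>s \<ge> 1/2\<close>, its modulus is at most the square of the \<open>H\<^sup>s\<close> norm.

  Let \<open>W(t)\<close> be the perturbation part of the Peregrine breather. Its Fourier transform has modulus
  \<open>2 sqrt pi exp (- b |\<xi>|)\<close> with \<open>b = sqrt ((1 + 4 t\<^sup>2) / 2)\<close>: it has momentum \<open>0\<close>, being even in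
  modulus, and it tends to \<open>0\<close> in every \<open>H\<^sup>s\<close> as \<open>t\<close> grows. Now multiply the positive frequencies of
  \<open>W(t\<^sub>0)\<close> by \<open>1 + \<delta>\<close>. This is a perturbation of size \<open>O(\<delta>)\<close>, and its momentum is at least \<open>2 \<delta> c\<close>
  with \<open>c > 0\<close>, i.e. of first order (\<open>asymmetric_perturbation\<close>). If the breather were stable, the
  solution would stay within \<open>O(\<delta>)\<close> of translates of \<open>W(t)\<close>; as \<open>W(t)\<close> disappears, the solution
  itself would have norm \<open>O(\<delta>)\<close> at late times, and so momentum \<open>O(\<delta>\<^sup>2)\<close>. By conservation
  \<open>2 \<delta> c = O(\<delta>\<^sup>2)\<close>, which fails for small \<open>\<delta>\<close>.

  The substance is conservation of momentum (\<open>momentum_conserved\<close>) for Duhamel solutions that are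
  only in \<open>H\<^sup>s\<close>, \<open>s > 1/2\<close>, where \<open>w\<^sub>x\<close> need not be a function. The symbol \<open>\<xi>\<close> is replaced by the bounded
  symbol \<open>sin (h \<xi>) / h\<close>. The rate of change of this momentum at scale \<open>h\<close> is \<open>1/h\<close> times the pairing
  of the forcing \<open>f(w)\<close> with \<open>w(x + h) - w(x - h)\<close>. The forcing is the gradient of the potential
  \<open>- (|1 + w|\<^sup>2 - 1)\<^sup>2 / 4\<close>, whose integral is invariant under translations, so only the second-order
  Taylor remainder survives, and that is \<open>O(\<integral> |w(x + h) - w(x)|\<^sup>2 dx)\<close> (\<open>momentum_flux_bound\<close>). For \<open>w\<close> in
  \<open>H\<^sup>s\<close> this is \<open>O(h powr (2 \<sigma>))\<close> with \<open>\<sigma> = min s 1 > 1/2\<close> (\<open>shift_diff_sobolev\<close>), hence still \<open>o(1)\<close>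
  after division by \<open>h\<close>. The constants involve the supremum of \<open>|w|\<close>, which \<open>sobolev_embedding\<close>
  controls; stability itself bounds the \<open>H\<^sup>s\<close> norm uniformly in time. The passage from Duhamel's
  integral to the growth of a quadratic form uses nothing but Riemann sums
  (\<open>quadratic_form_variation\<close>), so no time derivative of the solution is ever taken.

  All this takes place on the Fourier side, and rests on Plancherel's theorem and Fourier inversion
  for the transform defined through truncations. They are derived in a Hilbert space of classes of
  functions: the isometry on \<open>L\<^sup>1 \<inter> L\<^sup>2\<close> by damping with \<open>exp (- b |\<xi>|)\<close>, whose transform is the Poisson
  kernel, and the inversion from the isometry and the multiplication formula. The same computation
  of the Poisson kernel also gives the transform of \<open>W(t)\<close>.
\<close>

section \<open>Square-integrable functions modulo null sets\<close>

lemma L2_measurable [measurable_dest]: "f \<in> L2 \<Longrightarrow> f \<in> borel_measurable borel"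
  by (simp add: L2_def)

lemma L2_integrable: "f \<in> L2 \<Longrightarrow> integrable lborel (\<lambda>x. (cmod (f x))\<^sup>2)"
  by (simp add: L2_def)

lemma L2_dominated:
  assumes "f \<in> borel_measurable borel" and "integrable lborel g" and "AE x in lborel. (cmod (f x))\<^sup>2 \<le> g x"
  shows "f \<in> L2"
  unfolding L2_def
proof (intro CollectI conjI)
  show "f \<in> borel_measurable lborel" using assms(1) by simp
  show "integrable lborel (\<lambda>x. (cmod (f x))\<^sup>2)"
    by (rule Bochner_Integration.integrable_bound[OF assms(2)])
       (use assms in \<open>auto elim!: eventually_mono\<close>)
qed

lemma borel_measurable_cnj [measurable]:
  "f \<in> borel_measurable M \<Longrightarrow> (\<lambda>x. cnj (f x)) \<in> borel_measurable M"
  by (rule measurable_compose[of f M borel cnj borel])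
     (auto intro!: borel_measurable_continuous_onI continuous_intros)

lemma L2_zero [simp]: "(\<lambda>x. 0) \<in> L2"
  by (simp add: L2_def)

lemma cmod_add_sq_le: "(cmod (a + b))\<^sup>2 \<le> 2 * (cmod a)\<^sup>2 + 2 * (cmod b)\<^sup>2"
proof -
  have "(cmod (a + b))\<^sup>2 \<le> (cmod a + cmod b)\<^sup>2"
    by (intro power_mono norm_triangle_ineq) auto
  also have "\<dots> \<le> 2 * (cmod a)\<^sup>2 + 2 * (cmod b)\<^sup>2"
    using sum_squares_bound[of "cmod a" "cmod b"] by (simp add: power2_sum)
  finally show ?thesis .
qed

lemma L2_add [simp, intro]: "f \<in> L2 \<Longrightarrow> g \<in> L2 \<Longrightarrow> (\<lambda>x. f x + g x) \<in> L2"
  by (rule L2_dominated[where g="\<lambda>x. 2 * (cmod (f x))\<^sup>2 + 2 * (cmod (g x))\<^sup>2"])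
     (auto simp: cmod_add_sq_le L2_integrable dest: L2_measurable)

lemma L2_mult_bounded:
  assumes "f \<in> L2" "m \<in> borel_measurable borel" "AE x in lborel. cmod (m x) \<le> C"
  shows "(\<lambda>x. m x * f x) \<in> L2"
proof (rule L2_dominated[where g="\<lambda>x. C\<^sup>2 * (cmod (f x))\<^sup>2"])
  show "AE x in lborel. (cmod (m x * f x))\<^sup>2 \<le> C\<^sup>2 * (cmod (f x))\<^sup>2"
    using assms(3) by eventually_elim (simp add: norm_mult power_mult_distrib mult_right_mono power_mono)
qed (use assms in \<open>auto simp: L2_integrable intro!: borel_measurable_times dest: L2_measurable\<close>)

lemma L2_cmult [simp, intro]: "f \<in> L2 \<Longrightarrow> (\<lambda>x. c * f x) \<in> L2"
  by (rule L2_mult_bounded[where C="cmod c"]) auto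

lemma L2_scaleR [simp, intro]: "f \<in> L2 \<Longrightarrow> (\<lambda>x. r *\<^sub>R f x) \<in> L2"
  using L2_cmult[of f "complex_of_real r"] by (simp add: scaleR_conv_of_real)

lemma L2_minus [simp, intro]: "f \<in> L2 \<Longrightarrow> (\<lambda>x. - f x) \<in> L2"
  using L2_cmult[of f "-1"] by simp

lemma L2_diff [simp, intro]: "f \<in> L2 \<Longrightarrow> g \<in> L2 \<Longrightarrow> (\<lambda>x. f x - g x) \<in> L2"
  using L2_add[of f "\<lambda>x. - g x"] by simp

lemma L2_cnj [simp, intro]: "f \<in> L2 \<Longrightarrow> (\<lambda>x. cnj (f x)) \<in> L2"
  by (rule L2_dominated[where g="\<lambda>x. (cmod (f x))\<^sup>2"])
     (auto simp: L2_integrable intro!: borel_measurable_cnj dest: L2_measurable)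

lemma L2_sum [simp, intro]: "(\<And>i. i \<in> A \<Longrightarrow> f i \<in> L2) \<Longrightarrow> (\<lambda>x. \<Sum>i\<in>A. f i x) \<in> L2"
  by (induction A rule: infinite_finite_induct) auto

lemma L2_prod_integrable:
  assumes "f \<in> L2" "g \<in> L2"
  shows "integrable lborel (\<lambda>x. f x * g x)"
proof (rule Bochner_Integration.integrable_bound)
  show "integrable lborel (\<lambda>x. (cmod (f x))\<^sup>2 + (cmod (g x))\<^sup>2)"
    using assms by (auto dest: L2_integrable)
  have "cmod a * cmod b \<le> (cmod a)\<^sup>2 + (cmod b)\<^sup>2" for a b
  proof -
    have "0 \<le> cmod a * cmod b" by simp
    then show ?thesis using sum_squares_bound[of "cmod a" "cmod b"] by linarith
  qed
  then show "AE x in lborel. norm (f x * g x) \<le> norm ((cmod (f x))\<^sup>2 + (cmod (g x))\<^sup>2)"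
    by (simp add: norm_mult)
qed (use assms in \<open>auto dest: L2_measurable\<close>)

lemma L2_inner_integrable:
  "f \<in> L2 \<Longrightarrow> g \<in> L2 \<Longrightarrow> integrable lborel (\<lambda>x. f x * cnj (g x))"
  by (intro L2_prod_integrable L2_cnj)

lemma L2_Re_integrable [simp]:
  "f \<in> L2 \<Longrightarrow> g \<in> L2 \<Longrightarrow> integrable lborel (\<lambda>x. Re (f x * cnj (g x)))"
  by (intro integrable_Re L2_inner_integrable)

definition L2_rel :: "(real \<Rightarrow> complex) \<Rightarrow> (real \<Rightarrow> complex) \<Rightarrow> bool" where
  "L2_rel f g \<longleftrightarrow> f \<in> L2 \<and> g \<in> L2 \<and> (AE x in lborel. f x = g x)"

lemma L2_relI: "f \<in> L2 \<Longrightarrow> g \<in> L2 \<Longrightarrow> (AE x in lborel. f x = g x) \<Longrightarrow> L2_rel f g"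
  by (simp add: L2_rel_def)

text \<open>
  Convergence, completeness and the Cauchy-Schwarz inequality become available once functions equal
  almost everywhere are identified; the class of \<open>f\<close> is written \<open>cls f\<close>. The relation is partial,
  so that only square-integrable functions have a class of their own. Only the real inner
  product is used: every identity below concerns norms or real parts.
\<close>

quotient_type l2 = "real \<Rightarrow> complex" / partial: L2_rel
proof (rule part_equivpI)
  show "\<exists>f. L2_rel f f"
    by (rule exI[of _ "\<lambda>x. 0"]) (simp add: L2_rel_def)
  show "symp L2_rel"
    by (rule sympI) (auto simp: L2_rel_def elim: eventually_mono)
  show "transp L2_rel"
    by (rule transpI) (auto simp: L2_rel_def elim: eventually_elim2)
qed

abbreviation cls :: "(real \<Rightarrow> complex) \<Rightarrow> l2" where "cls \<equiv> abs_l2"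

instantiation l2 :: real_inner
begin

lift_definition zero_l2 :: l2 is "\<lambda>x. 0"
  by (simp add: L2_rel_def)

lift_definition plus_l2 :: "l2 \<Rightarrow> l2 \<Rightarrow> l2" is "\<lambda>f g x. f x + g x"
  by (auto simp: L2_rel_def elim: eventually_elim2)

lift_definition uminus_l2 :: "l2 \<Rightarrow> l2" is "\<lambda>f x. - f x"
  by (auto simp: L2_rel_def)

lift_definition minus_l2 :: "l2 \<Rightarrow> l2 \<Rightarrow> l2" is "\<lambda>f g x. f x - g x"
  by (auto simp: L2_rel_def elim: eventually_elim2)

lift_definition scaleR_l2 :: "real \<Rightarrow> l2 \<Rightarrow> l2" is "\<lambda>r f x. r *\<^sub>R f x"
  by (auto simp: L2_rel_def elim: eventually_mono)

lift_definition inner_l2 :: "l2 \<Rightarrow> l2 \<Rightarrow> real" is "\<lambda>f g. LINT x|lborel. Re (f x * cnj (g x))"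
proof -
  fix f f' g g' assume *: "L2_rel f f'" "L2_rel g g'"
  then show "(LINT x|lborel. Re (f x * cnj (g x))) = (LINT x|lborel. Re (f' x * cnj (g' x)))"
    by (intro integral_cong_AE borel_measurable_integrable L2_Re_integrable)
       (auto simp: L2_rel_def elim: eventually_elim2)
qed

definition norm_l2 :: "l2 \<Rightarrow> real" where "norm_l2 x = sqrt (inner x x)"
definition dist_l2 :: "l2 \<Rightarrow> l2 \<Rightarrow> real" where "dist_l2 x y = norm (x - y)"
definition sgn_l2 :: "l2 \<Rightarrow> l2" where "sgn_l2 x = inverse (norm x) *\<^sub>R x"
definition uniformity_l2 :: "(l2 \<times> l2) filter" where
  "uniformity_l2 = (INF e\<in>{0 <..}. principal {(x, y). dist x y < e})"
definition open_l2 :: "l2 set \<Rightarrow> bool" where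
  "open_l2 U \<longleftrightarrow> (\<forall>x\<in>U. \<forall>\<^sub>F (x', y) in uniformity. x' = x \<longrightarrow> y \<in> U)"

instance
proof
  fix x y z :: l2 and a b r :: real
  show "x + y + z = x + (y + z)"
    by transfer (auto intro!: L2_relI simp: L2_rel_def add.assoc)
  show "x + y = y + x"
    by transfer (auto intro!: L2_relI simp: L2_rel_def add.commute)
  show "0 + x = x"
    by transfer (auto intro!: L2_relI simp: L2_rel_def)
  show "- x + x = 0"
    by transfer (auto intro!: L2_relI simp: L2_rel_def)
  show "x - y = x + - y"
    by transfer (auto intro!: L2_relI simp: L2_rel_def)
  show "a *\<^sub>R (x + y) = a *\<^sub>R x + a *\<^sub>R y"
    by transfer (auto intro!: L2_relI simp: L2_rel_def scaleR_add_right)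
  show "(a + b) *\<^sub>R x = a *\<^sub>R x + b *\<^sub>R x"
    by transfer (auto intro!: L2_relI simp: L2_rel_def scaleR_add_left)
  show "a *\<^sub>R b *\<^sub>R x = (a * b) *\<^sub>R x"
    by transfer (auto intro!: L2_relI simp: L2_rel_def)
  show "1 *\<^sub>R x = x"
    by transfer (auto intro!: L2_relI simp: L2_rel_def)
  show "inner x y = inner y x"
    by transfer (simp add: mult.commute)
  show "inner (x + y) z = inner x z + inner y z"
  proof transfer
    fix f g k assume "L2_rel f f" "L2_rel g g" "L2_rel k k"
    then have "f \<in> L2" "g \<in> L2" "k \<in> L2" by (auto simp: L2_rel_def)
    then show "(LINT x|lborel. Re ((f x + g x) * cnj (k x))) =
      (LINT x|lborel. Re (f x * cnj (k x))) + (LINT x|lborel. Re (g x * cnj (k x)))"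
      by (subst Bochner_Integration.integral_add[symmetric]) (auto simp: distrib_right simp del: times_complex.simps)
  qed
  show "inner (r *\<^sub>R x) y = r * inner x y"
    by transfer (auto simp: L2_rel_def scaleR_conv_of_real mult.assoc simp flip: integral_mult_right_zero)
  show "0 \<le> inner x x"
    by transfer (auto intro!: integral_nonneg_AE simp: complex_mult_cnj)
  show "inner x x = 0 \<longleftrightarrow> x = 0"
  proof transfer
    fix f assume "L2_rel f f"
    then have f: "f \<in> L2" by (auto simp: L2_rel_def)
    have "(LINT x|lborel. Re (f x * cnj (f x))) = 0 \<longleftrightarrow> (AE x in lborel. Re (f x * cnj (f x)) = 0)"
      by (intro integral_nonneg_eq_0_iff_AE) (use f in \<open>auto simp: complex_mult_cnj simp flip: cmod_power2 intro: L2_integrable\<close>)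
    also have "\<dots> \<longleftrightarrow> L2_rel f (\<lambda>x. 0)"
      using f by (simp add: L2_rel_def complex_mult_cnj complex_eq_iff)
    finally show "(LINT x|lborel. Re (f x * cnj (f x))) = 0 \<longleftrightarrow> L2_rel f (\<lambda>x. 0)" .
  qed
qed (rule norm_l2_def dist_l2_def sgn_l2_def uniformity_l2_def open_l2_def)+

end

lemma L2_rel_refl [simp]: "f \<in> L2 \<Longrightarrow> L2_rel f f"
  by (simp add: L2_rel_def)

lemma cls_add: "f \<in> L2 \<Longrightarrow> g \<in> L2 \<Longrightarrow> cls (\<lambda>x. f x + g x) = cls f + cls g"
  by (simp add: plus_l2.abs_eq)
lemma cls_diff: "f \<in> L2 \<Longrightarrow> g \<in> L2 \<Longrightarrow> cls (\<lambda>x. f x - g x) = cls f - cls g"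
  by (simp add: minus_l2.abs_eq)
lemma cls_scaleR: "f \<in> L2 \<Longrightarrow> cls (\<lambda>x. r *\<^sub>R f x) = r *\<^sub>R cls f"
  by (simp add: scaleR_l2.abs_eq)
lemma cls_zero: "cls (\<lambda>x. 0) = 0"
  by (simp add: zero_l2.abs_eq)
lemma cls_sum:
  "(\<And>i. i \<in> A \<Longrightarrow> f i \<in> L2) \<Longrightarrow> cls (\<lambda>x. \<Sum>i\<in>A. f i x) = (\<Sum>i\<in>A. cls (f i))"
  by (induction A rule: infinite_finite_induct) (auto simp: cls_zero cls_add)
lemma inner_cls:
  "f \<in> L2 \<Longrightarrow> g \<in> L2 \<Longrightarrow> inner (cls f) (cls g) = (LINT x|lborel. Re (f x * cnj (g x)))"
  by (simp add: inner_l2.abs_eq)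

lemma norm_cls_sq: "f \<in> L2 \<Longrightarrow> (norm (cls f))\<^sup>2 = (LINT x|lborel. (cmod (f x))\<^sup>2)"
  by (simp add: power2_norm_eq_inner[of "cls f"] inner_cls complex_mult_cnj flip: cmod_power2)

lemma cls_eq_iff:
  "f \<in> L2 \<Longrightarrow> g \<in> L2 \<Longrightarrow> cls f = cls g \<longleftrightarrow> (AE x in lborel. f x = g x)"
  using Quotient_rel[OF Quotient_l2, of f g] by (simp add: L2_rel_def)

lemma cls_cases [case_names cls, cases type: l2]:
  obtains f where "f \<in> L2" "x = cls f"
  using Quotient_abs_rep[OF Quotient_l2, of x] Quotient_rep_reflp[OF Quotient_l2, of x]
  by (metis L2_rel_def)

lemma nn_integral_cls:
  "f \<in> L2 \<Longrightarrow> (\<integral>\<^sup>+ x. ennreal ((cmod (f x))\<^sup>2) \<partial>lborel) = ennreal ((norm (cls f))\<^sup>2)"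
  by (simp add: norm_cls_sq nn_integral_eq_integral L2_integrable)

text \<open>
  Fatou's lemma turns a Cauchy bound for the norms into a bound for the distance to the pointwise
  limit. This is the part of the Riesz-Fischer theorem that follows the extraction of a
  subsequence converging almost everywhere.
\<close>

lemma L2_AE_limit:
  assumes F: "\<And>n. F n \<in> L2" and lim: "AE x in lborel. (\<lambda>n. F n x) \<longlonglongrightarrow> g x"
    and [measurable]: "g \<in> borel_measurable borel"
    and cau: "\<And>e. e > 0 \<Longrightarrow> \<exists>N. \<forall>m\<ge>N. \<forall>n\<ge>N. norm (cls (F m) - cls (F n)) \<le> e"
  shows "g \<in> L2" "(\<lambda>n. cls (F n)) \<longlonglongrightarrow> cls g"
proof -
  have [measurable]: "F n \<in> borel_measurable borel" for n using F by (rule L2_measurable)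
  have fatou: "(\<integral>\<^sup>+ x. ennreal ((cmod (g x - F n x))\<^sup>2) \<partial>lborel) \<le> ennreal (e\<^sup>2)"
    if N: "\<forall>m\<ge>N. \<forall>n\<ge>N. norm (cls (F m) - cls (F n)) \<le> e" and n: "n \<ge> N" for n N e
  proof -
    have "(\<integral>\<^sup>+ x. ennreal ((cmod (g x - F n x))\<^sup>2) \<partial>lborel) =
        (\<integral>\<^sup>+ x. liminf (\<lambda>m. ennreal ((cmod (F m x - F n x))\<^sup>2)) \<partial>lborel)"
    proof (intro nn_integral_cong_AE)
      show "AE x in lborel. ennreal ((cmod (g x - F n x))\<^sup>2) = liminf (\<lambda>m. ennreal ((cmod (F m x - F n x))\<^sup>2))"
        using lim
      proof eventually_elim
        case (elim x)
        have "(\<lambda>m. ennreal ((cmod (F m x - F n x))\<^sup>2)) \<longlonglongrightarrow> ennreal ((cmod (g x - F n x))\<^sup>2)"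
          by (intro tendsto_intros elim)
        then show ?case by (intro lim_imp_Liminf[symmetric]) auto
      qed
    qed
    also have "\<dots> \<le> liminf (\<lambda>m. \<integral>\<^sup>+ x. ennreal ((cmod (F m x - F n x))\<^sup>2) \<partial>lborel)"
      by (rule nn_integral_liminf) measurable
    also have "\<dots> \<le> limsup (\<lambda>m. \<integral>\<^sup>+ x. ennreal ((cmod (F m x - F n x))\<^sup>2) \<partial>lborel)"
      by (rule Liminf_le_Limsup) simp
    also have "\<dots> \<le> ennreal (e\<^sup>2)"
    proof (rule Limsup_bounded)
      show "\<forall>\<^sub>F m in sequentially. (\<integral>\<^sup>+ x. ennreal ((cmod (F m x - F n x))\<^sup>2) \<partial>lborel) \<le> ennreal (e\<^sup>2)"
        unfolding eventually_sequentially
      proof (intro exI[of _ N] allI impI)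
        fix m assume "m \<ge> N"
        then have "norm (cls (F m) - cls (F n)) \<le> e" using N n by auto
        then show "(\<integral>\<^sup>+ x. ennreal ((cmod (F m x - F n x))\<^sup>2) \<partial>lborel) \<le> ennreal (e\<^sup>2)"
          by (subst nn_integral_cls) (auto simp: F cls_diff intro!: ennreal_leI power_mono)
      qed
    qed
    finally show ?thesis .
  qed
  have gF: "(\<lambda>x. g x - F n x) \<in> L2"
    if N: "\<forall>m\<ge>N. \<forall>n\<ge>N. norm (cls (F m) - cls (F n)) \<le> e" and n: "n \<ge> N" for n N e
    using fatou[OF that] unfolding L2_def
    by (auto simp: integrable_iff_bounded less_top[symmetric] top_unique)
  obtain N where "\<forall>m\<ge>N. \<forall>n\<ge>N. norm (cls (F m) - cls (F n)) \<le> 1" using cau[of 1] by auto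
  from gF[OF this, of N] have "(\<lambda>x. (g x - F N x) + F N x) \<in> L2" by (intro L2_add F) auto
  then show g: "g \<in> L2" by simp
  show "(\<lambda>n. cls (F n)) \<longlonglongrightarrow> cls g"
  proof (rule LIMSEQ_I)
    fix e :: real assume e: "e > 0"
    obtain N where N: "\<forall>m\<ge>N. \<forall>n\<ge>N. norm (cls (F m) - cls (F n)) \<le> e/2" using cau[of "e/2"] e by auto
    have "norm (cls (F n) - cls g) < e" if "n \<ge> N" for n
    proof -
      have "ennreal ((norm (cls g - cls (F n)))\<^sup>2) \<le> ennreal ((e/2)\<^sup>2)"
        using fatou[OF N that] by (subst (asm) nn_integral_cls) (auto simp: g F cls_diff)
      then have "norm (cls g - cls (F n)) \<le> e/2"
        using e by (simp add: power2_le_iff_abs_le)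
      then show ?thesis using e by (simp add: norm_minus_commute)
    qed
    then show "\<exists>N. \<forall>n\<ge>N. norm (cls (F n) - cls g) < e" by auto
  qed
qed

text \<open>
  A subsequence with summable distances converges almost everywhere, and so in norm; a Cauchy
  sequence converges along with any of its subsequences.
\<close>

instance l2 :: complete_space
proof
  fix X :: "nat \<Rightarrow> l2" assume X: "Cauchy X"
  obtain r where r: "strict_mono r" and fast: "\<And>n. dist (X (r (Suc n))) (X (r n)) \<le> (1/2)^n"
  proof -
    have "\<exists>N. \<forall>m\<ge>N. \<forall>n\<ge>N. dist (X m) (X n) < (1/2)^k" for k
      using X by (auto intro: metric_CauchyD)
    then obtain N where N: "\<And>k m n. m \<ge> N k \<Longrightarrow> n \<ge> N k \<Longrightarrow> dist (X m) (X n) < (1/2)^k" by metis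
    define r where "r k = k + (\<Sum>i\<le>k. N i)" for k
    have "strict_mono r" by (rule strict_monoI_Suc) (simp add: r_def)
    moreover have "N k \<le> (\<Sum>i\<le>k. N i)" for k
      by (rule member_le_sum) auto
    then have "r k \<ge> N k" "r (Suc k) \<ge> N k" for k
      by (simp_all add: r_def trans_le_add2 add_increasing le_SucI trans_le_add1)
    ultimately show ?thesis using that N by (metis less_imp_le)
  qed
  have "\<forall>n. \<exists>f. f \<in> L2 \<and> X (r n) = cls f" by (metis cls_cases)
  then obtain F where F: "\<And>n. F n \<in> L2" "\<And>n. X (r n) = cls (F n)" by metis
  have [measurable]: "F n \<in> borel_measurable borel" for n using F(1) by (rule L2_measurable)
  define u where "u n x = 2^n * (cmod (F (Suc n) x - F n x))\<^sup>2" for n x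
  have [measurable]: "u n \<in> borel_measurable borel" for n unfolding u_def by measurable
  have "(\<integral>\<^sup>+x. ennreal (u n x) \<partial>lborel) \<le> ennreal ((1/2)^n)" for n
  proof -
    have "(\<integral>\<^sup>+x. ennreal (u n x) \<partial>lborel) = 2^n * (\<integral>\<^sup>+x. ennreal ((cmod (F (Suc n) x - F n x))\<^sup>2) \<partial>lborel)"
      unfolding u_def by (subst nn_integral_cmult[symmetric]) (auto simp: ennreal_mult ennreal_power[symmetric])
    also have "\<dots> = ennreal (2^n * (dist (X (r (Suc n))) (X (r n)))\<^sup>2)"
      by (subst nn_integral_cls) (auto simp: F cls_diff dist_norm ennreal_mult ennreal_power[symmetric])
    also have "\<dots> \<le> ennreal (2^n * ((1/2)^n)\<^sup>2)"
      by (intro ennreal_leI mult_left_mono power_mono fast) auto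
    also have "2^n * ((1/2::real)^n)\<^sup>2 = (1/2)^n"
    proof -
      have "2^n * (1/2::real)^n = 1" by (simp flip: power_mult_distrib)
      then show ?thesis by (simp only: power2_eq_square mult.assoc[symmetric])
    qed
    finally show ?thesis .
  qed
  then have "(\<Sum>n. \<integral>\<^sup>+x. ennreal (u n x) \<partial>lborel) \<le> (\<Sum>n. ennreal ((1/2)^n))"
    by (intro suminf_le) auto
  also have "\<dots> < \<infinity>"
    by (subst suminf_ennreal_eq[OF _ geometric_sums]) auto
  finally have "(\<integral>\<^sup>+x. (\<Sum>n. ennreal (u n x)) \<partial>lborel) < \<infinity>"
    by (subst nn_integral_suminf) auto
  then have "AE x in lborel. (\<Sum>n. ennreal (u n x)) \<noteq> \<infinity>"
    by (intro nn_integral_noteq_infinite) auto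
  then have conv: "AE x in lborel. convergent (\<lambda>n. F n x)"
  proof eventually_elim
    case (elim x)
    then have su: "summable (\<lambda>n. u n x)"
      by (intro summable_suminf_not_top) (auto simp: u_def)
    \<comment> \<open>AM-GM: the weights \<open>2^n\<close> turn square summability into summability\<close>
    have "cmod (F (Suc n) x - F n x) \<le> (1/2)^n + u n x" for n
    proof -
      have "0 \<le> (1/2::real)^n * (1 - 2^n * cmod (F (Suc n) x - F n x))\<^sup>2" by simp
      also have "\<dots> = (1/2)^n - 2 * cmod (F (Suc n) x - F n x) + u n x"
      proof -
        have "2^n * (1/2::real)^n = 1" by (simp flip: power_mult_distrib)
        moreover have "(1/2::real)^n * (1 - 2^n * y)\<^sup>2 =
            (1/2)^n - 2 * (2^n * (1/2)^n) * y + 2^n * (2^n * (1/2)^n) * y\<^sup>2" for y :: real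
          by (simp add: power2_eq_square algebra_simps del: power_divide power_one_over)
        ultimately have "(1/2::real)^n * (1 - 2^n * y)\<^sup>2 = (1/2)^n - 2 * y + 2^n * y\<^sup>2" for y :: real
          by simp
        then show ?thesis by (simp only: u_def)
      qed
      finally show ?thesis using norm_ge_zero[of "F (Suc n) x - F n x"] by linarith
    qed
    moreover have "summable (\<lambda>n. (1/2)^n + u n x)"
      by (intro summable_add su summable_geometric) simp
    ultimately have "summable (\<lambda>n. norm (F (Suc n) x - F n x))"
      by - (rule summable_comparison_test'[of "\<lambda>n. (1/2)^n + u n x" 0], simp_all)
    then have "summable (\<lambda>n. F (Suc n) x - F n x)"
      by (rule summable_norm_cancel)
    then have "convergent (\<lambda>n. F n x - F 0 x)"
      unfolding summable_iff_convergent sum_lessThan_telescope[of "\<lambda>n. F n x"] .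
    then have "convergent (\<lambda>n. (F n x - F 0 x) + F 0 x)"
      by (intro convergent_add convergent_const)
    then show ?case by simp
  qed
  define g where "g x = lim (\<lambda>n. F n x)" for x
  have [measurable]: "g \<in> borel_measurable borel" unfolding g_def by measurable
  have "Cauchy (\<lambda>n. cls (F n))"
    using Cauchy_subseq_Cauchy[OF X r] by (simp add: comp_def F)
  then have cau: "\<exists>N. \<forall>m\<ge>N. \<forall>n\<ge>N. norm (cls (F m) - cls (F n)) \<le> e" if "e > 0" for e
    using CauchyD[of "\<lambda>n. cls (F n)" e] that by (meson less_imp_le)
  have "AE x in lborel. (\<lambda>n. F n x) \<longlonglongrightarrow> g x"
    using conv by eventually_elim (simp add: g_def convergent_LIMSEQ_iff)
  then have "(\<lambda>n. cls (F n)) \<longlonglongrightarrow> cls g"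
    by (rule L2_AE_limit(2)[OF F(1)]) (use cau in auto)
  then have "X \<longlonglongrightarrow> cls g"
    by (intro Cauchy_converges_subseq[OF X r]) (simp add: comp_def F)
  then show "convergent X" by (rule convergentI)
qed

section \<open>The Fourier integral and the Poisson kernel\<close>

lemma borel_measurable_cis [measurable]:
  assumes "f \<in> borel_measurable M" shows "(\<lambda>x. cis (f x)) \<in> borel_measurable M"
  by (rule measurable_compose[OF assms, of cis borel])
     (auto intro!: borel_measurable_continuous_onI continuous_intros)

definition fourier_integral :: "(real \<Rightarrow> complex) \<Rightarrow> real \<Rightarrow> complex" where
  "fourier_integral f \<xi> = complex_of_real (1 / sqrt (2 * pi)) * (LINT x|lborel. f x * cis (- (\<xi> * x)))"

lemma truncated_fourier_eq:
  "truncated_fourier R f = fourier_integral (\<lambda>x. indicator {-R..R} x *\<^sub>R f x)"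
  by (simp add: truncated_fourier_def fourier_integral_def set_lebesgue_integral_def fun_eq_iff)

lemma borel_measurable_fourier_integral [measurable]:
  assumes [measurable]: "f \<in> borel_measurable borel"
  shows "fourier_integral f \<in> borel_measurable borel"
proof -
  have "(\<lambda>\<xi>. LINT x|lborel. f x * cis (- (\<xi> * x))) \<in> borel_measurable borel"
    by (rule lborel.borel_measurable_lebesgue_integral) measurable
  then show ?thesis unfolding fourier_integral_def[abs_def] by measurable
qed

lemma integrable_mult_unimodular:
  fixes f :: "real \<Rightarrow> complex"
  assumes "integrable lborel f" "u \<in> borel_measurable borel" "\<And>x. cmod (u x) \<le> 1"
  shows "integrable lborel (\<lambda>x. f x * u x)"
  by (rule Bochner_Integration.integrable_bound[OF assms(1)])
     (use assms in \<open>auto simp: norm_mult intro!: mult_left_le\<close>)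

lemma integrable_cis_mult [simp]:
  "integrable lborel f \<Longrightarrow> integrable lborel (\<lambda>x. f x * cis (- (\<xi> * x)))"
  by (rule integrable_mult_unimodular) auto

lemma fourier_integral_bound:
  assumes "integrable lborel f"
  shows "cmod (fourier_integral f \<xi>) \<le> (LINT x|lborel. cmod (f x))"
proof -
  have "cmod (LINT x|lborel. f x * cis (- (\<xi> * x))) \<le> (LINT x|lborel. cmod (f x * cis (- (\<xi> * x))))"
    by (rule integral_norm_bound)
  also have "\<dots> = (LINT x|lborel. cmod (f x))" by (simp add: norm_mult)
  finally have *: "cmod (LINT x|lborel. f x * cis (- (\<xi> * x))) \<le> (LINT x|lborel. cmod (f x))" .
  have "1 \<le> sqrt (2 * pi)" using pi_gt3 by (intro real_le_rsqrt) auto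
  then have "1 / sqrt (2 * pi) * cmod (LINT x|lborel. f x * cis (- (\<xi> * x))) \<le> 1 * (LINT x|lborel. cmod (f x))"
    by (intro mult_mono *) auto
  then show ?thesis by (simp add: fourier_integral_def norm_mult norm_divide)
qed

lemma integrable_pair_mult:
  fixes f g :: "real \<Rightarrow> complex"
  assumes f: "integrable lborel f" and g: "integrable lborel g"
    and [measurable]: "u \<in> borel_measurable (borel \<Otimes>\<^sub>M borel)" and u: "\<And>z. cmod (u z) \<le> 1"
  shows "integrable (lborel \<Otimes>\<^sub>M lborel) (\<lambda>(x, y). f x * g y * u (x, y))"
proof (rule lborel_pair.Fubini_integrable)
  note [measurable] = borel_measurable_integrable[OF f, simplified] borel_measurable_integrable[OF g, simplified]
  show meas: "(\<lambda>(x, y). f x * g y * u (x, y)) \<in> borel_measurable (lborel \<Otimes>\<^sub>M lborel)"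
    by measurable
  have *: "integrable lborel (\<lambda>y. f x * g y * u (x, y))" for x
    using integrable_mult_unimodular[OF integrable_mult_right[OF g, of "f x"], of "\<lambda>y. u (x, y)"] u by simp
  show "AE x in lborel. integrable lborel (\<lambda>y. case (x, y) of (x, y) \<Rightarrow> f x * g y * u (x, y))"
    by (simp add: *)
  show "integrable lborel (\<lambda>x. LINT y|lborel. norm (case (x, y) of (x, y) \<Rightarrow> f x * g y * u (x, y)))"
  proof (rule Bochner_Integration.integrable_bound)
    show "integrable lborel (\<lambda>x. cmod (f x) * (LINT y|lborel. cmod (g y)))"
      using f by auto
    show "(\<lambda>x. LINT y|lborel. norm (case (x, y) of (x, y) \<Rightarrow> f x * g y * u (x, y))) \<in> borel_measurable lborel"
      by measurable
    have "(LINT y|lborel. norm (f x * g y * u (x, y))) \<le> (LINT y|lborel. cmod (f x) * cmod (g y))" for x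
      by (rule integral_mono)
         (use * g u in \<open>auto simp: norm_mult intro!: mult_left_le integrable_norm[OF *, simplified norm_mult]\<close>)
    then show "AE x in lborel. norm (LINT y|lborel. norm (case (x, y) of (x, y) \<Rightarrow> f x * g y * u (x, y)))
        \<le> norm (cmod (f x) * (LINT y|lborel. cmod (g y)))"
      by (simp add: integral_nonneg_AE)
  qed
qed

text \<open>
  Fubini's theorem. With \<open>g\<close> damping the frequencies this gives the isometry; extended to
  square-integrable functions it makes the conjugated transform an adjoint, which gives the inversion.
\<close>

lemma fourier_integral_mult_formula:
  assumes f: "integrable lborel f" and g: "integrable lborel g"
  shows "(LINT \<xi>|lborel. fourier_integral f \<xi> * g \<xi>) = (LINT x|lborel. f x * fourier_integral g x)"
proof -
  have "integrable (lborel \<Otimes>\<^sub>M lborel) (\<lambda>(x, \<xi>). f x * g \<xi> * (\<lambda>(x, \<xi>). cis (- (\<xi> * x))) (x, \<xi>))"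
    by (rule integrable_pair_mult[OF f g]) (measurable, auto)
  then have "(LINT \<xi>|lborel. LINT x|lborel. f x * g \<xi> * cis (- (\<xi> * x))) =
      (LINT x|lborel. LINT \<xi>|lborel. f x * g \<xi> * cis (- (\<xi> * x)))"
    by (intro lborel_pair.Fubini_integral) simp
  moreover have "(LINT x|lborel. f x * g \<xi> * cis (- (\<xi> * x))) = (LINT x|lborel. f x * cis (- (\<xi> * x))) * g \<xi>" for \<xi>
    by (subst integral_mult_left_zero[symmetric]) (simp add: mult_ac)
  moreover have "(LINT \<xi>|lborel. f x * g \<xi> * cis (- (\<xi> * x))) = f x * (LINT \<xi>|lborel. g \<xi> * cis (- (x * \<xi>)))" for x
    by (subst integral_mult_right_zero[symmetric]) (simp add: mult_ac)
  ultimately have *: "(LINT \<xi>|lborel. (LINT x|lborel. f x * cis (- (\<xi> * x))) * g \<xi>) =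
      (LINT x|lborel. f x * (LINT \<xi>|lborel. g \<xi> * cis (- (x * \<xi>))))" by simp
  let ?c = "complex_of_real (1 / sqrt (2 * pi))"
  have "(LINT \<xi>|lborel. fourier_integral f \<xi> * g \<xi>) =
      ?c * (LINT \<xi>|lborel. (LINT x|lborel. f x * cis (- (\<xi> * x))) * g \<xi>)"
    by (subst integral_mult_right_zero[symmetric]) (simp add: fourier_integral_def mult.assoc)
  also have "\<dots> = (LINT x|lborel. f x * fourier_integral g x)"
    unfolding * by (subst integral_mult_right_zero[symmetric])
      (simp add: fourier_integral_def mult.left_commute)
  finally show ?thesis .
qed

lemma fourier_integral_cnj: "fourier_integral (\<lambda>x. cnj (f x)) \<xi> = cnj (fourier_integral f (- \<xi>))"
proof -
  have "(LINT x|lborel. cnj (f x) * cis (- (\<xi> * x))) = (LINT x|lborel. cnj (f x * cis (- (- \<xi> * x))))"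
    by (simp add: cis_cnj)
  also have "\<dots> = cnj (LINT x|lborel. f x * cis (- (- \<xi> * x)))"
    by (rule Bochner_Integration.integral_cnj)
  finally show ?thesis by (simp add: fourier_integral_def)
qed

lemma fourier_integral_shift:
  "fourier_integral (\<lambda>x. f (x + h)) \<xi> = cis (\<xi> * h) * fourier_integral f \<xi>"
proof -
  have "(LINT x|lborel. f x * cis (- (\<xi> * x))) = (LINT x|lborel. f (h + x) * cis (- (\<xi> * (h + x))))"
    using lborel_integral_real_affine[of 1 "\<lambda>x. f x * cis (- (\<xi> * x))" h] by simp
  also have "\<dots> = (LINT x|lborel. cis (- (\<xi> * h)) * (f (x + h) * cis (- (\<xi> * x))))"
  proof (intro Bochner_Integration.integral_cong refl)
    fix x
    have "cis (- (\<xi> * (h + x))) = cis (- (\<xi> * h)) * cis (- (\<xi> * x))"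
      by (simp add: cis_mult algebra_simps)
    then show "f (h + x) * cis (- (\<xi> * (h + x))) = cis (- (\<xi> * h)) * (f (x + h) * cis (- (\<xi> * x)))"
      by (simp add: add.commute)
  qed
  also have "\<dots> = cis (- (\<xi> * h)) * (LINT x|lborel. f (x + h) * cis (- (\<xi> * x)))"
    by simp
  finally have "cis (\<xi> * h) * (LINT x|lborel. f x * cis (- (\<xi> * x))) = (LINT x|lborel. f (x + h) * cis (- (\<xi> * x)))"
    by (simp add: cis_mult flip: mult.assoc)
  then show ?thesis
    by (simp add: fourier_integral_def)
qed

text \<open>
  Folding at the origin removes the absolute value from exponentials in \<open>\<bar>x\<bar>\<close> and
  exhibits the cancellation of odd integrands.
\<close>

lemma integral_half_line:
  fixes f :: "real \<Rightarrow> 'a :: {banach, second_countable_topology}"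
  assumes f: "integrable lborel f"
  shows "(LINT x|lborel. f x) = (LINT x:{0<..}|lborel. f x + f (- x))"
proof -
  have i: "set_integrable lborel {0<..} f" "set_integrable lborel {..<0} f"
    using f by (auto intro!: integrable_mult_indicator simp: set_integrable_def)
  have i': "set_integrable lborel {0<..} (\<lambda>x. f (- x))"
    using lborel_integrable_real_affine[OF f, of "-1" 0]
    by (auto intro!: integrable_mult_indicator simp: set_integrable_def)
  have "(LINT x|lborel. f x) = (LINT x:{0<..} \<union> {..<0}|lborel. f x)"
    unfolding set_lebesgue_integral_def
  proof (rule integral_cong_AE)
    have "AE x in lborel. x \<noteq> (0::real)" by (rule AE_lborel_singleton)
    then show "AE x in lborel. f x = indicat_real ({0<..} \<union> {..<0}) x *\<^sub>R f x"
      by eventually_elim (auto simp: indicator_def)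
  qed (use f in \<open>auto intro!: borel_measurable_scaleR dest: borel_measurable_integrable\<close>)
  also have "\<dots> = (LINT x:{0<..}|lborel. f x) + (LINT x:{..<0}|lborel. f x)"
    by (rule set_integral_Un) (use i in auto)
  also have "(LINT x:{..<0}|lborel. f x) = (LINT x:{0<..}|lborel. f (- x))"
    unfolding set_lebesgue_integral_def
    by (subst lborel_integral_real_affine[of "-1" _ 0])
       (auto intro!: Bochner_Integration.integral_cong simp: indicator_def)
  also have "(LINT x:{0<..}|lborel. f x) + (LINT x:{0<..}|lborel. f (- x)) = (LINT x:{0<..}|lborel. f x + f (- x))"
    by (rule set_integral_add(2)[symmetric]) (use i i' in auto)
  finally show ?thesis .
qed

lemma integrable_exp_half_line:
  assumes b: "b > (0::real)"
  shows "set_integrable lborel {0<..} (\<lambda>x. exp (- b * x))"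
proof -
  have lim: "((\<lambda>x. - exp (- b * x) / b) \<longlongrightarrow> 0) at_top"
    using b by real_asymp
  have "set_integrable lborel (einterval 0 \<infinity>) (\<lambda>x. exp (- b * x))"
  proof (rule interval_integral_FTC_nonneg(1))
    show "((\<lambda>x. - exp (- b * x) / b) has_real_derivative exp (- b * x)) (at x)" for x
      using b by (auto intro!: derivative_eq_intros)
    show "(((\<lambda>x. - exp (- b * x) / b) \<circ> real_of_ereal) \<longlongrightarrow> -1 / b) (at_right 0)"
      unfolding zero_ereal_def ereal_tendsto_simps
      by (rule tendsto_eq_intros | use b in simp)+
    show "(((\<lambda>x. - exp (- b * x) / b) \<circ> real_of_ereal) \<longlongrightarrow> 0) (at_left \<infinity>)"
      unfolding ereal_tendsto_simps by (rule lim)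
  qed auto
  then show ?thesis by (simp add: zero_ereal_def)
qed

lemma integrable_exp_abs:
  assumes b: "b > (0::real)"
  shows "integrable lborel (\<lambda>x. exp (- b * \<bar>x\<bar>))"
proof -
  have 1: "integrable lborel (\<lambda>x. indicator {0<..} x *\<^sub>R exp (- b * x))"
    using integrable_exp_half_line[OF b] by (simp add: set_integrable_def)
  have "integrable lborel (\<lambda>x. indicator {0<..} x *\<^sub>R exp (- b * x) + indicator {0<..} (- x) *\<^sub>R exp (- b * (- x)))"
    using lborel_integrable_real_affine[OF 1, of "-1" 0] 1 by (intro Bochner_Integration.integrable_add) auto
  moreover have "AE x in lborel. exp (- b * \<bar>x\<bar>) =
      indicator {0<..} x *\<^sub>R exp (- b * x) + indicator {0<..} (- x) *\<^sub>R exp (- b * (- x))"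
    using AE_lborel_singleton[of 0] by eventually_elim (auto simp: indicator_def)
  ultimately show ?thesis
    by (subst integrable_cong_AE) auto
qed

text \<open>
  The integrand, folded onto the half-line, has an elementary primitive.
\<close>

lemma integral_exp_abs_cos:
  fixes y :: real
  assumes b: "b > 0"
  shows "(LINT x|lborel. exp (- b * \<bar>x\<bar>) * cos (y * x)) = 2 * b / (b\<^sup>2 + y\<^sup>2)"
proof -
  have i: "integrable lborel (\<lambda>x. exp (- b * \<bar>x\<bar>) * cos (y * x))"
    by (rule Bochner_Integration.integrable_bound[OF integrable_exp_abs[OF b]])
       (auto simp: abs_mult intro!: mult_left_le)
  have pos: "b\<^sup>2 + y\<^sup>2 > 0" using b by (simp add: add_pos_nonneg)
  define F where "F x = 2 * exp (- b * x) * (y * sin (y * x) - b * cos (y * x)) / (b\<^sup>2 + y\<^sup>2)" for x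
  have "(LINT x|lborel. exp (- b * \<bar>x\<bar>) * cos (y * x)) =
      (LINT x:{0<..}|lborel. exp (- b * \<bar>x\<bar>) * cos (y * x) + exp (- b * \<bar>- x\<bar>) * cos (y * - x))"
    by (rule integral_half_line[OF i])
  also have "\<dots> = (LINT x:{0<..}|lborel. 2 * exp (- b * x) * cos (y * x))"
    by (rule set_lebesgue_integral_cong) auto
  also have "\<dots> = (LBINT x=ereal 0..\<infinity>. 2 * exp (- b * x) * cos (y * x))"
    by (simp add: interval_lebesgue_integral_def)
  also have "\<dots> = 0 - F 0"
  proof (rule interval_integral_FTC_integrable)
    show "(F has_vector_derivative 2 * exp (- b * x) * cos (y * x)) (at x)" for x
    proof -
      let ?K = "2 / (b\<^sup>2 + y\<^sup>2)"
      have "((\<lambda>x. ?K * (exp (- b * x) * (y * sin (y * x) - b * cos (y * x)))) has_real_derivative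
          ?K * (exp (- b * x) * ((b\<^sup>2 + y\<^sup>2) * cos (y * x)))) (at x)"
        by (rule DERIV_cmult, (rule derivative_eq_intros refl)+) (simp add: algebra_simps power2_eq_square)
      moreover have "?K * (exp (- b * x) * ((b\<^sup>2 + y\<^sup>2) * cos (y * x))) = 2 * exp (- b * x) * cos (y * x)"
        using pos[THEN less_imp_neq] by (simp del: sum_power2_eq_zero_iff)
      moreover have "F = (\<lambda>x. ?K * (exp (- b * x) * (y * sin (y * x) - b * cos (y * x))))"
        by (simp add: F_def fun_eq_iff)
      ultimately show ?thesis by (simp add: has_real_derivative_iff_has_vector_derivative)
    qed
    show "set_integrable lborel (einterval (ereal 0) \<infinity>) (\<lambda>x. 2 * exp (- b * x) * cos (y * x))"
      unfolding einterval_eq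
      by (rule set_integrable_bound[OF set_integrable_mult_right[OF integrable_exp_half_line[OF b], of 2]])
         (auto simp: set_borel_measurable_def abs_mult intro!: mult_left_le)
    show "((F \<circ> real_of_ereal) \<longlongrightarrow> F 0) (at_right (ereal 0))"
      unfolding ereal_tendsto_simps F_def using pos by (intro tendsto_intros) auto
    have l: "((\<lambda>x. 2 * exp (- b * x) * (\<bar>y\<bar> + \<bar>b\<bar>) / (b\<^sup>2 + y\<^sup>2)) \<longlongrightarrow> 0) at_top"
      using b by real_asymp
    show "((F \<circ> real_of_ereal) \<longlongrightarrow> 0) (at_left \<infinity>)"
      unfolding ereal_tendsto_simps
    proof (rule Lim_null_comparison[OF always_eventually l], intro allI)
      fix x
      have "\<bar>y * sin (y * x) - b * cos (y * x)\<bar> \<le> \<bar>y * sin (y * x)\<bar> + \<bar>b * cos (y * x)\<bar>" by simp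
      also have "\<dots> \<le> \<bar>y\<bar> + \<bar>b\<bar>" by (intro add_mono) (auto simp: abs_mult intro!: mult_left_le)
      finally have *: "\<bar>y * sin (y * x) - b * cos (y * x)\<bar> \<le> \<bar>y\<bar> + \<bar>b\<bar>" .
      show "norm (F x) \<le> 2 * exp (- b * x) * (\<bar>y\<bar> + \<bar>b\<bar>) / (b\<^sup>2 + y\<^sup>2)"
        using pos * by (auto simp: F_def abs_mult intro!: divide_right_mono mult_left_mono)
    qed
  qed (auto intro!: continuous_intros)
  also have "\<dots> = 2 * b / (b\<^sup>2 + y\<^sup>2)" by (simp add: F_def)
  finally show ?thesis .
qed

lemma fourier_integral_exp_abs:
  assumes b: "b > 0"
  shows "fourier_integral (\<lambda>x. complex_of_real (exp (- b * \<bar>x\<bar>))) y = complex_of_real (sqrt (2 / pi) * (b / (b\<^sup>2 + y\<^sup>2)))"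
proof -
  let ?f = "\<lambda>x. complex_of_real (exp (- b * \<bar>x\<bar>)) * cis (- (y * x))"
  have i: "integrable lborel ?f"
    using integrable_cis_mult[of "\<lambda>x. complex_of_real (exp (- b * \<bar>x\<bar>))" y] integrable_exp_abs[OF b] by simp
  have odd: "(LINT x|lborel. exp (- b * \<bar>x\<bar>) * sin (y * x)) = - (LINT x|lborel. exp (- b * \<bar>x\<bar>) * sin (y * x))"
    by (subst lborel_integral_real_affine[of "-1" _ 0]) auto
  have "(LINT x|lborel. ?f x) = complex_of_real (LINT x|lborel. Re (?f x)) + \<i> * complex_of_real (LINT x|lborel. Im (?f x))"
    by (rule complex_eqI) (simp_all only: integral_Re[OF i] integral_Im[OF i], simp_all)
  also have "(LINT x|lborel. Re (?f x)) = 2 * b / (b\<^sup>2 + y\<^sup>2)"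
    using integral_exp_abs_cos[OF b, of y] by simp
  also have "(LINT x|lborel. Im (?f x)) = 0"
    using odd by simp
  finally have "fourier_integral (\<lambda>x. complex_of_real (exp (- b * \<bar>x\<bar>))) y =
      complex_of_real (1 / sqrt (2 * pi) * (2 * b / (b\<^sup>2 + y\<^sup>2)))"
    by (simp add: fourier_integral_def)
  also have "1 / sqrt (2 * pi) * (2 * b / (b\<^sup>2 + y\<^sup>2)) = sqrt (2 / pi) * (b / (b\<^sup>2 + y\<^sup>2))"
  proof -
    have "1 / sqrt (2 * pi) * 2 = sqrt (2 / pi)"
      by (simp add: real_sqrt_mult real_sqrt_divide field_simps)
    then show ?thesis by (metis times_divide_eq_right mult.assoc)
  qed
  finally show ?thesis .
qed

lemma integral_inverse_one_plus_sq:
  "integrable lborel (\<lambda>y::real. 1 / (1 + y\<^sup>2))" "(LINT y|lborel. 1 / (1 + (y::real)\<^sup>2)) = pi"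
proof -
  have d: "(arctan has_real_derivative 1 / (1 + x\<^sup>2)) (at x)" for x
    using DERIV_arctan[of x] by (simp add: inverse_eq_divide)
  have c: "isCont (\<lambda>y::real. 1 / (1 + y\<^sup>2)) x" for x
    by (intro continuous_intros) (metis add_pos_nonneg less_irrefl zero_le_power2 zero_less_one)
  have l1: "((arctan \<circ> real_of_ereal) \<longlongrightarrow> - (pi/2)) (at_right (-\<infinity>))"
    unfolding ereal_tendsto_simps by (rule tendsto_arctan_at_bot)
  have l2: "((arctan \<circ> real_of_ereal) \<longlongrightarrow> pi/2) (at_left \<infinity>)"
    unfolding ereal_tendsto_simps by (rule tendsto_arctan_at_top)
  have lt: "(-\<infinity>::ereal) < \<infinity>" by simp
  have nn: "AE x in lborel. (-\<infinity>::ereal) < ereal x \<longrightarrow> ereal x < \<infinity> \<longrightarrow> 0 \<le> 1 / (1 + x\<^sup>2)" by simp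
  note FTC = interval_integral_FTC_nonneg[OF lt d c nn l1 l2]
  show "integrable lborel (\<lambda>y::real. 1 / (1 + y\<^sup>2))"
    using FTC(1) by (simp add: set_integrable_def)
  show "(LINT y|lborel. 1 / (1 + (y::real)\<^sup>2)) = pi"
    using FTC(2) by (simp add: interval_lebesgue_integral_def set_lebesgue_integral_def)
qed

section \<open>Continuity of translations\<close>

text \<open>
  Translations act continuously on integrable functions. The property is named because it is proved
  by approximation: first for open sets, then for Borel sets, then for all integrable functions.
\<close>

definition L1_translation_continuous :: "(real \<Rightarrow> complex) \<Rightarrow> bool" where
  "L1_translation_continuous f \<longleftrightarrow> ((\<lambda>z. LINT x|lborel. cmod (f (x + z) - f x)) \<longlongrightarrow> 0) (at 0)"

lemma integrable_shift:
  fixes f :: "real \<Rightarrow> 'a :: {banach, second_countable_topology}"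
  shows "integrable lborel f \<Longrightarrow> integrable lborel (\<lambda>x. f (x + z))"
  using lborel_integrable_real_affine[of f 1 z] by (simp add: add.commute)

lemma integral_shift:
  fixes f :: "real \<Rightarrow> 'a :: {banach, second_countable_topology}"
  shows "(LINT x|lborel. f (x + z)) = (LINT x|lborel. f x)"
  using lborel_integral_real_affine[of 1 f z] by (simp add: add.commute)

lemma integrable_indicator_complex:
  "A \<in> sets borel \<Longrightarrow> emeasure lborel A < \<infinity> \<Longrightarrow> integrable lborel (\<lambda>x::real. indicator A x :: complex)"
  using integrable_indicator[of A lborel "1::complex"] by (simp add: scaleR_conv_of_real of_real_indicator)

lemma L1_translation_approx:
  assumes f: "integrable lborel f"
    and approx: "\<And>e. e > 0 \<Longrightarrow> \<exists>g. integrable lborel g \<and> L1_translation_continuous g \<and> (LINT x|lborel. cmod (f x - g x)) \<le> e"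
  shows "L1_translation_continuous f"
  unfolding L1_translation_continuous_def
proof (rule tendstoI)
  fix e :: real assume e: "e > 0"
  obtain g where g: "integrable lborel g" "L1_translation_continuous g" "(LINT x|lborel. cmod (f x - g x)) \<le> e/3"
    using approx[of "e/3"] e by auto
  have "\<forall>\<^sub>F z in at 0. dist (LINT x|lborel. cmod (g (x + z) - g x)) 0 < e/3"
    using g(2) e unfolding L1_translation_continuous_def by (intro tendstoD) auto
  then show "\<forall>\<^sub>F z in at 0. dist (LINT x|lborel. cmod (f (x + z) - f x)) 0 < e"
  proof eventually_elim
    case (elim z)
    note int = f g(1) integrable_shift[OF f] integrable_shift[OF g(1)]
    have "(LINT x|lborel. cmod (f (x + z) - f x)) \<le>
        (LINT x|lborel. cmod (f (x + z) - g (x + z)) + cmod (g (x + z) - g x) + cmod (f x - g x))"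
    proof (rule integral_mono)
      fix x
      have "f (x + z) - f x = (f (x + z) - g (x + z)) + (g (x + z) - g x) - (f x - g x)" by simp
      then show "cmod (f (x + z) - f x) \<le> cmod (f (x + z) - g (x + z)) + cmod (g (x + z) - g x) + cmod (f x - g x)"
        using norm_triangle_ineq4[of "(f (x + z) - g (x + z)) + (g (x + z) - g x)" "f x - g x"]
          norm_triangle_ineq[of "f (x + z) - g (x + z)" "g (x + z) - g x"] by (simp only:)
    qed (use int in auto)
    also have "\<dots> = (LINT x|lborel. cmod (f (x + z) - g (x + z))) + (LINT x|lborel. cmod (g (x + z) - g x)) + (LINT x|lborel. cmod (f x - g x))"
      using int by simp
    also have "(LINT x|lborel. cmod (f (x + z) - g (x + z))) = (LINT x|lborel. cmod (f x - g x))"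
      by (rule integral_shift)
    finally show ?case using g(3) elim
      by (simp add: integral_nonneg_AE)
  qed
qed

text \<open>
  For open \<open>U\<close> the indicator of \<open>U\<close> is lower semicontinuous, so on \<open>U\<close> its small translates are eventually
  \<open>1\<close>. Hence the overlap of \<open>U\<close> with its translate tends to the measure of \<open>U\<close>, and the measure of the
  symmetric difference is determined by the overlap.
\<close>

lemma L1_translation_open:
  assumes U: "open U" and fin: "emeasure lborel U < \<infinity>"
  shows "L1_translation_continuous (\<lambda>x. indicator U x)"
  unfolding L1_translation_continuous_def tendsto_at_iff_sequentially comp_def
proof (intro allI impI)
  fix Z :: "nat \<Rightarrow> real" assume Z: "\<forall>i. Z i \<in> UNIV - {0}" "Z \<longlonglongrightarrow> 0"
  let ?u = "\<lambda>x. indicator U x :: real"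
  have [measurable]: "U \<in> sets borel" using U by simp
  have i: "integrable lborel ?u" using fin by (auto intro!: integrable_real_indicator)
  have i2: "integrable lborel (\<lambda>x. ?u (x + z) * ?u x)" for z
    by (rule Bochner_Integration.integrable_bound[OF i]) (auto simp: indicator_def)
  have "(\<lambda>n. LINT x|lborel. ?u (x + Z n) * ?u x) \<longlonglongrightarrow> (LINT x|lborel. ?u x)"
  proof (rule integral_dominated_convergence[where w = ?u])
    show "AE x in lborel. (\<lambda>n. ?u (x + Z n) * ?u x) \<longlonglongrightarrow> ?u x"
    proof (intro AE_I2)
      fix x
      show "(\<lambda>n. ?u (x + Z n) * ?u x) \<longlonglongrightarrow> ?u x"
      proof (cases "x \<in> U")
        case True
        have "(\<lambda>n. x + Z n) \<longlonglongrightarrow> x + 0" by (intro tendsto_intros Z)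
        then have "\<forall>\<^sub>F n in sequentially. x + Z n \<in> U"
          using topological_tendstoD[OF _ U] True by auto
        then have "\<forall>\<^sub>F n in sequentially. ?u (x + Z n) * ?u x = ?u x"
          by eventually_elim simp
        then show ?thesis by (rule tendsto_eventually)
      qed auto
    qed
  qed (auto simp: i split: split_indicator)
  then have "(\<lambda>n. 2 * (LINT x|lborel. ?u x) - 2 * (LINT x|lborel. ?u (x + Z n) * ?u x)) \<longlonglongrightarrow>
      2 * (LINT x|lborel. ?u x) - 2 * (LINT x|lborel. ?u x)"
    by (intro tendsto_intros)
  moreover have "(LINT x|lborel. cmod (indicator U (x + z) - indicator U x)) =
      2 * (LINT x|lborel. ?u x) - 2 * (LINT x|lborel. ?u (x + z) * ?u x)" for z
  proof -
    have "(LINT x|lborel. cmod (indicator U (x + z) - indicator U x)) =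
        (LINT x|lborel. ?u (x + z) + ?u x - 2 * (?u (x + z) * ?u x))"
      by (intro Bochner_Integration.integral_cong) (auto simp: indicator_def)
    also have "\<dots> = (LINT x|lborel. ?u (x + z)) + (LINT x|lborel. ?u x) - (LINT x|lborel. 2 * (?u (x + z) * ?u x))"
      using i i2 integrable_shift[OF i] by simp
    finally show ?thesis by (simp add: integral_shift)
  qed
  ultimately show "(\<lambda>n. LINT x|lborel. cmod (indicator U (x + Z n) - indicator U x)) \<longlonglongrightarrow> 0"
    by simp
qed

lemma L1_translation_cmult:
  assumes "L1_translation_continuous f"
  shows "L1_translation_continuous (\<lambda>x. c * f x)"
proof -
  have "(LINT x|lborel. cmod (c * f (x + z) - c * f x)) = cmod c * (LINT x|lborel. cmod (f (x + z) - f x))" for z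
    by (simp add: norm_mult flip: right_diff_distrib)
  moreover have "((\<lambda>z. cmod c * (LINT x|lborel. cmod (f (x + z) - f x))) \<longlongrightarrow> cmod c * 0) (at 0)"
    using assms unfolding L1_translation_continuous_def by (intro tendsto_intros)
  ultimately show ?thesis unfolding L1_translation_continuous_def by simp
qed

lemma L1_translation:
  assumes "integrable lborel f" shows "L1_translation_continuous f"
  using assms
proof (induct rule: integrable_induct)
  case (base A c)
  have A: "A \<in> sets borel" using base(1) by simp
  have "L1_translation_continuous (\<lambda>x. indicator A x)"
  proof (rule L1_translation_approx)
    show iA: "integrable lborel (\<lambda>x. indicator A x :: complex)"
      using base by (auto intro: integrable_indicator_complex)
    fix e :: real assume e: "e > 0"
    obtain U where U: "open U" "A \<subseteq> U" "emeasure lborel (U - A) < ennreal e"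
      using outer_regular_lborel[OF A e] by metis
    have [measurable]: "U \<in> sets borel" "A \<in> sets borel" using U A by auto
    have "emeasure lborel U \<le> emeasure lborel A + emeasure lborel (U - A)"
      using emeasure_subadditive[of A lborel "U - A"] U(2) by (simp add: Un_absorb1)
    also have "\<dots> < \<infinity>" using base(2) U(3) by (auto simp: ennreal_add_less_top dest: less_trans[OF _ ennreal_less_top])
    finally have finU: "emeasure lborel U < \<infinity>" .
    have "(LINT x|lborel. cmod (indicator A x - indicator U x)) = (LINT x|lborel. indicat_real (U - A) x)"
      using U(2) by (intro Bochner_Integration.integral_cong) (auto simp: indicator_def)
    also have "\<dots> = measure lborel (U - A)" by simp
    also have "\<dots> \<le> e" using U(3) e by (auto simp: measure_def intro!: enn2real_leI)
    finally show "\<exists>g. integrable lborel g \<and> L1_translation_continuous g \<and> (LINT x|lborel. cmod (indicator A x - g x)) \<le> e"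
      using L1_translation_open[OF U(1) finU] finU
      by (intro exI[of _ "\<lambda>x. indicator U x"]) (auto intro!: integrable_indicator_complex)
  qed
  from L1_translation_cmult[OF this, of c] show ?case
    by (simp add: scaleR_conv_of_real mult.commute of_real_indicator)
next
  case (add f g)
  show ?case unfolding L1_translation_continuous_def
  proof (rule tendsto_sandwich[of "\<lambda>_. 0"])
    note int = add(1,3) integrable_shift[OF add(1)] integrable_shift[OF add(3)]
    show "\<forall>\<^sub>F z in at 0. (LINT x|lborel. cmod (f (x + z) + g (x + z) - (f x + g x))) \<le>
        (LINT x|lborel. cmod (f (x + z) - f x)) + (LINT x|lborel. cmod (g (x + z) - g x))"
    proof (intro always_eventually allI)
      fix z
      have "(LINT x|lborel. cmod (f (x + z) + g (x + z) - (f x + g x))) \<le>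
          (LINT x|lborel. cmod (f (x + z) - f x) + cmod (g (x + z) - g x))"
        by (rule integral_mono) (use int in \<open>auto intro: norm_diff_triangle_ineq\<close>)
      then show "(LINT x|lborel. cmod (f (x + z) + g (x + z) - (f x + g x))) \<le>
        (LINT x|lborel. cmod (f (x + z) - f x)) + (LINT x|lborel. cmod (g (x + z) - g x))"
        using int by simp
    qed
    show "((\<lambda>z. (LINT x|lborel. cmod (f (x + z) - f x)) + (LINT x|lborel. cmod (g (x + z) - g x))) \<longlongrightarrow> 0) (at 0)"
      using add(2,4) unfolding L1_translation_continuous_def by (auto intro: tendsto_eq_intros)
  qed (auto intro!: always_eventually integral_nonneg_AE)
next
  case (lim f s)
  show ?case
  proof (rule L1_translation_approx[OF lim(5)])
    fix e :: real assume e: "e > 0"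
    have "(\<lambda>i. LINT x|lborel. cmod (f x - s i x)) \<longlonglongrightarrow> (LINT (x::real)|lborel. 0 :: real)"
    proof (rule integral_dominated_convergence[where w = "\<lambda>x. 3 * cmod (f x)"])
      show "AE x in lborel. (\<lambda>i. cmod (f x - s i x)) \<longlonglongrightarrow> 0"
      proof (intro AE_I2)
        fix x :: real
        have "(\<lambda>i. s i x) \<longlonglongrightarrow> f x" by (rule lim(3)) simp
        then have "(\<lambda>i. cmod (f x - s i x)) \<longlonglongrightarrow> cmod (f x - f x)" by (intro tendsto_intros)
        then show "(\<lambda>i. cmod (f x - s i x)) \<longlonglongrightarrow> 0" by simp
      qed
      show "AE x in lborel. norm (cmod (f x - s i x)) \<le> 3 * cmod (f x)" for i
      proof (intro AE_I2)
        fix x :: real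
        have "cmod (f x - s i x) \<le> cmod (f x) + cmod (s i x)" by (rule norm_triangle_ineq4)
        then show "norm (cmod (f x - s i x)) \<le> 3 * cmod (f x)" using lim(4)[of x i] by simp
      qed
    qed (use lim(1,5) in \<open>auto dest!: borel_measurable_integrable\<close>)
    then have "\<forall>\<^sub>F i in sequentially. (LINT x|lborel. cmod (f x - s i x)) < e"
      using e by (intro order_tendstoD(2)[where y=0]) auto
    then obtain i where "(LINT x|lborel. cmod (f x - s i x)) < e"
      by (meson eventually_happens sequentially_bot)
    then show "\<exists>g. integrable lborel g \<and> L1_translation_continuous g \<and> (LINT x|lborel. cmod (f x - g x)) \<le> e"
      using lim(1,2) by (intro exI[of _ "s i"]) simp
  qed
qed

lemma L2_shift [simp, intro]: "f \<in> L2 \<Longrightarrow> (\<lambda>x. f (x + z)) \<in> L2"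
  using integrable_shift[OF L2_integrable, of f z] by (auto simp: L2_def)

lemma norm_cls_shift: "f \<in> L2 \<Longrightarrow> norm (cls (\<lambda>x. f (x + z))) = norm (cls f)"
  using norm_cls_sq[of f] norm_cls_sq[of "\<lambda>x. f (x + z)"] integral_shift[of "\<lambda>x. (cmod (f x))\<^sup>2" z]
  by (metis L2_shift norm_ge_zero power2_eq_iff_nonneg)

lemma norm_cls_le:
  assumes "f \<in> L2" "g \<in> L2" "AE x in lborel. cmod (f x) \<le> cmod (g x)"
  shows "norm (cls f) \<le> norm (cls g)"
proof (rule power2_le_imp_le)
  show "(norm (cls f))\<^sup>2 \<le> (norm (cls g))\<^sup>2"
    unfolding norm_cls_sq[OF assms(1)] norm_cls_sq[OF assms(2)]
    by (rule integral_mono_AE)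
       (use assms in \<open>auto intro: L2_integrable power_mono elim!: eventually_mono\<close>)
qed simp

lemma L2_norm [simp, intro]: "f \<in> L2 \<Longrightarrow> (\<lambda>x. complex_of_real (cmod (f x))) \<in> L2"
  by (auto simp: L2_def)

lemma L2_Cauchy_Schwarz:
  assumes "f \<in> L2" "g \<in> L2"
  shows "cmod (LINT x|lborel. f x * g x) \<le> norm (cls f) * norm (cls g)"
proof -
  let ?f = "\<lambda>x. complex_of_real (cmod (f x))" and ?g = "\<lambda>x. complex_of_real (cmod (g x))"
  have "cmod (LINT x|lborel. f x * g x) \<le> (LINT x|lborel. cmod (f x * g x))"
    by (rule integral_norm_bound)
  also have "\<dots> = inner (cls ?f) (cls ?g)"
    using assms by (simp add: inner_cls norm_mult)
  also have "\<dots> \<le> norm (cls ?f) * norm (cls ?g)" by (rule norm_cauchy_schwarz)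
  also have "\<dots> \<le> norm (cls f) * norm (cls g)"
    using assms by (intro mult_mono norm_cls_le) auto
  finally show ?thesis .
qed

lemma cls_tendsto_dominated:
  fixes F :: "nat \<Rightarrow> real \<Rightarrow> complex"
  assumes F: "\<And>n. F n \<in> borel_measurable borel" and f: "f \<in> L2"
    and lim: "\<And>x. (\<lambda>n. F n x) \<longlonglongrightarrow> f x" and le: "\<And>n x. cmod (F n x) \<le> cmod (f x)"
  shows "F n \<in> L2" "(\<lambda>n. cls (F n)) \<longlonglongrightarrow> cls f"
proof -
  show F2: "F n \<in> L2" for n
    by (rule L2_dominated[where g="\<lambda>x. (cmod (f x))\<^sup>2"]) (auto simp: F L2_integrable f intro!: power_mono le)
  have [measurable]: "f \<in> borel_measurable borel" "F n \<in> borel_measurable borel" for n using f F by auto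
  have "(\<lambda>n. LINT x|lborel. (cmod (F n x - f x))\<^sup>2) \<longlonglongrightarrow> (LINT (x::real)|lborel. 0 :: real)"
  proof (rule integral_dominated_convergence[where w = "\<lambda>x. 4 * (cmod (f x))\<^sup>2"])
    show "AE x in lborel. (\<lambda>n. (cmod (F n x - f x))\<^sup>2) \<longlonglongrightarrow> 0"
    proof (intro AE_I2)
      fix x
      have "(\<lambda>n. (cmod (F n x - f x))\<^sup>2) \<longlonglongrightarrow> (cmod (f x - f x))\<^sup>2" by (intro tendsto_intros lim)
      then show "(\<lambda>n. (cmod (F n x - f x))\<^sup>2) \<longlonglongrightarrow> 0" by simp
    qed
    show "AE x in lborel. norm ((cmod (F n x - f x))\<^sup>2) \<le> 4 * (cmod (f x))\<^sup>2" for n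
    proof (intro AE_I2)
      fix x
      have "cmod (F n x - f x) \<le> 2 * cmod (f x)"
        using norm_triangle_ineq4[of "F n x" "f x"] le[of n x] by linarith
      then have "(cmod (F n x - f x))\<^sup>2 \<le> (2 * cmod (f x))\<^sup>2" by (intro power_mono) auto
      then show "norm ((cmod (F n x - f x))\<^sup>2) \<le> 4 * (cmod (f x))\<^sup>2" by (simp add: power_mult_distrib)
    qed
  qed (use f in \<open>auto simp: L2_integrable\<close>)
  then have "(\<lambda>n. (norm (cls (F n) - cls f))\<^sup>2) \<longlonglongrightarrow> 0"
    using F2 f by (simp add: norm_cls_sq flip: cls_diff)
  then have "(\<lambda>n. sqrt ((norm (cls (F n) - cls f))\<^sup>2)) \<longlonglongrightarrow> sqrt 0" by (intro tendsto_intros)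
  then show "(\<lambda>n. cls (F n)) \<longlonglongrightarrow> cls f"
    by (simp add: LIM_zero_iff tendsto_norm_zero_iff)
qed

text \<open>
  Where \<open>f\<close> is bounded by \<open>n\<close>, a squared difference is at most \<open>2 n\<close> times the difference, which reduces
  the claim to continuity in the mean. Cutting off large values costs little in norm.
\<close>

lemma L2_translation:
  assumes f: "f \<in> L2" and fi: "integrable lborel f"
  shows "((\<lambda>z. cls (\<lambda>x. f (x + z))) \<longlongrightarrow> cls f) (at 0)"
proof (rule tendstoI)
  fix e :: real assume e: "e > 0"
  have [measurable]: "f \<in> borel_measurable borel" using f by auto
  \<comment> \<open>the cut-off functions are dominated by \<open>f\<close>, so they converge in norm\<close>
  define F where "F n x = (if cmod (f x) \<le> real n then f x else 0)" for n x
  have Fm: "F n \<in> borel_measurable borel" for n unfolding F_def by measurable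
  have lim: "(\<lambda>n. F n x) \<longlonglongrightarrow> f x" for x
  proof (rule tendsto_eventually)
    obtain N where "cmod (f x) \<le> real N" using real_arch_simple by auto
    then show "\<forall>\<^sub>F n in sequentially. F n x = f x"
      unfolding eventually_sequentially F_def by (intro exI[of _ N]) auto
  qed
  have le: "cmod (F n x) \<le> cmod (f x)" for n x by (simp add: F_def)
  note F = cls_tendsto_dominated[of F f, OF Fm f lim le]
  obtain n where n: "norm (cls (F n) - cls f) < e/4"
    using LIMSEQ_D[OF F(2), of "e/4"] e by auto
  have Fi: "integrable lborel (F n)"
    by (rule Bochner_Integration.integrable_bound[OF fi]) (use Fm le in auto)
  have "L1_translation_continuous (F n)" by (rule L1_translation[OF Fi])
  then have "((\<lambda>z. 2 * real n * (LINT x|lborel. cmod (F n (x + z) - F n x))) \<longlongrightarrow> 2 * real n * 0) (at 0)"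
    unfolding L1_translation_continuous_def by (intro tendsto_intros)
  then have "\<forall>\<^sub>F z in at 0. 2 * real n * (LINT x|lborel. cmod (F n (x + z) - F n x)) < (e/4)\<^sup>2"
    by (rule order_tendstoD(2)) (use e in auto)
  then show "\<forall>\<^sub>F z in at 0. dist (cls (\<lambda>x. f (x + z))) (cls f) < e"
  proof eventually_elim
    case (elim z)
    have "(norm (cls (\<lambda>x. F n (x + z)) - cls (F n)))\<^sup>2 = (LINT x|lborel. (cmod (F n (x + z) - F n x))\<^sup>2)"
      using F(1)[of n] by (simp add: norm_cls_sq flip: cls_diff)
    also have "\<dots> \<le> (LINT x|lborel. 2 * real n * cmod (F n (x + z) - F n x))"
    proof (rule integral_mono)
      fix x
      have "cmod (F n (x + z) - F n x) \<le> 2 * real n"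
        using norm_triangle_ineq4[of "F n (x + z)" "F n x"] by (auto simp: F_def split: if_splits)
      then show "(cmod (F n (x + z) - F n x))\<^sup>2 \<le> 2 * real n * cmod (F n (x + z) - F n x)"
        by (simp add: power2_eq_square mult_right_mono)
    qed (use F(1)[of n] Fi integrable_shift[OF Fi, of z] in \<open>auto intro: L2_integrable\<close>)
    also have "\<dots> < (e/4)\<^sup>2" using elim by simp
    finally have 1: "norm (cls (\<lambda>x. F n (x + z)) - cls (F n)) < e/4"
      by (rule power2_less_imp_less) (use e in simp)
    have 2: "norm (cls (\<lambda>x. f (x + z)) - cls (\<lambda>x. F n (x + z))) < e/4"
      using n norm_cls_shift[of "\<lambda>x. f x - F n x" z] f F(1)[of n]
      by (simp add: cls_diff norm_minus_commute)
    have "norm (cls (\<lambda>x. f (x + z)) - cls f) \<le> norm (cls (\<lambda>x. f (x + z)) - cls (\<lambda>x. F n (x + z)))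
        + norm (cls (\<lambda>x. F n (x + z)) - cls (F n)) + norm (cls (F n) - cls f)"
    proof -
      have "norm (a - d) \<le> norm (a - b) + norm (b - c) + norm (c - d)" for a b c d :: l2
        using norm_triangle_ineq[of "a - b + (b - c)" "c - d"] norm_triangle_ineq[of "a - b" "b - c"] by simp
      then show ?thesis .
    qed
    then have "norm (cls (\<lambda>x. f (x + z)) - cls f) < e"
      using 1 2 n e by linarith
    then show ?case using e by (simp add: dist_norm)
  qed
qed

section \<open>Plancherel's identity for integrable functions\<close>

text \<open>
  Formally, and up to a constant, the Fourier transform of \<open>(cmod (fourier_integral f \<xi>))\<^sup>2\<close>.
\<close>

definition autocorrelation :: "(real \<Rightarrow> complex) \<Rightarrow> real \<Rightarrow> complex" where
  "autocorrelation f z = (LINT x|lborel. f x * cnj (f (x + z)))"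

lemma autocorrelation_bound: "f \<in> L2 \<Longrightarrow> cmod (autocorrelation f z) \<le> (norm (cls f))\<^sup>2"
  using L2_Cauchy_Schwarz[of f "\<lambda>x. cnj (f (x + z))"] norm_cls_shift[of f z]
    norm_cls_le[of "\<lambda>x. cnj (f (x + z))" "\<lambda>x. f (x + z)"]
  by (simp add: autocorrelation_def power2_eq_square mult_left_mono order_trans)

lemma autocorrelation_0:
  assumes "f \<in> L2" shows "autocorrelation f 0 = complex_of_real ((norm (cls f))\<^sup>2)"
proof -
  have "autocorrelation f 0 = (LINT x|lborel. complex_of_real ((cmod (f x))\<^sup>2))"
    by (simp add: autocorrelation_def complex_norm_square flip: of_real_power)
  also have "\<dots> = complex_of_real (LINT x|lborel. (cmod (f x))\<^sup>2)"
    by (rule integral_complex_of_real)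
  finally show ?thesis by (simp only: norm_cls_sq[OF assms])
qed

lemma autocorrelation_tendsto:
  assumes f: "f \<in> L2" and fi: "integrable lborel f"
  shows "(autocorrelation f \<longlongrightarrow> autocorrelation f 0) (at 0)"
proof (rule LIM_zero_cancel, rule Lim_null_comparison)
  have "((\<lambda>z. norm (cls f) * norm (cls (\<lambda>x. f (x + z)) - cls f)) \<longlongrightarrow> norm (cls f) * norm (cls f - cls f)) (at 0)"
    by (intro tendsto_intros L2_translation f fi)
  then show "((\<lambda>z. norm (cls f) * norm (cls (\<lambda>x. f (x + z)) - cls f)) \<longlongrightarrow> 0) (at 0)" by simp
  show "\<forall>\<^sub>F z in at 0. cmod (autocorrelation f z - autocorrelation f 0) \<le> norm (cls f) * norm (cls (\<lambda>x. f (x + z)) - cls f)"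
  proof (intro always_eventually allI)
    fix z
    have "autocorrelation f z - autocorrelation f 0 = (LINT x|lborel. f x * cnj (f (x + z) - f x))"
      using L2_inner_integrable[of f f] L2_inner_integrable[of f "\<lambda>x. f (x + z)"] f
      by (simp add: autocorrelation_def right_diff_distrib)
    also have "cmod \<dots> \<le> norm (cls f) * norm (cls (\<lambda>x. cnj (f (x + z) - f x)))"
      using f by (intro L2_Cauchy_Schwarz) auto
    also have "norm (cls (\<lambda>x. cnj (f (x + z) - f x))) \<le> norm (cls (\<lambda>x. f (x + z) - f x))"
      using f by (intro norm_cls_le L2_cnj L2_diff L2_shift) (simp_all only: complex_mod_cnj, simp)
    finally show "cmod (autocorrelation f z - autocorrelation f 0) \<le> norm (cls f) * norm (cls (\<lambda>x. f (x + z)) - cls f)"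
      using f by (simp add: cls_diff mult_left_mono)
  qed
qed

definition poisson_kernel :: "real \<Rightarrow> real \<Rightarrow> real" where
  "poisson_kernel b z = b / (pi * (b\<^sup>2 + z\<^sup>2))"

lemma borel_measurable_poisson_kernel [measurable]: "poisson_kernel b \<in> borel_measurable borel"
  unfolding poisson_kernel_def[abs_def] by measurable

lemma poisson_kernel_bounds:
  assumes "b > 0" shows "0 \<le> poisson_kernel b z" "poisson_kernel b z \<le> 1 / (pi * b)"
proof -
  show "0 \<le> poisson_kernel b z" using assms by (simp add: poisson_kernel_def)
  have "b / (pi * (b\<^sup>2 + z\<^sup>2)) \<le> b / (pi * b\<^sup>2)"
    using assms by (intro divide_left_mono mult_left_mono mult_pos_pos add_pos_nonneg) auto
  then show "poisson_kernel b z \<le> 1 / (pi * b)"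
    using assms by (simp add: poisson_kernel_def power2_eq_square)
qed

text \<open>
  The damped energy is written as the integral of \<open>fourier_integral f\<close> against
  \<open>exp (- b \<bar>\<xi>\<bar>) * cnj (fourier_integral f \<xi>)\<close>. Applying the multiplication formula once moves the
  transform onto the second factor, and once more onto the damping factor, where it produces the
  Poisson kernel.
\<close>

lemma damped_energy_eq_poisson:
  assumes f: "integrable lborel f" and b: "b > 0"
  shows "(LINT \<xi>|lborel. complex_of_real (exp (- b * \<bar>\<xi>\<bar>) * (cmod (fourier_integral f \<xi>))\<^sup>2)) =
    (LINT z|lborel. complex_of_real (poisson_kernel b z) * autocorrelation f z)"
proof -
  have [measurable]: "f \<in> borel_measurable borel" using borel_measurable_integrable[OF f] by simp
  define k where "k \<xi> = complex_of_real (exp (- b * \<bar>\<xi>\<bar>))" for \<xi>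
  have k: "integrable lborel k" unfolding k_def using integrable_exp_abs[OF b] by simp
  note [measurable] = borel_measurable_integrable[OF k, simplified]
  define g where "g \<xi> = k \<xi> * cnj (fourier_integral f \<xi>)" for \<xi>
  have gi: "integrable lborel g"
  proof (rule Bochner_Integration.integrable_bound)
    show "integrable lborel (\<lambda>\<xi>. k \<xi> * (LINT x|lborel. cmod (f x)))" using k by simp
    show "AE \<xi> in lborel. norm (g \<xi>) \<le> norm (k \<xi> * (LINT x|lborel. cmod (f x)))"
      by (auto simp: g_def norm_mult integral_nonneg_AE intro!: mult_left_mono fourier_integral_bound f)
  qed (simp add: g_def[abs_def])
  have Fg: "fourier_integral g x = (LINT z|lborel. cnj (f (x + z)) * poisson_kernel b z)" for x
  proof -
    let ?c = "complex_of_real (1 / sqrt (2 * pi))"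
    \<comment> \<open>modulating the damping factor translates its transform\<close>
    let ?k = "\<lambda>\<xi>. k \<xi> * cis (\<xi> * x)"
    have ki: "integrable lborel ?k"
      using integrable_cis_mult[OF k, of "-x"] by (simp add: mult.commute)
    have Fk: "fourier_integral ?k y = fourier_integral k (y - x)" for y
      unfolding fourier_integral_def
      by (simp add: cis_mult algebra_simps flip: mult.assoc)
    have cfi: "integrable lborel (\<lambda>x. cnj (f x))" using f by simp
    have "fourier_integral g x = ?c * (LINT \<xi>|lborel. fourier_integral (\<lambda>x. cnj (f x)) (- \<xi>) * (k \<xi> * cis (- (\<xi> * x))))"
      by (simp add: fourier_integral_def[of g] g_def fourier_integral_cnj mult_ac)
    also have "(LINT \<xi>|lborel. fourier_integral (\<lambda>x. cnj (f x)) (- \<xi>) * (k \<xi> * cis (- (\<xi> * x)))) =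
        (LINT \<xi>|lborel. fourier_integral (\<lambda>x. cnj (f x)) \<xi> * ?k \<xi>)"
      by (subst lborel_integral_real_affine[of "-1" _ 0]) (auto simp: k_def)
    also have "\<dots> = (LINT y|lborel. cnj (f y) * fourier_integral ?k y)"
      by (rule fourier_integral_mult_formula[OF cfi ki])
    also have "\<dots> = (LINT y|lborel. cnj (f y) * fourier_integral k (y - x))" by (simp only: Fk)
    also have "\<dots> = (LINT z|lborel. cnj (f (z + x)) * fourier_integral k (z + x - x))"
      by (rule integral_shift[symmetric])
    also have "?c * \<dots> = (LINT z|lborel. ?c * (cnj (f (x + z)) * fourier_integral k z))"
      by (simp add: add.commute)
    also have "\<dots> = (LINT z|lborel. cnj (f (x + z)) * poisson_kernel b z)"
    proof (intro Bochner_Integration.integral_cong refl)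
      fix z
      have "1 / sqrt (2 * pi) * (sqrt (2 / pi) * (b / (b\<^sup>2 + z\<^sup>2))) = poisson_kernel b z"
      proof -
        have "1 / sqrt (2 * pi) * sqrt (2 / pi) = 1 / pi"
          by (simp add: real_sqrt_mult real_sqrt_divide)
        then show ?thesis
          by (simp only: mult.assoc[symmetric] poisson_kernel_def) simp
      qed
      then have "?c * fourier_integral k z = complex_of_real (poisson_kernel b z)"
        unfolding k_def fourier_integral_exp_abs[OF b] of_real_mult[symmetric] by simp
      then show "?c * (cnj (f (x + z)) * fourier_integral k z) = cnj (f (x + z)) * poisson_kernel b z"
        by (metis mult.left_commute)
    qed
    finally show ?thesis .
  qed
  have int: "integrable (lborel \<Otimes>\<^sub>M lborel) (\<lambda>(x, z). f x * (cnj (f (x + z)) * poisson_kernel b z))"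
  proof (rule lborel_pair.Fubini_integrable)
    show "(\<lambda>(x, z). f x * (cnj (f (x + z)) * poisson_kernel b z)) \<in> borel_measurable (lborel \<Otimes>\<^sub>M lborel)"
      by measurable
    let ?C = "1 / (pi * b)"
    have le: "cmod (f x * (cnj (f (x + z)) * poisson_kernel b z)) \<le> cmod (f x) * ?C * cmod (f (x + z))" for x z
    proof -
      have "cmod (f x) * cmod (f (x + z)) * poisson_kernel b z \<le> cmod (f x) * cmod (f (x + z)) * ?C"
        by (intro mult_left_mono poisson_kernel_bounds b) auto
      then show ?thesis using poisson_kernel_bounds(1)[OF b, of z] by (simp add: norm_mult mult_ac)
    qed
    have fs: "integrable lborel (\<lambda>z. f (x + z))" for x
      using integrable_shift[OF f, of x] by (simp add: add.commute)
    have bi: "integrable lborel (\<lambda>z. cmod (f x) * ?C * cmod (f (x + z)))" for x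
      using fs by auto
    have *: "integrable lborel (\<lambda>z. f x * (cnj (f (x + z)) * poisson_kernel b z))" for x
      by (rule Bochner_Integration.integrable_bound[OF bi[of x]])
         (use le b in \<open>auto intro!: AE_I2 order_trans[OF le]\<close>)
    then show "AE x in lborel. integrable lborel (\<lambda>z. case (x, z) of (x, z) \<Rightarrow> f x * (cnj (f (x + z)) * poisson_kernel b z))"
      by simp
    show "integrable lborel (\<lambda>x. LINT z|lborel. norm (case (x, z) of (x, z) \<Rightarrow> f x * (cnj (f (x + z)) * poisson_kernel b z)))"
    proof (rule Bochner_Integration.integrable_bound)
      show "integrable lborel (\<lambda>x. cmod (f x) * (?C * (LINT z|lborel. cmod (f z))))" using f by auto
      show "(\<lambda>x. LINT z|lborel. norm (case (x, z) of (x, z) \<Rightarrow> f x * (cnj (f (x + z)) * poisson_kernel b z))) \<in> borel_measurable lborel"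
        by measurable
      have "(LINT z|lborel. cmod (f x * (cnj (f (x + z)) * poisson_kernel b z))) \<le>
          (LINT z|lborel. cmod (f x) * ?C * cmod (f (x + z)))" for x
        by (rule integral_mono[OF integrable_norm[OF *] bi le])
      also have "(LINT z|lborel. cmod (f x) * ?C * cmod (f (x + z))) = cmod (f x) * (?C * (LINT z|lborel. cmod (f z)))" for x
        using integral_shift[of "\<lambda>z. cmod (f z)" x] by (simp add: add.commute)
      finally have "(LINT z|lborel. cmod (f x * (cnj (f (x + z)) * poisson_kernel b z))) \<le>
          cmod (f x) * (?C * (LINT z|lborel. cmod (f z)))" for x .
      then show "AE x in lborel. norm (LINT z|lborel. norm (case (x, z) of (x, z) \<Rightarrow> f x * (cnj (f (x + z)) * poisson_kernel b z)))
          \<le> norm (cmod (f x) * (?C * (LINT z|lborel. cmod (f z))))"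
        using b by (auto simp: integral_nonneg_AE abs_mult intro!: AE_I2)
    qed
  qed
  have "(LINT \<xi>|lborel. complex_of_real (exp (- b * \<bar>\<xi>\<bar>) * (cmod (fourier_integral f \<xi>))\<^sup>2)) =
      (LINT \<xi>|lborel. fourier_integral f \<xi> * g \<xi>)"
    unfolding g_def k_def of_real_mult complex_norm_square by (simp add: mult_ac)
  also have "\<dots> = (LINT x|lborel. f x * fourier_integral g x)"
    by (rule fourier_integral_mult_formula[OF f gi])
  also have "\<dots> = (LINT x|lborel. LINT z|lborel. f x * (cnj (f (x + z)) * poisson_kernel b z))"
    by (simp add: Fg)
  also have "\<dots> = (LINT z|lborel. LINT x|lborel. f x * (cnj (f (x + z)) * poisson_kernel b z))"
    by (rule lborel_pair.Fubini_integral[OF int, symmetric])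
  also have "\<dots> = (LINT z|lborel. complex_of_real (poisson_kernel b z) * autocorrelation f z)"
    unfolding autocorrelation_def
    by (subst integral_mult_right_zero[symmetric]) (simp add: mult_ac)
  finally show ?thesis .
qed

lemma poisson_autocorrelation_rescaled:
  assumes b: "b > 0"
  shows "(LINT z|lborel. complex_of_real (poisson_kernel b z) * autocorrelation f z) =
    (LINT y|lborel. complex_of_real (1 / pi * (1 / (1 + y\<^sup>2))) * autocorrelation f (b * y))"
proof -
  have "b * poisson_kernel b (b * y) = 1 / pi * (1 / (1 + y\<^sup>2))" for y
  proof -
    have "b * poisson_kernel b (b * y) = b\<^sup>2 / (b\<^sup>2 * (pi * (1 + y\<^sup>2)))"
      unfolding poisson_kernel_def by (simp add: power2_eq_square algebra_simps)
    then show ?thesis using b by simp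
  qed
  then have "complex_of_real b * (complex_of_real (poisson_kernel b (b * y)) * a) = complex_of_real (1 / pi * (1 / (1 + y\<^sup>2))) * a" for y a
    by (metis mult.assoc of_real_mult)
  then show ?thesis
    using b by (subst lborel_integral_real_affine[of b _ 0])
      (auto simp: scaleR_conv_of_real simp flip: integral_mult_right_zero)
qed

text \<open>
  As the damping is removed, the damped energies increase to the energy of the transform, while the
  Poisson kernels concentrate at the origin, where the autocorrelation is continuous with value
  the energy of \<open>f\<close>.
\<close>

theorem Plancherel_L1_L2:
  assumes f: "integrable lborel f" and f2: "f \<in> L2"
  shows "fourier_integral f \<in> L2" "norm (cls (fourier_integral f)) = norm (cls f)"
proof -
  have fm [measurable]: "f \<in> borel_measurable borel" using f2 by auto
  let ?A = "autocorrelation f"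
  let ?b = "\<lambda>n. 1 / real (Suc n)"
  let ?p = "\<lambda>y::real. 1 / pi * (1 / (1 + y\<^sup>2))"
  let ?e = "\<lambda>n \<xi>. exp (- ?b n * \<bar>\<xi>\<bar>) * (cmod (fourier_integral f \<xi>))\<^sup>2"
  have [measurable]: "?A \<in> borel_measurable borel"
    unfolding autocorrelation_def[abs_def] by measurable
  have p: "integrable lborel ?p" "(LINT y|lborel. ?p y) = 1"
    using integrable_mult_right[OF integral_inverse_one_plus_sq(1), of "1 / pi"]
    by (simp, simp only: integral_mult_right_zero integral_inverse_one_plus_sq(2), simp)
  have "(\<lambda>n. LINT y|lborel. complex_of_real (?p y) * ?A (?b n * y)) \<longlonglongrightarrow> (LINT y|lborel. complex_of_real (?p y) * ?A 0)"
  proof (rule integral_dominated_convergence[where w = "\<lambda>y. ?p y * (norm (cls f))\<^sup>2"])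
    show "integrable lborel (\<lambda>y. ?p y * (norm (cls f))\<^sup>2)" by (rule integrable_mult_left[OF p(1)])
    show "AE y in lborel. (\<lambda>n. complex_of_real (?p y) * ?A (?b n * y)) \<longlonglongrightarrow> complex_of_real (?p y) * ?A 0"
    proof (intro AE_I2 tendsto_intros)
      fix y
      have "isCont ?A 0" using autocorrelation_tendsto[OF f2 f] by (simp add: isCont_def)
      moreover have "(\<lambda>n. ?b n * y) \<longlonglongrightarrow> 0 * y"
        by (intro tendsto_intros LIMSEQ_Suc[OF lim_1_over_n])
      ultimately show "(\<lambda>n. ?A (?b n * y)) \<longlonglongrightarrow> ?A 0"
        by (intro isCont_tendsto_compose[of _ ?A]) auto
    qed
    show "AE y in lborel. norm (complex_of_real (?p y) * ?A (?b n * y)) \<le> ?p y * (norm (cls f))\<^sup>2" for n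
    proof (intro AE_I2)
      fix y
      have "\<bar>?p y\<bar> = ?p y" by (simp add: abs_mult)
      then show "norm (complex_of_real (?p y) * ?A (?b n * y)) \<le> ?p y * (norm (cls f))\<^sup>2"
        unfolding norm_mult norm_of_real by (simp only:) (intro mult_left_mono autocorrelation_bound f2, simp)
    qed
  qed measurable
  moreover have "(LINT y|lborel. complex_of_real (?p y) * ?A 0) = complex_of_real ((norm (cls f))\<^sup>2)"
    using p(2) by (simp add: autocorrelation_0[OF f2] del: of_real_mult of_real_divide)
  moreover have "(LINT y|lborel. complex_of_real (?p y) * ?A (?b n * y)) = complex_of_real (LINT \<xi>|lborel. ?e n \<xi>)" for n
    using damped_energy_eq_poisson[OF f, of "?b n"] poisson_autocorrelation_rescaled[of "?b n" f]
    by (simp del: of_nat_Suc of_real_mult of_real_divide)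
  ultimately have "(\<lambda>n. complex_of_real (LINT \<xi>|lborel. ?e n \<xi>)) \<longlonglongrightarrow> complex_of_real ((norm (cls f))\<^sup>2)"
    by simp
  then have lim: "(\<lambda>n. LINT \<xi>|lborel. ?e n \<xi>) \<longlonglongrightarrow> (norm (cls f))\<^sup>2"
    by (simp only: tendsto_of_real_iff)
  have eint: "integrable lborel (?e n)" for n
  proof (rule Bochner_Integration.integrable_bound)
    show "integrable lborel (\<lambda>\<xi>. exp (- ?b n * \<bar>\<xi>\<bar>) * (LINT x|lborel. cmod (f x))\<^sup>2)"
      by (intro integrable_mult_left integrable_exp_abs) auto
    show "AE \<xi> in lborel. norm (?e n \<xi>) \<le> norm (exp (- ?b n * \<bar>\<xi>\<bar>) * (LINT x|lborel. cmod (f x))\<^sup>2)"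
      by (intro AE_I2) (auto simp: abs_mult intro!: mult_left_mono power_mono fourier_integral_bound f)
  qed measurable
  have mono: "AE \<xi> in lborel. mono (\<lambda>n. ?e n \<xi>)"
    by (intro AE_I2 monoI mult_right_mono) (auto intro!: mult_right_mono divide_left_mono)
  have conv: "AE \<xi> in lborel. (\<lambda>n. ?e n \<xi>) \<longlonglongrightarrow> (cmod (fourier_integral f \<xi>))\<^sup>2"
  proof (intro AE_I2)
    fix \<xi>
    have "(\<lambda>n. ?e n \<xi>) \<longlonglongrightarrow> exp (- 0 * \<bar>\<xi>\<bar>) * (cmod (fourier_integral f \<xi>))\<^sup>2"
      by (intro tendsto_intros LIMSEQ_Suc[OF lim_1_over_n])
    then show "(\<lambda>n. ?e n \<xi>) \<longlonglongrightarrow> (cmod (fourier_integral f \<xi>))\<^sup>2" by simp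
  qed
  have hb: "has_bochner_integral lborel (\<lambda>\<xi>. (cmod (fourier_integral f \<xi>))\<^sup>2) ((norm (cls f))\<^sup>2)"
    by (rule has_bochner_integral_monotone_convergence[OF eint mono conv lim]) measurable
  then show F2: "fourier_integral f \<in> L2"
    using fm by (auto simp: L2_def has_bochner_integral_iff)
  have "(norm (cls (fourier_integral f)))\<^sup>2 = (norm (cls f))\<^sup>2"
    using hb by (simp add: norm_cls_sq[OF F2] has_bochner_integral_iff)
  then show "norm (cls (fourier_integral f)) = norm (cls f)" by simp
qed

section \<open>The Fourier transform on square-integrable functions\<close>

lemma truncation_L1_L2:
  assumes "f \<in> L2"
  shows "(\<lambda>x. indicator {-R..R} x *\<^sub>R f x) \<in> L2" "integrable lborel (\<lambda>x. indicator {-R..R} x *\<^sub>R f x)"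
proof -
  have ind: "(\<lambda>x. indicator {-R..R} x :: complex) \<in> L2"
    by (rule L2_dominated[OF _ integrable_real_indicator[of "{-R..R}"]])
       (auto simp: emeasure_lborel_Icc_eq split: split_indicator)
  show "(\<lambda>x. indicator {-R..R} x *\<^sub>R f x) \<in> L2"
    by (rule L2_dominated[OF _ L2_integrable[OF assms]]) (use assms in \<open>auto simp: indicator_def\<close>)
  show "integrable lborel (\<lambda>x. indicator {-R..R} x *\<^sub>R f x)"
    using L2_prod_integrable[OF ind assms] by (simp add: scaleR_conv_of_real of_real_indicator)
qed

lemma tendsto_same_distance:
  fixes X Y :: "'b \<Rightarrow> 'a :: real_normed_vector"
  assumes "(Y \<longlongrightarrow> y) F" and "\<And>n. norm (X n - x) = norm (Y n - y)"
  shows "(X \<longlongrightarrow> x) F"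
  using assms(1) unfolding tendsto_iff dist_norm assms(2) .

lemma truncation_tendsto:
  assumes "f \<in> L2"
  shows "((\<lambda>R. cls (\<lambda>x. indicator {-R..R} x *\<^sub>R f x)) \<longlongrightarrow> cls f) at_top"
proof (rule tendsto_at_topI_sequentially)
  fix X :: "nat \<Rightarrow> real" assume X: "filterlim X at_top sequentially"
  show "(\<lambda>n. cls (\<lambda>x. indicator {-X n..X n} x *\<^sub>R f x)) \<longlonglongrightarrow> cls f"
  proof (rule cls_tendsto_dominated(2))
    fix x
    have "\<forall>\<^sub>F n in sequentially. \<bar>x\<bar> \<le> X n" using X by (simp add: filterlim_at_top)
    then have "\<forall>\<^sub>F n in sequentially. indicator {-X n..X n} x *\<^sub>R f x = f x"
      by eventually_elim (auto simp: indicator_def abs_le_iff)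
    then show "(\<lambda>n. indicator {-X n..X n} x *\<^sub>R f x) \<longlonglongrightarrow> f x" by (rule tendsto_eventually)
  qed (use assms in \<open>auto simp: indicator_def\<close>)
qed

lemma fourier_integral_diff:
  "integrable lborel f \<Longrightarrow> integrable lborel g \<Longrightarrow>
    fourier_integral (\<lambda>x. f x - g x) = (\<lambda>\<xi>. fourier_integral f \<xi> - fourier_integral g \<xi>)"
  by (simp add: fun_eq_iff fourier_integral_def left_diff_distrib right_diff_distrib)

lemma fourier_integral_isometry:
  assumes "integrable lborel f" "f \<in> L2" "integrable lborel g" "g \<in> L2"
  shows "norm (cls (fourier_integral f) - cls (fourier_integral g)) = norm (cls f - cls g)"
  using Plancherel_L1_L2[of "\<lambda>x. f x - g x"] Plancherel_L1_L2[of f] Plancherel_L1_L2[of g] assms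
  by (simp add: fourier_integral_diff cls_diff)

lemma truncated_fourier_L2 [simp, intro]: "f \<in> L2 \<Longrightarrow> truncated_fourier R f \<in> L2"
  unfolding truncated_fourier_eq by (intro Plancherel_L1_L2 truncation_L1_L2)

text \<open>
  The limit along integer cut-offs of a representative; the choice of the representative is
  immaterial, and \<open>truncated_fourier_tendsto\<close> gives the limit along all cut-offs.
\<close>

definition L2_fourier :: "l2 \<Rightarrow> l2" where
  "L2_fourier x = lim (\<lambda>n. cls (truncated_fourier (real n) (rep_l2 x)))"

lemma rep_cls_AE: "f \<in> L2 \<Longrightarrow> AE x in lborel. rep_l2 (cls f) x = f x"
  and rep_L2 [simp]: "rep_l2 y \<in> L2" and cls_rep [simp]: "cls (rep_l2 y) = y"
  using Quotient_rep_abs[OF Quotient_l2, of f] Quotient_rep_reflp[OF Quotient_l2, of y] Quotient_abs_rep[OF Quotient_l2, of y]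
  by (auto simp: L2_rel_def)

lemma truncated_fourier_cong_AE:
  assumes "f \<in> L2" "g \<in> L2" "AE x in lborel. f x = g x"
  shows "truncated_fourier R f = truncated_fourier R g"
proof
  fix \<xi>
  have "(LINT x:{-R..R}|lborel. f x * cis (- (\<xi> * x))) = (LINT x:{-R..R}|lborel. g x * cis (- (\<xi> * x)))"
    unfolding set_lebesgue_integral_def
    by (rule integral_cong_AE) (use assms in \<open>auto elim!: eventually_mono\<close>)
  then show "truncated_fourier R f \<xi> = truncated_fourier R g \<xi>"
    by (simp only: truncated_fourier_def)
qed

text \<open>
  The truncated transforms are at the same mutual distances as the truncations, so they converge,
  and they converge as fast as the truncations do.
\<close>

lemma truncated_fourier_tendsto:
  assumes f: "f \<in> L2"
  shows "((\<lambda>R. cls (truncated_fourier R f)) \<longlongrightarrow> L2_fourier (cls f)) at_top"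
proof -
  let ?t = "\<lambda>R. cls (\<lambda>x. indicator {-R..R} x *\<^sub>R f x)"
  have iso: "norm (cls (truncated_fourier R f) - cls (truncated_fourier S f)) = norm (?t R - ?t S)" for R S
    unfolding truncated_fourier_eq by (intro fourier_integral_isometry truncation_L1_L2 f)
  have t: "(\<lambda>n. ?t (real n)) \<longlonglongrightarrow> cls f"
    by (rule filterlim_compose[OF truncation_tendsto[OF f] filterlim_real_sequentially])
  then have "Cauchy (\<lambda>n. ?t (real n))" by (rule LIMSEQ_imp_Cauchy)
  then have "Cauchy (\<lambda>n. cls (truncated_fourier (real n) f))"
    unfolding Cauchy_def dist_norm iso .
  then have "convergent (\<lambda>n. cls (truncated_fourier (real n) f))" by (rule Cauchy_convergent)
  then have lim: "(\<lambda>n. cls (truncated_fourier (real n) f)) \<longlonglongrightarrow> L2_fourier (cls f)"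
    unfolding L2_fourier_def truncated_fourier_cong_AE[OF rep_L2 f rep_cls_AE[OF f]]
    by (simp add: convergent_LIMSEQ_iff)
  show ?thesis
  proof (rule tendsto_same_distance[OF truncation_tendsto[OF f]])
    show "norm (cls (truncated_fourier R f) - L2_fourier (cls f)) = norm (?t R - cls f)" for R
  proof (rule LIMSEQ_unique)
    show "(\<lambda>n. norm (cls (truncated_fourier R f) - cls (truncated_fourier (real n) f))) \<longlonglongrightarrow> norm (cls (truncated_fourier R f) - L2_fourier (cls f))"
      by (intro tendsto_intros lim)
    show "(\<lambda>n. norm (cls (truncated_fourier R f) - cls (truncated_fourier (real n) f))) \<longlonglongrightarrow> norm (?t R - cls f)"
      unfolding iso by (intro tendsto_intros t)
  qed
  qed
qed

lemma tendsto_power2_zero_iff: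
  fixes u :: "'b \<Rightarrow> real"
  shows "((\<lambda>x. (u x)\<^sup>2) \<longlongrightarrow> 0) F \<longleftrightarrow> (u \<longlongrightarrow> 0) F"
proof
  assume "((\<lambda>x. (u x)\<^sup>2) \<longlongrightarrow> 0) F"
  then have "((\<lambda>x. sqrt ((u x)\<^sup>2)) \<longlongrightarrow> sqrt 0) F" by (intro tendsto_intros)
  then show "(u \<longlongrightarrow> 0) F" by (simp add: tendsto_rabs_zero_iff)
next
  assume "(u \<longlongrightarrow> 0) F"
  then have "((\<lambda>x. (u x)\<^sup>2) \<longlongrightarrow> 0\<^sup>2) F" by (intro tendsto_intros)
  then show "((\<lambda>x. (u x)\<^sup>2) \<longlongrightarrow> 0) F" by simp
qed

text \<open>
  From here on the relational definition of the transform can be handled as an equation between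
  classes.
\<close>

lemma is_fourier_iff: "is_fourier f g \<longleftrightarrow> f \<in> L2 \<and> g \<in> L2 \<and> L2_fourier (cls f) = cls g"
proof (cases "f \<in> L2 \<and> g \<in> L2")
  case True
  then have "is_fourier f g \<longleftrightarrow> ((\<lambda>R. ennreal ((norm (cls g - cls (truncated_fourier R f)))\<^sup>2)) \<longlongrightarrow> ennreal 0) at_top"
    by (simp add: is_fourier_def nn_integral_cls cls_diff)
  also have "\<dots> \<longleftrightarrow> ((\<lambda>R. (norm (cls (truncated_fourier R f) - cls g))\<^sup>2) \<longlongrightarrow> 0) at_top"
    by (subst tendsto_ennreal_iff) (auto simp: norm_minus_commute)
  also have "\<dots> \<longleftrightarrow> ((\<lambda>R. cls (truncated_fourier R f)) \<longlongrightarrow> cls g) at_top"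
    by (simp add: tendsto_power2_zero_iff tendsto_norm_zero_iff LIM_zero_iff)
  also have "\<dots> \<longleftrightarrow> L2_fourier (cls f) = cls g"
  proof -
    note t = truncated_fourier_tendsto[OF True[THEN conjunct1]]
    show ?thesis
    proof
      assume "((\<lambda>R. cls (truncated_fourier R f)) \<longlongrightarrow> cls g) at_top"
      with t show "L2_fourier (cls f) = cls g" by (rule tendsto_unique[OF trivial_limit_at_top_linorder])
    qed (use t in simp)
  qed
  finally show ?thesis using True by simp
qed (auto simp: is_fourier_def)

lemma L2_fourier_of_integrable:
  assumes f: "integrable lborel f" and f2: "f \<in> L2"
  shows "L2_fourier (cls f) = cls (fourier_integral f)"
proof (rule tendsto_unique[OF trivial_limit_at_top_linorder truncated_fourier_tendsto[OF f2]])
  show "((\<lambda>R. cls (truncated_fourier R f)) \<longlongrightarrow> cls (fourier_integral f)) at_top"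
  proof (rule tendsto_same_distance[OF truncation_tendsto[OF f2]])
    show "norm (cls (truncated_fourier R f) - cls (fourier_integral f)) =
        norm (cls (\<lambda>x. indicator {-R..R} x *\<^sub>R f x) - cls f)" for R
      unfolding truncated_fourier_eq by (intro fourier_integral_isometry truncation_L1_L2 f f2)
  qed
qed

lemma norm_L2_fourier [simp]: "norm (L2_fourier x) = norm x"
proof (cases x)
  case (cls f)
  have "((\<lambda>R. norm (cls (truncated_fourier R f))) \<longlongrightarrow> norm (L2_fourier x)) at_top"
    unfolding cls(2) by (intro tendsto_intros truncated_fourier_tendsto cls)
  moreover have "norm (cls (truncated_fourier R f)) = norm (cls (\<lambda>x. indicator {-R..R} x *\<^sub>R f x))" for R
    unfolding truncated_fourier_eq by (intro Plancherel_L1_L2 truncation_L1_L2 cls)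
  moreover have "((\<lambda>R. norm (cls (\<lambda>x. indicator {-R..R} x *\<^sub>R f x))) \<longlongrightarrow> norm x) at_top"
    unfolding cls(2) by (intro tendsto_intros truncation_tendsto cls)
  ultimately show ?thesis by (simp only:) (rule tendsto_unique[OF trivial_limit_at_top_linorder])
qed

lemma truncated_fourier_add:
  assumes "f \<in> L2" "g \<in> L2"
  shows "truncated_fourier R (\<lambda>x. f x + g x) = (\<lambda>\<xi>. truncated_fourier R f \<xi> + truncated_fourier R g \<xi>)"
proof
  fix \<xi>
  have "set_integrable lborel {-R..R} (\<lambda>x. f x * cis (- (\<xi> * x)))" if "f \<in> L2" for f
    using integrable_cis_mult[OF truncation_L1_L2(2)[OF that, of R], of \<xi>]
    by (simp add: set_integrable_def)
  from this[OF assms(1)] this[OF assms(2)]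
  show "truncated_fourier R (\<lambda>x. f x + g x) \<xi> = truncated_fourier R f \<xi> + truncated_fourier R g \<xi>"
    by (simp add: truncated_fourier_def ring_distribs)
qed

lemma truncated_fourier_cmult: "truncated_fourier R (\<lambda>x. c * f x) = (\<lambda>\<xi>. c * truncated_fourier R f \<xi>)"
  by (simp add: fun_eq_iff truncated_fourier_def mult.assoc)

lemma L2_fourier_add: "L2_fourier (x + y) = L2_fourier x + L2_fourier y"
proof (cases x, cases y)
  fix f g assume *: "f \<in> L2" "x = cls f" "g \<in> L2" "y = cls g"
  have "((\<lambda>R. cls (truncated_fourier R (\<lambda>x. f x + g x))) \<longlongrightarrow> L2_fourier (cls (\<lambda>x. f x + g x))) at_top"
    using * by (intro truncated_fourier_tendsto) auto
  moreover have "cls (truncated_fourier R (\<lambda>x. f x + g x)) = cls (truncated_fourier R f) + cls (truncated_fourier R g)" for R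
    using * by (simp add: truncated_fourier_add cls_add)
  moreover have "((\<lambda>R. cls (truncated_fourier R f) + cls (truncated_fourier R g)) \<longlongrightarrow> L2_fourier (cls f) + L2_fourier (cls g)) at_top"
    using * by (intro tendsto_intros truncated_fourier_tendsto)
  ultimately have "L2_fourier (cls (\<lambda>x. f x + g x)) = L2_fourier (cls f) + L2_fourier (cls g)"
    by (simp only:) (rule tendsto_unique[OF trivial_limit_at_top_linorder])
  then show ?thesis using * by (simp add: cls_add)
qed

lemma norm_cls_cmult: "f \<in> L2 \<Longrightarrow> norm (cls (\<lambda>x. c * f x)) = cmod c * norm (cls f)"
proof -
  assume f: "f \<in> L2"
  have "(norm (cls (\<lambda>x. c * f x)))\<^sup>2 = (cmod c * norm (cls f))\<^sup>2"
    using f by (simp add: norm_cls_sq norm_mult power_mult_distrib)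
  then show ?thesis by (subst (asm) power2_eq_iff_nonneg) auto
qed

lemma is_fourier_cmult: "is_fourier f g \<Longrightarrow> is_fourier (\<lambda>x. c * f x) (\<lambda>\<xi>. c * g \<xi>)"
proof -
  assume "is_fourier f g"
  then have f: "f \<in> L2" and g: "g \<in> L2" and fg: "L2_fourier (cls f) = cls g" by (auto simp: is_fourier_iff)
  have "((\<lambda>R. cls (truncated_fourier R (\<lambda>x. c * f x))) \<longlongrightarrow> cls (\<lambda>\<xi>. c * g \<xi>)) at_top"
  proof (subst LIM_zero_iff[symmetric], subst tendsto_norm_zero_iff[symmetric])
    have "norm (cls (truncated_fourier R (\<lambda>x. c * f x)) - cls (\<lambda>\<xi>. c * g \<xi>)) =
        cmod c * norm (cls (truncated_fourier R f) - cls g)" for R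
      using f g norm_cls_cmult[of "\<lambda>\<xi>. truncated_fourier R f \<xi> - g \<xi>" c]
      by (simp add: truncated_fourier_cmult right_diff_distrib cls_diff)
    moreover have "((\<lambda>R. cmod c * norm (cls (truncated_fourier R f) - cls g)) \<longlongrightarrow> cmod c * norm (cls g - cls g)) at_top"
      using truncated_fourier_tendsto[OF f] fg by (intro tendsto_intros) simp
    ultimately show "((\<lambda>R. norm (cls (truncated_fourier R (\<lambda>x. c * f x)) - cls (\<lambda>\<xi>. c * g \<xi>))) \<longlongrightarrow> 0) at_top" by simp
  qed
  then have "L2_fourier (cls (\<lambda>x. c * f x)) = cls (\<lambda>\<xi>. c * g \<xi>)"
    using tendsto_unique[OF trivial_limit_at_top_linorder truncated_fourier_tendsto[OF L2_cmult[OF f, of c]]] by simp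
  then show ?thesis using f g by (auto simp: is_fourier_iff)
qed

lemma L2_fourier_scaleR: "L2_fourier (r *\<^sub>R x) = r *\<^sub>R L2_fourier x"
proof (cases x)
  case (cls f)
  have "is_fourier f (rep_l2 (L2_fourier x))" using cls by (simp add: is_fourier_iff)
  from is_fourier_cmult[OF this, of "complex_of_real r"] show ?thesis
    using cls by (simp add: is_fourier_iff cls_scaleR flip: scaleR_conv_of_real)
qed

lemma bounded_linear_L2_fourier: "bounded_linear L2_fourier"
  by (rule bounded_linear_intro[where K=1]) (simp_all add: L2_fourier_add L2_fourier_scaleR)

lemmas L2_fourier_diff = linear_diff[OF bounded_linear.linear[OF bounded_linear_L2_fourier]]
lemmas tendsto_L2_fourier = bounded_linear.tendsto[OF bounded_linear_L2_fourier]

lemma inner_L2_fourier: "inner (L2_fourier x) (L2_fourier y) = inner x y"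
proof -
  have "norm (L2_fourier x + L2_fourier y) = norm (x + y)"
    using norm_L2_fourier[of "x + y"] by (simp only: L2_fourier_add)
  then show ?thesis by (simp add: dot_norm)
qed

lift_definition l2_cnj :: "l2 \<Rightarrow> l2" is "\<lambda>f x. cnj (f x)"
  by (auto simp: L2_rel_def)

lemma l2_cnj_cls: "f \<in> L2 \<Longrightarrow> l2_cnj (cls f) = cls (\<lambda>x. cnj (f x))"
  by (simp add: l2_cnj.abs_eq)

lemma bounded_linear_l2_cnj: "bounded_linear l2_cnj"
  and norm_l2_cnj [simp]: "norm (l2_cnj x) = norm x"
  and l2_cnj_l2_cnj [simp]: "l2_cnj (l2_cnj x) = x"
proof -
  show n: "norm (l2_cnj x) = norm x" for x
    by (cases x) (auto simp: l2_cnj_cls intro!: antisym norm_cls_le)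
  show "l2_cnj (l2_cnj x) = x"
    by (cases x) (simp add: l2_cnj_cls)
  show "bounded_linear l2_cnj"
  proof (rule bounded_linear_intro[where K=1])
    fix x y :: l2 and r :: real
    show "l2_cnj (x + y) = l2_cnj x + l2_cnj y"
      by (cases x, cases y) (simp add: l2_cnj_cls flip: cls_add)
    show "l2_cnj (r *\<^sub>R x) = r *\<^sub>R l2_cnj x"
      by (cases x) (simp add: l2_cnj_cls flip: cls_scaleR)
  qed (simp add: n)
qed

lemmas tendsto_l2_cnj = bounded_linear.tendsto[OF bounded_linear_l2_cnj]

text \<open>
  Both sides are continuous in \<open>x\<close> and \<open>y\<close>, and for truncations the identity is the one for integrable
  functions. Together with the isometry it identifies the inverse of the transform.
\<close>

lemma L2_fourier_mult_formula: "inner (L2_fourier x) (l2_cnj y) = inner x (l2_cnj (L2_fourier y))"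
proof (cases x, cases y)
  fix f g assume *: "f \<in> L2" "x = cls f" "g \<in> L2" "y = cls g"
  let ?f = "\<lambda>n x. indicator {-real n..real n} x *\<^sub>R f x" and ?g = "\<lambda>n x. indicator {-real n..real n} x *\<^sub>R g x"
  have f: "(\<lambda>n. cls (?f n)) \<longlonglongrightarrow> cls f" "(\<lambda>n. cls (?g n)) \<longlonglongrightarrow> cls g"
    using * by (auto intro!: filterlim_compose[OF truncation_tendsto filterlim_real_sequentially])
  have eq: "inner (L2_fourier (cls (?f n))) (l2_cnj (cls (?g n))) = inner (cls (?f n)) (l2_cnj (L2_fourier (cls (?g n))))" for n
  proof -
    note i = truncation_L1_L2[OF *(1), of "real n"] truncation_L1_L2[OF *(3), of "real n"]
    note F = Plancherel_L1_L2(1)[OF i(2,1)] Plancherel_L1_L2(1)[OF i(4,3)]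
    have "inner (L2_fourier (cls (?f n))) (l2_cnj (cls (?g n))) = (LINT x|lborel. Re (fourier_integral (?f n) x * ?g n x))"
      using i F by (simp only: L2_fourier_of_integrable l2_cnj_cls inner_cls L2_cnj complex_cnj_cnj)
    also have "\<dots> = Re (LINT x|lborel. fourier_integral (?f n) x * ?g n x)"
      by (intro integral_Re L2_prod_integrable F i)
    also have "\<dots> = Re (LINT x|lborel. ?f n x * fourier_integral (?g n) x)"
      by (simp only: fourier_integral_mult_formula[OF i(2,4)])
    also have "\<dots> = (LINT x|lborel. Re (?f n x * fourier_integral (?g n) x))"
      by (intro integral_Re[symmetric] L2_prod_integrable F i)
    also have "\<dots> = inner (cls (?f n)) (l2_cnj (L2_fourier (cls (?g n))))"
      using i F by (simp only: L2_fourier_of_integrable l2_cnj_cls inner_cls L2_cnj complex_cnj_cnj)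
    finally show ?thesis .
  qed
  have "(\<lambda>n. inner (L2_fourier (cls (?f n))) (l2_cnj (cls (?g n)))) \<longlonglongrightarrow> inner (L2_fourier x) (l2_cnj y)"
    unfolding * by (intro tendsto_intros tendsto_L2_fourier tendsto_l2_cnj f)
  moreover have "(\<lambda>n. inner (cls (?f n)) (l2_cnj (L2_fourier (cls (?g n))))) \<longlonglongrightarrow> inner x (l2_cnj (L2_fourier y))"
    unfolding * by (intro tendsto_intros tendsto_L2_fourier tendsto_l2_cnj f)
  ultimately show ?thesis unfolding eq by (rule LIMSEQ_unique)
qed

text \<open>
  Write \<open>h\<close> for the conjugated transform of \<open>cnj y\<close>. By the multiplication formula the inner product of
  the transform of \<open>h\<close> with \<open>y\<close> is \<open>inner h h\<close>, and the isometry shows that both vectors have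
  this squared norm as well; so their distance is \<open>0\<close>.
\<close>

theorem L2_fourier_inversion: "L2_fourier (l2_cnj (L2_fourier (l2_cnj y))) = y"
proof -
  let ?h = "l2_cnj (L2_fourier (l2_cnj y))"
  have "inner (L2_fourier ?h) y = inner ?h ?h"
    using L2_fourier_mult_formula[of ?h "l2_cnj y"] by simp
  moreover have "inner (L2_fourier ?h) (L2_fourier ?h) = inner ?h ?h" by (rule inner_L2_fourier)
  moreover have "inner ?h ?h = inner y y"
    by (simp flip: power2_norm_eq_inner)
  ultimately have "inner (L2_fourier ?h - y) (L2_fourier ?h - y) = 0"
    by (simp add: inner_diff_left inner_diff_right inner_commute)
  then show ?thesis by simp
qed

lemma is_fourier_fourier: "f \<in> L2 \<Longrightarrow> is_fourier f (fourier f)"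
  unfolding fourier_def
  by (rule someI[of _ "rep_l2 (L2_fourier (cls f))"]) (simp add: is_fourier_iff)

lemma fourier_L2 [simp, intro]: "f \<in> L2 \<Longrightarrow> fourier f \<in> L2"
  and L2_fourier_cls: "f \<in> L2 \<Longrightarrow> L2_fourier (cls f) = cls (fourier f)"
  using is_fourier_fourier[of f] by (auto simp: is_fourier_iff)

lemma is_fourier_exists: "g \<in> L2 \<Longrightarrow> \<exists>h. is_fourier h g"
  by (rule exI[of _ "rep_l2 (l2_cnj (L2_fourier (l2_cnj (cls g))))"])
     (simp add: is_fourier_iff L2_fourier_inversion)

lemma is_fourier_AE: "is_fourier f g \<Longrightarrow> AE \<xi> in lborel. fourier f \<xi> = g \<xi>"
  using is_fourier_fourier[of f] by (auto simp: is_fourier_iff cls_eq_iff)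

lemma is_fourier_inj:
  assumes "is_fourier f g" "is_fourier f' g'" "AE \<xi> in lborel. g \<xi> = g' \<xi>"
  shows "AE x in lborel. f x = f' x"
proof -
  have f: "f \<in> L2" "f' \<in> L2" "g \<in> L2" "g' \<in> L2" "L2_fourier (cls f) = cls g" "L2_fourier (cls f') = cls g'"
    using assms by (auto simp: is_fourier_iff)
  then have "cls g = cls g'" using assms(3) by (simp add: cls_eq_iff)
  then have "L2_fourier (cls f - cls f') = 0" using f by (simp add: L2_fourier_diff)
  then have "norm (cls f - cls f') = 0" by (metis norm_L2_fourier norm_zero)
  then show ?thesis using f by (simp add: cls_eq_iff)
qed

text \<open>
  Inversion supplies functions with a prescribed integrable transform. It gives the transform of the
  Lorentzian profile of the breather, and the pointwise bound in the Sobolev embedding.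
\<close>

lemma is_fourier_inverse_integral:
  assumes g: "integrable lborel g" "g \<in> L2"
  shows "is_fourier (\<lambda>x. cnj (fourier_integral (\<lambda>\<xi>. cnj (g \<xi>)) x)) g"
proof -
  have g': "integrable lborel (\<lambda>\<xi>. cnj (g \<xi>))" "(\<lambda>\<xi>. cnj (g \<xi>)) \<in> L2" using g by auto
  note F = Plancherel_L1_L2(1)[OF g'] 
  have "L2_fourier (cls (\<lambda>x. cnj (fourier_integral (\<lambda>\<xi>. cnj (g \<xi>)) x))) = cls g"
    using L2_fourier_inversion[of "cls g"] F g g' by (simp add: l2_cnj_cls L2_fourier_of_integrable)
  then show ?thesis using F g by (simp add: is_fourier_iff)
qed

lemma L2_cis_mult [simp, intro]:
  assumes "g \<in> L2" and [measurable]: "p \<in> borel_measurable borel" shows "(\<lambda>\<xi>. cis (p \<xi>) * g \<xi>) \<in> L2"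
  by (rule L2_mult_bounded[where C=1]) (use assms(1) in auto)

lemma norm_cls_unimodular:
  assumes "g \<in> L2" and [measurable]: "p \<in> borel_measurable borel"
  shows "norm (cls (\<lambda>\<xi>. cis (p \<xi>) * g \<xi>)) = norm (cls g)"
  using assms(1) by (intro antisym norm_cls_le) (auto simp: norm_mult)

text \<open>
  For truncations this is a substitution in the Fourier integral; translation and multiplication by
  a unimodular function are isometries, so the identity passes to the limit.
\<close>

lemma is_fourier_shift:
  assumes "is_fourier f g"
  shows "is_fourier (\<lambda>x. f (x + h)) (\<lambda>\<xi>. cis (\<xi> * h) * g \<xi>)"
proof -
  have f: "f \<in> L2" and g: "g \<in> L2" and fg: "L2_fourier (cls f) = cls g" using assms by (auto simp: is_fourier_iff)
  let ?f = "\<lambda>n x. indicator {-real n..real n} x *\<^sub>R f x"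
  note i = truncation_L1_L2[OF f]
  have F: "fourier_integral (?f n) \<in> L2" for n by (rule Plancherel_L1_L2(1)[OF i(2,1)])
  have lim: "(\<lambda>n. cls (?f n)) \<longlonglongrightarrow> cls f"
    by (rule filterlim_compose[OF truncation_tendsto[OF f] filterlim_real_sequentially])
  have "(\<lambda>n. cls (\<lambda>x. ?f n (x + h))) \<longlonglongrightarrow> cls (\<lambda>x. f (x + h))"
  proof (rule tendsto_same_distance[OF lim])
    show "norm (cls (\<lambda>x. ?f n (x + h)) - cls (\<lambda>x. f (x + h))) = norm (cls (?f n) - cls f)" for n
      using norm_cls_shift[of "\<lambda>x. ?f n x - f x" h] i(1)[of "real n"] L2_shift[OF i(1)[of "real n"], of h] f
      by (simp add: cls_diff)
  qed
  then have 1: "(\<lambda>n. L2_fourier (cls (\<lambda>x. ?f n (x + h)))) \<longlonglongrightarrow> L2_fourier (cls (\<lambda>x. f (x + h)))"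
    by (rule tendsto_L2_fourier)
  have eq: "L2_fourier (cls (\<lambda>x. ?f n (x + h))) = cls (\<lambda>\<xi>. cis (\<xi> * h) * fourier_integral (?f n) \<xi>)" for n
    using L2_fourier_of_integrable[OF integrable_shift[OF i(2)] L2_shift[OF i(1)], of "real n" h]
    by (simp only: fourier_integral_shift[of "?f n" h, THEN ext])
  have 2: "(\<lambda>n. cls (\<lambda>\<xi>. cis (\<xi> * h) * fourier_integral (?f n) \<xi>)) \<longlonglongrightarrow> cls (\<lambda>\<xi>. cis (\<xi> * h) * g \<xi>)"
  proof (rule tendsto_same_distance)
    show "(\<lambda>n. cls (fourier_integral (?f n))) \<longlonglongrightarrow> cls g"
      using tendsto_L2_fourier[OF lim] fg by (simp add: L2_fourier_of_integrable[OF i(2,1)])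
    show "norm (cls (\<lambda>\<xi>. cis (\<xi> * h) * fourier_integral (?f n) \<xi>) - cls (\<lambda>\<xi>. cis (\<xi> * h) * g \<xi>)) =
        norm (cls (fourier_integral (?f n)) - cls g)" for n
      using norm_cls_unimodular[of "\<lambda>\<xi>. fourier_integral (?f n) \<xi> - g \<xi>" "\<lambda>\<xi>. \<xi> * h"] F[of n] g
      by (simp add: right_diff_distrib cls_diff)
  qed
  from LIMSEQ_unique[OF 1[unfolded eq] 2] show ?thesis using f g by (simp add: is_fourier_iff)
qed

section \<open>Sobolev energies\<close>

lemma is_fourier_add: "is_fourier f g \<Longrightarrow> is_fourier f' g' \<Longrightarrow> is_fourier (\<lambda>x. f x + f' x) (\<lambda>\<xi>. g \<xi> + g' \<xi>)"
  by (simp add: is_fourier_iff cls_add L2_fourier_add)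

lemma is_fourier_diff: "is_fourier f g \<Longrightarrow> is_fourier f' g' \<Longrightarrow> is_fourier (\<lambda>x. f x - f' x) (\<lambda>\<xi>. g \<xi> - g' \<xi>)"
  by (simp add: is_fourier_iff cls_diff L2_fourier_diff)

text \<open>
  The square of the \<open>H\<^sup>s\<close> norm. Squares are preferred to norms, since the momentum is quadratic and
  the crude inequality \<open>sobolev_add\<close> for squares suffices in place of the triangle inequality.
\<close>

definition sobolev_energy :: "real \<Rightarrow> (real \<Rightarrow> complex) \<Rightarrow> real" where
  "sobolev_energy s f = (LINT \<xi>|lborel. (1 + \<xi>\<^sup>2) powr s * (cmod (fourier f \<xi>))\<^sup>2)"

lemma sobolev_L2: "f \<in> sobolev s \<Longrightarrow> f \<in> L2"
  and sobolev_integrable: "f \<in> sobolev s \<Longrightarrow> integrable lborel (\<lambda>\<xi>. (1 + \<xi>\<^sup>2) powr s * (cmod (fourier f \<xi>))\<^sup>2)"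
  by (auto simp: sobolev_def)

lemma sobolev_energy_nonneg [simp]: "0 \<le> sobolev_energy s f"
  by (simp add: sobolev_energy_def integral_nonneg_AE)

lemma sobolev_is_fourier:
  assumes fg: "is_fourier f g"
  shows "f \<in> sobolev s \<longleftrightarrow> integrable lborel (\<lambda>\<xi>. (1 + \<xi>\<^sup>2) powr s * (cmod (g \<xi>))\<^sup>2)"
    and "sobolev_energy s f = (LINT \<xi>|lborel. (1 + \<xi>\<^sup>2) powr s * (cmod (g \<xi>))\<^sup>2)"
proof -
  have f: "f \<in> L2" "g \<in> L2" using fg by (auto simp: is_fourier_iff)
  have m [measurable]: "fourier f \<in> borel_measurable borel" "g \<in> borel_measurable borel"
    using f by (auto intro: L2_measurable fourier_L2)
  have ae: "AE \<xi> in lborel. (1 + \<xi>\<^sup>2) powr s * (cmod (fourier f \<xi>))\<^sup>2 = (1 + \<xi>\<^sup>2) powr s * (cmod (g \<xi>))\<^sup>2"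
    using is_fourier_AE[OF fg] by eventually_elim simp
  show "f \<in> sobolev s \<longleftrightarrow> integrable lborel (\<lambda>\<xi>. (1 + \<xi>\<^sup>2) powr s * (cmod (g \<xi>))\<^sup>2)"
    unfolding sobolev_def using f m by (simp add: integrable_cong_AE[OF _ _ ae])
  show "sobolev_energy s f = (LINT \<xi>|lborel. (1 + \<xi>\<^sup>2) powr s * (cmod (g \<xi>))\<^sup>2)"
    unfolding sobolev_energy_def by (rule integral_cong_AE[OF _ _ ae]) simp_all
qed

lemma sobolev_norm_less_iff:
  assumes "e \<ge> 0"
  shows "sobolev_norm s f < ennreal e \<longleftrightarrow> f \<in> sobolev s \<and> sobolev_energy s f < e\<^sup>2"
proof -
  have "sqrt (sobolev_energy s f) < e \<longleftrightarrow> sobolev_energy s f < e\<^sup>2"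
    using assms by (metis real_sqrt_less_iff real_sqrt_abs abs_of_nonneg)
  then show ?thesis
    using assms by (auto simp: sobolev_norm_def sobolev_energy_def[symmetric] ennreal_less_iff)
qed

lemma sobolev_add:
  assumes "f \<in> sobolev s" "g \<in> sobolev s"
  shows "(\<lambda>x. f x + g x) \<in> sobolev s"
    and "sobolev_energy s (\<lambda>x. f x + g x) \<le> 2 * sobolev_energy s f + 2 * sobolev_energy s g"
proof -
  have fg: "is_fourier (\<lambda>x. f x + g x) (\<lambda>\<xi>. fourier f \<xi> + fourier g \<xi>)"
    by (intro is_fourier_add is_fourier_fourier) (use assms in \<open>auto dest: sobolev_L2\<close>)
  have [measurable]: "fourier f \<in> borel_measurable borel" "fourier g \<in> borel_measurable borel"
    using assms by (auto intro: L2_measurable fourier_L2 sobolev_L2)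
  note i = sobolev_integrable[OF assms(1)] sobolev_integrable[OF assms(2)]
  let ?S = "\<lambda>\<xi>. 2 * ((1 + \<xi>\<^sup>2) powr s * (cmod (fourier f \<xi>))\<^sup>2) + 2 * ((1 + \<xi>\<^sup>2) powr s * (cmod (fourier g \<xi>))\<^sup>2)"
  have S: "integrable lborel ?S" using i by simp
  have le: "(1 + \<xi>\<^sup>2) powr s * (cmod (fourier f \<xi> + fourier g \<xi>))\<^sup>2 \<le> ?S \<xi>" for \<xi>
  proof -
    have "(1 + \<xi>\<^sup>2) powr s * (cmod (fourier f \<xi> + fourier g \<xi>))\<^sup>2 \<le>
        (1 + \<xi>\<^sup>2) powr s * (2 * (cmod (fourier f \<xi>))\<^sup>2 + 2 * (cmod (fourier g \<xi>))\<^sup>2)"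
      by (intro mult_left_mono cmod_add_sq_le powr_ge_zero)
    then show ?thesis by (simp only: distrib_left mult.left_commute[of _ 2])
  qed
  have int: "integrable lborel (\<lambda>\<xi>. (1 + \<xi>\<^sup>2) powr s * (cmod (fourier f \<xi> + fourier g \<xi>))\<^sup>2)"
    by (rule Bochner_Integration.integrable_bound[OF S]) (use le in \<open>auto intro!: AE_I2 order_trans[OF le]\<close>)
  then show "(\<lambda>x. f x + g x) \<in> sobolev s" using sobolev_is_fourier(1)[OF fg] by simp
  have "sobolev_energy s (\<lambda>x. f x + g x) \<le> (LINT \<xi>|lborel. ?S \<xi>)"
    unfolding sobolev_is_fourier(2)[OF fg] by (rule integral_mono[OF int S le])
  also have "\<dots> = 2 * sobolev_energy s f + 2 * sobolev_energy s g"
    using i by (simp add: sobolev_energy_def)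
  finally show "sobolev_energy s (\<lambda>x. f x + g x) \<le> 2 * sobolev_energy s f + 2 * sobolev_energy s g" .
qed

text \<open>
  The single comparison principle behind all bounds of quadratic expressions by the Sobolev energy.
\<close>

lemma multiplier_energy_le:
  assumes fg: "is_fourier f g" and f: "f \<in> sobolev s" and [measurable]: "m \<in> borel_measurable borel"
    and m: "\<And>\<xi>. \<bar>m \<xi>\<bar> \<le> C * (1 + \<xi>\<^sup>2) powr s"
  shows "integrable lborel (\<lambda>\<xi>. m \<xi> * (cmod (g \<xi>))\<^sup>2)"
    and "\<bar>LINT \<xi>|lborel. m \<xi> * (cmod (g \<xi>))\<^sup>2\<bar> \<le> C * sobolev_energy s f"
proof -
  have [measurable]: "g \<in> borel_measurable borel" using fg by (auto simp: is_fourier_iff)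
  have i: "integrable lborel (\<lambda>\<xi>. C * ((1 + \<xi>\<^sup>2) powr s * (cmod (g \<xi>))\<^sup>2))"
    using f sobolev_is_fourier(1)[OF fg, of s] by simp
  have le: "\<bar>m \<xi> * (cmod (g \<xi>))\<^sup>2\<bar> \<le> C * ((1 + \<xi>\<^sup>2) powr s * (cmod (g \<xi>))\<^sup>2)" for \<xi>
    using mult_right_mono[OF m[of \<xi>], of "(cmod (g \<xi>))\<^sup>2"] by (simp add: abs_mult mult.assoc)
  show 1: "integrable lborel (\<lambda>\<xi>. m \<xi> * (cmod (g \<xi>))\<^sup>2)"
    by (rule Bochner_Integration.integrable_bound[OF i]) (measurable, simp add: order_trans[OF le abs_ge_self])
  have "\<bar>LINT \<xi>|lborel. m \<xi> * (cmod (g \<xi>))\<^sup>2\<bar> \<le> (LINT \<xi>|lborel. norm (m \<xi> * (cmod (g \<xi>))\<^sup>2))"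
    using integral_norm_bound[of lborel "\<lambda>\<xi>. m \<xi> * (cmod (g \<xi>))\<^sup>2"] by simp
  also have "\<dots> \<le> (LINT \<xi>|lborel. C * ((1 + \<xi>\<^sup>2) powr s * (cmod (g \<xi>))\<^sup>2))"
    by (rule integral_mono[OF integrable_norm[OF 1] i le[folded real_norm_def]])
  also have "\<dots> = C * sobolev_energy s f" by (simp add: sobolev_is_fourier(2)[OF fg])
  finally show "\<bar>LINT \<xi>|lborel. m \<xi> * (cmod (g \<xi>))\<^sup>2\<bar> \<le> C * sobolev_energy s f" .
qed

lemma norm_cls_eq_energy:
  assumes "is_fourier f g"
  shows "(norm (cls f))\<^sup>2 = (LINT \<xi>|lborel. (cmod (g \<xi>))\<^sup>2)"
  using assms norm_L2_fourier[of "cls f"] by (auto simp: is_fourier_iff simp flip: norm_cls_sq)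

lemma norm_cls_le_sobolev_energy:
  assumes "f \<in> sobolev s" "s \<ge> 0"
  shows "(norm (cls f))\<^sup>2 \<le> sobolev_energy s f"
proof -
  have f: "is_fourier f (fourier f)" using assms(1) by (intro is_fourier_fourier sobolev_L2)
  have "1 \<le> (1 + \<xi>\<^sup>2) powr s" for \<xi> :: real using assms(2) by (intro ge_one_powr_ge_zero) auto
  then show ?thesis
    using multiplier_energy_le(2)[OF f assms(1), of "\<lambda>_. 1" 1] norm_cls_eq_energy[OF f] by simp
qed

lemma integrable_bracket_powr:
  assumes s: "s > 1/2"
  shows "integrable lborel (\<lambda>\<xi>::real. (1 + \<xi>\<^sup>2) powr (- s))"
proof -
  have half: "integrable lborel (\<lambda>\<xi>::real. indicator {1..} \<xi> *\<^sub>R \<xi> powr (- (2 * s)))"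
  proof -
    have "((\<lambda>\<xi>. \<xi> powr (- (2 * s))) has_integral - (1 powr (- (2 * s) + 1)) / (- (2 * s) + 1)) {1..}"
      using s by (intro has_integral_powr_to_inf) auto
    then have "(\<lambda>\<xi>. \<xi> powr (- (2 * s))) absolutely_integrable_on {1..}"
      by (intro nonnegative_absolutely_integrable_1) (auto simp: has_integral_integrable)
    then show ?thesis
      by (simp add: set_integrable_def integrable_completion)
  qed
  have ind: "integrable lborel (indicat_real {-1..1::real})"
    by (intro integrable_real_indicator) (auto simp: emeasure_lborel_Icc_eq)
  have "integrable lborel (\<lambda>\<xi>::real. indicator {-1..1} \<xi> + indicator {1..} \<xi> *\<^sub>R \<xi> powr (- (2 * s)) + indicator {1..} (-\<xi>) *\<^sub>R (-\<xi>) powr (- (2 * s)))"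
    using lborel_integrable_real_affine[OF half, of "-1" 0] half ind by (intro Bochner_Integration.integrable_add) auto
  then show ?thesis
  proof (rule Bochner_Integration.integrable_bound)
    have pw: "(1 + \<xi>\<^sup>2) powr (- s) \<le> \<bar>\<xi>\<bar> powr (- (2 * s))" if "\<bar>\<xi>\<bar> \<ge> 1" for \<xi> :: real
    proof -
      have "(1 + \<xi>\<^sup>2) powr (- s) \<le> (\<xi>\<^sup>2) powr (- s)" using that s by (intro powr_mono2') auto
      also have "(\<xi>\<^sup>2) powr (- s) = \<bar>\<xi>\<bar> powr (- (2 * s))"
      proof -
        have "\<xi>\<^sup>2 = \<bar>\<xi>\<bar> powr 2" using that by (simp add: powr_numeral)
        then have "(\<xi>\<^sup>2) powr (- s) = \<bar>\<xi>\<bar> powr (2 * - s)" by (simp only: powr_powr)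
        then show ?thesis by simp
      qed
      finally show ?thesis .
    qed
    have p1: "(1 + \<xi>\<^sup>2) powr (- s) \<le> 1" for \<xi> :: real using s powr_mono[of "-s" 0 "1 + \<xi>\<^sup>2"] by (simp split: if_splits)
    show "AE \<xi> in lborel. norm ((1 + \<xi>\<^sup>2) powr (- s)) \<le>
        norm (indicator {-1..1} \<xi> + indicator {1..} \<xi> *\<^sub>R \<xi> powr (- (2 * s)) + indicator {1..} (-\<xi>) *\<^sub>R (-\<xi>) powr (- (2 * s)))"
    proof (intro AE_I2)
      fix \<xi> :: real
      consider "\<bar>\<xi>\<bar> \<le> 1" | "\<xi> > 1" | "\<xi> < -1" by linarith
      then show "norm ((1 + \<xi>\<^sup>2) powr (- s)) \<le>
        norm (indicator {-1..1} \<xi> + indicator {1..} \<xi> *\<^sub>R \<xi> powr (- (2 * s)) + indicator {1..} (-\<xi>) *\<^sub>R (-\<xi>) powr (- (2 * s)))"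
      proof cases
        case 1
        then have "indicat_real {-1..1} \<xi> = 1" by (auto simp: indicator_def)
        then show ?thesis using p1[of \<xi>] by (simp add: add_nonneg_nonneg) (smt (verit) indicator_pos_le powr_ge_zero mult_nonneg_nonneg)
      qed (use pw[of \<xi>] in \<open>auto simp: indicator_def\<close>)
    qed
  qed measurable
qed

definition sobolev_constant :: "real \<Rightarrow> real" where
  "sobolev_constant s = (LINT \<xi>|lborel. (1 + \<xi>\<^sup>2) powr (- s))"

text \<open>
  The transform is integrable by the Cauchy-Schwarz inequality, since \<open>(1 + \<xi>\<^sup>2) powr (- s)\<close> is integrable
  for \<open>s > 1/2\<close>, and the integral of its modulus bounds the inverse Fourier integral.
\<close>

theorem sobolev_embedding:
  assumes f: "f \<in> sobolev s" and s: "s > 1/2"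
  shows "AE x in lborel. cmod (f x) \<le> sqrt (sobolev_constant s * sobolev_energy s f)"
proof -
  have f2: "f \<in> L2" using f by (rule sobolev_L2)
  let ?g = "fourier f"
  have g [measurable]: "?g \<in> borel_measurable borel" using fourier_L2[OF f2] by auto
  \<comment> \<open>the transform factors into two square-integrable functions\<close>
  define u where "u \<xi> = complex_of_real ((1 + \<xi>\<^sup>2) powr (- (s/2)))" for \<xi> :: real
  define v where "v \<xi> = complex_of_real ((1 + \<xi>\<^sup>2) powr (s/2)) * ?g \<xi>" for \<xi> :: real
  have pos: "1 + \<xi>\<^sup>2 \<noteq> 0" for \<xi> :: real by (metis add_pos_nonneg less_irrefl zero_le_power2 zero_less_one)
  have uv: "u \<xi> * v \<xi> = ?g \<xi>" for \<xi>
    using pos[of \<xi>] by (simp add: u_def v_def flip: mult.assoc of_real_mult powr_add)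
  have u2: "(cmod (u \<xi>))\<^sup>2 = (1 + \<xi>\<^sup>2) powr (- s)" for \<xi>
    using pos[of \<xi>] by (simp add: u_def power2_eq_square flip: powr_add)
  have v2: "(cmod (v \<xi>))\<^sup>2 = (1 + \<xi>\<^sup>2) powr s * (cmod (?g \<xi>))\<^sup>2" for \<xi>
    using pos[of \<xi>] by (simp add: v_def norm_mult power_mult_distrib) (simp add: power2_eq_square flip: powr_add)
  have [measurable]: "u \<in> borel_measurable borel" "v \<in> borel_measurable borel"
    unfolding u_def[abs_def] v_def[abs_def] by measurable
  have u: "u \<in> L2" using integrable_bracket_powr[OF s] by (simp add: L2_def u2)
  have v: "v \<in> L2" using sobolev_integrable[OF f] by (simp add: L2_def v2)
  have gi: "integrable lborel ?g" using L2_prod_integrable[OF u v] by (simp add: uv)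
  have "(LINT \<xi>|lborel. cmod (?g \<xi>)) = (LINT \<xi>|lborel. cmod (u \<xi>) * cmod (v \<xi>))"
    by (simp flip: uv add: norm_mult)
  also have "\<dots> = inner (cls (\<lambda>x. complex_of_real (cmod (u x)))) (cls (\<lambda>x. complex_of_real (cmod (v x))))"
    using u v by (simp add: inner_cls)
  also have "\<dots> \<le> norm (cls (\<lambda>x. complex_of_real (cmod (u x)))) * norm (cls (\<lambda>x. complex_of_real (cmod (v x))))"
    by (rule norm_cauchy_schwarz)
  also have "\<dots> \<le> norm (cls u) * norm (cls v)" using u v by (intro mult_mono norm_cls_le) auto
  also have "norm (cls u) = sqrt (sobolev_constant s)"
    using norm_cls_sq[OF u] by (simp add: u2 sobolev_constant_def real_sqrt_unique)
  also have "norm (cls v) = sqrt (sobolev_energy s f)"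
    using norm_cls_sq[OF v] by (simp add: v2 sobolev_energy_def real_sqrt_unique)
  finally have L1: "(LINT \<xi>|lborel. cmod (?g \<xi>)) \<le> sqrt (sobolev_constant s * sobolev_energy s f)"
    by (simp add: real_sqrt_mult)
  have "AE x in lborel. f x = cnj (fourier_integral (\<lambda>\<xi>. cnj (?g \<xi>)) x)"
    by (rule is_fourier_inj[OF is_fourier_fourier[OF f2] is_fourier_inverse_integral[OF gi fourier_L2[OF f2]]]) simp
  then show ?thesis
  proof eventually_elim
    case (elim x)
    have "integrable lborel (\<lambda>\<xi>. cnj (?g \<xi>))" using gi by simp
    from fourier_integral_bound[OF this, of x] show ?case using L1 elim by simp
  qed
qed

lemma cmod_cis_minus_one: "(cmod (cis \<theta> - 1))\<^sup>2 \<le> \<theta>\<^sup>2" "(cmod (cis \<theta> - 1))\<^sup>2 \<le> 4"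
proof -
  have eq: "(cmod (cis \<theta> - 1))\<^sup>2 = 4 * (sin (\<theta> / 2))\<^sup>2"
  proof -
    have "(cmod (cis \<theta> - 1))\<^sup>2 = 2 - 2 * cos \<theta>"
      using sin_cos_squared_add[of \<theta>] by (simp add: cmod_power2 power2_diff)
    also have "cos \<theta> = 1 - 2 * (sin (\<theta> / 2))\<^sup>2" using cos_double_sin[of "\<theta>/2"] by simp
    finally show ?thesis by simp
  qed
  show "(cmod (cis \<theta> - 1))\<^sup>2 \<le> 4" unfolding eq using abs_sin_le_one[of "\<theta> / 2"] by (simp add: abs_square_le_1)
  have "(sin (\<theta> / 2))\<^sup>2 \<le> (\<theta> / 2)\<^sup>2" using abs_sin_x_le_abs_x[of "\<theta> / 2"] by (simp only: abs_le_square_iff)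
  then show "(cmod (cis \<theta> - 1))\<^sup>2 \<le> \<theta>\<^sup>2" unfolding eq by (simp add: power_divide)
qed

text \<open>
  Interpolation between the bounds \<open>\<bar>\<theta>\<bar>\<close> and \<open>2\<close> for \<open>cmod (cis \<theta> - 1)\<close>.
\<close>

lemma cmod_cis_minus_one_powr:
  assumes "0 < \<sigma>" "\<sigma> \<le> 1" "\<sigma> \<le> s"
  shows "(cmod (cis (\<xi> * h) - 1))\<^sup>2 \<le> 4 * \<bar>h\<bar> powr (2 * \<sigma>) * (1 + \<xi>\<^sup>2) powr s"
proof (cases "h = 0 \<or> \<xi> = 0")
  case False
  have "(cmod (cis (\<xi> * h) - 1))\<^sup>2 \<le> 4 * \<bar>\<xi> * h\<bar> powr (2 * \<sigma>)"
  proof (cases "\<bar>\<xi> * h\<bar> \<le> 1")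
    case True
    have "(\<xi> * h)\<^sup>2 = \<bar>\<xi> * h\<bar> powr 2" using False by (simp add: powr_numeral)
    also have "\<dots> \<le> \<bar>\<xi> * h\<bar> powr (2 * \<sigma>)" using True assms by (intro powr_mono') auto
    finally show ?thesis using cmod_cis_minus_one(1)[of "\<xi> * h"] powr_ge_zero[of "\<bar>\<xi> * h\<bar>" "2 * \<sigma>"] by linarith
  next
    case F: False
    then have "1 \<le> \<bar>\<xi> * h\<bar> powr (2 * \<sigma>)" using assms by (intro ge_one_powr_ge_zero) auto
    then show ?thesis using cmod_cis_minus_one(2)[of "\<xi> * h"] by linarith
  qed
  also have "\<bar>\<xi> * h\<bar> powr (2 * \<sigma>) = \<bar>h\<bar> powr (2 * \<sigma>) * (\<xi>\<^sup>2) powr \<sigma>"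
  proof -
    have "\<xi>\<^sup>2 = \<bar>\<xi>\<bar> powr 2" using False by (simp add: powr_numeral)
    then have "(\<xi>\<^sup>2) powr \<sigma> = \<bar>\<xi>\<bar> powr (2 * \<sigma>)" by (simp only: powr_powr)
    then show ?thesis by (simp add: abs_mult powr_mult mult.commute)
  qed
  also have "(\<xi>\<^sup>2) powr \<sigma> \<le> (1 + \<xi>\<^sup>2) powr s"
  proof -
    have "(\<xi>\<^sup>2) powr \<sigma> \<le> (1 + \<xi>\<^sup>2) powr \<sigma>" using assms by (intro powr_mono2) auto
    also have "\<dots> \<le> (1 + \<xi>\<^sup>2) powr s" using assms by (intro powr_mono) auto
    finally show ?thesis .
  qed
  finally show ?thesis by (simp add: mult_left_mono mult.assoc)
qed (use assms in auto)

text \<open>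
  With \<open>\<sigma> > 1/2\<close> the right-hand side is of smaller order than \<open>h\<close>, so that it survives the division by \<open>h\<close>
  in the momentum at scale \<open>h\<close>.
\<close>

lemma shift_diff_sobolev:
  assumes f: "f \<in> sobolev s" and "0 < \<sigma>" "\<sigma> \<le> 1" "\<sigma> \<le> s"
  shows "(norm (cls (\<lambda>x. f (x + h) - f x)))\<^sup>2 \<le> 4 * \<bar>h\<bar> powr (2 * \<sigma>) * sobolev_energy s f"
proof -
  have F: "is_fourier f (fourier f)" using f by (intro is_fourier_fourier sobolev_L2)
  have "is_fourier (\<lambda>x. f (x + h) - f x) (\<lambda>\<xi>. cis (\<xi> * h) * fourier f \<xi> - fourier f \<xi>)"
    by (intro is_fourier_diff is_fourier_shift F)
  from norm_cls_eq_energy[OF this]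
  have "(norm (cls (\<lambda>x. f (x + h) - f x)))\<^sup>2 = (LINT \<xi>|lborel. (cmod (cis (\<xi> * h) - 1))\<^sup>2 * (cmod (fourier f \<xi>))\<^sup>2)"
    by (simp add: left_diff_distrib flip: power_mult_distrib norm_mult)
  also have "\<dots> \<le> 4 * \<bar>h\<bar> powr (2 * \<sigma>) * sobolev_energy s f"
    using multiplier_energy_le(2)[OF F f, of "\<lambda>\<xi>. (cmod (cis (\<xi> * h) - 1))\<^sup>2" "4 * \<bar>h\<bar> powr (2 * \<sigma>)"]
      cmod_cis_minus_one_powr[OF assms(2-4)] by simp
  finally show ?thesis .
qed

section \<open>The forcing and the momentum flux\<close>

text \<open>
  The inhomogeneity in Duhamel's formula: the equation reads \<open>\<i> w\<^sub>t + w\<^sub>x\<^sub>x = forcing w\<close>.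
\<close>

definition forcing :: "complex \<Rightarrow> complex" where
  "forcing w = G w - complex_of_real (2 * Re w)"

text \<open>
  This is \<open>\<bar>1 + w\<bar>\<^sup>2 - 1\<close>, the deviation of the intensity from that of the Stokes wave.
\<close>

definition intensity_defect :: "complex \<Rightarrow> real" where
  "intensity_defect w = 2 * Re w + (cmod w)\<^sup>2"

lemma forcing_eq: "forcing w = - complex_of_real (intensity_defect w) * (1 + w)"
proof -
  have "w\<^sup>2 = complex_of_real (2 * Re w) * w - complex_of_real ((cmod w)\<^sup>2)"
    by (simp add: complex_eq_iff power2_eq_square cmod_def real_sqrt_mult_self algebra_simps)
  then show ?thesis
    by (simp add: forcing_def G_def intensity_defect_def algebra_simps)
qed

lemma intensity_defect_le: "\<bar>intensity_defect w\<bar> \<le> (2 + cmod w) * cmod w"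
  using abs_Re_le_cmod[of w] abs_triangle_ineq[of "2 * Re w" "(cmod w)\<^sup>2"]
  by (simp add: intensity_defect_def power2_eq_square algebra_simps)

lemma intensity_defect_add:
  "intensity_defect (a + d) = intensity_defect a + (2 * Re ((1 + a) * cnj d) + (cmod d)\<^sup>2)"
  unfolding intensity_defect_def cmod_power2 by (simp add: power2_eq_square algebra_simps)

text \<open>
  The forcing is minus the gradient of \<open>V(w) = (intensity_defect w)\<^sup>2 / 4\<close>, and the left-hand side is the
  remainder in the first-order Taylor expansion of \<open>V\<close> at \<open>a\<close>. It can be computed exactly, as
  \<open>intensity_defect\<close> is a quadratic polynomial in the real and imaginary parts.
\<close>

lemma forcing_potential:
  assumes a: "cmod a \<le> M" and b: "cmod b \<le> M"
  shows "\<bar>Re (forcing a * cnj (b - a)) - ((intensity_defect a)\<^sup>2 / 4 - (intensity_defect b)\<^sup>2 / 4)\<bar>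
    \<le> ((2 + M) * M + (2 + 4 * M)\<^sup>2) * (cmod (b - a))\<^sup>2"
proof -
  \<comment> \<open>the intensity defect changes by \<open>\<eta>\<close>, which is \<open>O(cmod d)\<close>; the remainder is \<open>\<rho> * (cmod d)\<^sup>2 / 2 + \<eta>\<^sup>2 / 4\<close>\<close>
  define d where "d = b - a"
  define \<rho> where "\<rho> = intensity_defect a"
  define \<eta> where "\<eta> = 2 * Re ((1 + a) * cnj d) + (cmod d)\<^sup>2"
  have M: "M \<ge> 0" using a norm_ge_zero order_trans by blast
  have b': "intensity_defect b = \<rho> + \<eta>"
    using intensity_defect_add[of a d] by (simp add: d_def \<rho>_def \<eta>_def)
  have f: "Re (forcing a * cnj d) = - \<rho> * Re ((1 + a) * cnj d)"
    by (simp add: forcing_eq \<rho>_def mult.assoc)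
  have "Re (forcing a * cnj d) - (\<rho>\<^sup>2 / 4 - (\<rho> + \<eta>)\<^sup>2 / 4) = \<rho> * (cmod d)\<^sup>2 / 2 + \<eta>\<^sup>2 / 4"
    unfolding f by (simp add: \<eta>_def power2_eq_square field_simps)
  also have "\<bar>\<dots>\<bar> \<le> \<bar>\<rho>\<bar> * (cmod d)\<^sup>2 + \<eta>\<^sup>2"
  proof -
    have "\<bar>\<rho> * (cmod d)\<^sup>2 / 2\<bar> = \<bar>\<rho>\<bar> * (cmod d)\<^sup>2 / 2" "0 \<le> \<bar>\<rho>\<bar> * (cmod d)\<^sup>2"
      by (simp_all add: abs_mult)
    then show ?thesis
      using abs_triangle_ineq[of "\<rho> * (cmod d)\<^sup>2 / 2" "\<eta>\<^sup>2 / 4"] zero_le_power2[of \<eta>] by linarith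
  qed
  also have "\<dots> \<le> (2 + M) * M * (cmod d)\<^sup>2 + ((2 + 4 * M) * cmod d)\<^sup>2"
  proof (intro add_mono mult_right_mono)
    have "\<bar>\<rho>\<bar> \<le> (2 + cmod a) * cmod a" unfolding \<rho>_def by (rule intensity_defect_le)
    also have "\<dots> \<le> (2 + M) * M" using a M by (intro mult_mono) auto
    finally show "\<bar>\<rho>\<bar> \<le> (2 + M) * M" .
    have d: "cmod d \<le> 2 * M" using norm_triangle_ineq4[of b a] a b by (simp add: d_def)
    have u: "cmod (1 + a) \<le> 1 + M" using norm_triangle_ineq[of 1 a] a by simp
    have "\<bar>Re ((1 + a) * cnj d)\<bar> \<le> cmod (1 + a) * cmod d"
      using abs_Re_le_cmod[of "(1 + a) * cnj d"] by (simp add: norm_mult)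
    also have "\<dots> \<le> (1 + M) * cmod d" using u by (intro mult_right_mono) auto
    finally have "\<bar>Re ((1 + a) * cnj d)\<bar> \<le> (1 + M) * cmod d" .
    moreover have "(cmod d)\<^sup>2 \<le> 2 * M * cmod d" using d by (simp add: power2_eq_square mult_right_mono)
    ultimately have "\<bar>\<eta>\<bar> \<le> (2 + 4 * M) * cmod d"
      unfolding \<eta>_def distrib_right using zero_le_power2[of "cmod d"] by linarith
    then show "\<eta>\<^sup>2 \<le> ((2 + 4 * M) * cmod d)\<^sup>2"
      using M by (simp add: abs_le_square_iff[symmetric] abs_mult)
  qed auto
  also have "\<dots> = ((2 + M) * M + (2 + 4 * M)\<^sup>2) * (cmod d)\<^sup>2"
    by (simp only: power_mult_distrib distrib_right[symmetric])
  finally show ?thesis unfolding b' \<rho>_def[symmetric] d_def[symmetric] .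
qed

lemma forcing_le:
  assumes "cmod w \<le> M" shows "cmod (forcing w) \<le> (2 + M) * (1 + M) * cmod w"
proof -
  have M: "M \<ge> 0" using assms norm_ge_zero order_trans by blast
  have "cmod (forcing w) = \<bar>intensity_defect w\<bar> * cmod (1 + w)" by (simp add: forcing_eq norm_mult)
  also have "\<dots> \<le> ((2 + cmod w) * cmod w) * (1 + M)"
    using norm_triangle_ineq[of 1 w] assms by (intro mult_mono intensity_defect_le) auto
  also have "\<dots> \<le> ((2 + M) * cmod w) * (1 + M)"
    using assms M by (intro mult_right_mono) auto
  finally show ?thesis by (simp add: mult_ac)
qed

lemma borel_measurable_forcing [measurable]:
  assumes [measurable]: "w \<in> borel_measurable M"
  shows "(\<lambda>x. forcing (w x)) \<in> borel_measurable M"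
  unfolding forcing_eq intensity_defect_def by measurable

lemma forcing_L2:
  assumes w: "w \<in> L2" and M: "AE x in lborel. cmod (w x) \<le> M"
  shows "(\<lambda>x. forcing (w x)) \<in> L2" "norm (cls (\<lambda>x. forcing (w x))) \<le> (2 + M) * (1 + M) * norm (cls w)"
proof -
  have M0: "M \<ge> 0"
  proof (rule ccontr)
    assume "\<not> M \<ge> 0"
    with M have "AE x::real in lborel. False" by (auto elim!: eventually_mono dest: order_trans[OF norm_ge_zero])
    then show False by (simp add: AE_iff_null null_sets_def)
  qed
  have le: "AE x in lborel. cmod (forcing (w x)) \<le> cmod (complex_of_real ((2 + M) * (1 + M)) * w x)"
    using M by eventually_elim (use M0 forcing_le in \<open>simp add: norm_mult del: of_real_mult of_real_add\<close>)
  show 1: "(\<lambda>x. forcing (w x)) \<in> L2"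
  proof (rule L2_dominated[OF _ L2_integrable[OF L2_cmult[OF w]]])
    show "AE x in lborel. (cmod (forcing (w x)))\<^sup>2 \<le> (cmod (complex_of_real ((2 + M) * (1 + M)) * w x))\<^sup>2"
      using le by eventually_elim (intro power_mono norm_ge_zero)
  qed (use w in measurable)
  have "norm (cls (\<lambda>x. forcing (w x))) \<le> norm (cls (\<lambda>x. complex_of_real ((2 + M) * (1 + M)) * w x))"
    by (rule norm_cls_le[OF 1 L2_cmult[OF w] le])
  also have "\<dots> = (2 + M) * (1 + M) * norm (cls w)"
    unfolding norm_cls_cmult[OF w] using M0 by (simp del: of_real_mult of_real_add)
  finally show "norm (cls (\<lambda>x. forcing (w x))) \<le> (2 + M) * (1 + M) * norm (cls w)" .
qed

lemma AE_shift:
  assumes "AE x in lborel. P x" and [measurable]: "Measurable.pred borel P"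
  shows "AE x::real in lborel. P (x + h)"
  using AE_borel_affine[of 1 P h] assms by (simp add: add.commute)

text \<open>
  Expanding the potential at \<open>w x\<close> towards \<open>w (x + h)\<close> and towards \<open>w (x - h)\<close>, the first-order
  contributions are differences of translates of one integrable function and integrate to \<open>0\<close>.
  What is left are the quadratic remainders.
\<close>

theorem momentum_flux_bound:
  assumes w: "w \<in> L2" and M: "AE x in lborel. cmod (w x) \<le> M"
  shows "\<bar>inner (cls (\<lambda>x. forcing (w x))) (cls (\<lambda>x. w (x + h) - w (x + - h)))\<bar>
    \<le> 2 * ((2 + M) * M + (2 + 4 * M)\<^sup>2) * (norm (cls (\<lambda>x. w (x + h) - w x)))\<^sup>2"
proof -
  let ?C = "(2 + M) * M + (2 + 4 * M)\<^sup>2"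
  have [measurable]: "w \<in> borel_measurable borel" using w by auto
  let ?V = "\<lambda>x. (intensity_defect (w x))\<^sup>2 / 4"
  have V: "integrable lborel ?V"
  proof (rule Bochner_Integration.integrable_bound)
    show "integrable lborel (\<lambda>x. (2 + M)\<^sup>2 * (cmod (w x))\<^sup>2)" using L2_integrable[OF w] by simp
    show "AE x in lborel. norm (?V x) \<le> norm ((2 + M)\<^sup>2 * (cmod (w x))\<^sup>2)"
      using M
    proof eventually_elim
      case (elim x)
      have "\<bar>intensity_defect (w x)\<bar> \<le> (2 + M) * cmod (w x)"
        using intensity_defect_le[of "w x"] elim by (meson add_left_mono mult_right_mono norm_ge_zero order_trans)
      then have "(intensity_defect (w x))\<^sup>2 \<le> ((2 + M) * cmod (w x))\<^sup>2"
        by (metis abs_ge_zero power2_abs power_mono)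
      then have "?V x \<le> (2 + M)\<^sup>2 * (cmod (w x))\<^sup>2"
        using zero_le_power2[of "intensity_defect (w x)"] by (simp only: power_mult_distrib)
      then show ?case by simp
    qed
  qed (unfold intensity_defect_def, measurable)
  let ?R = "\<lambda>k x. Re (forcing (w x) * cnj (w (x + k) - w x))"
  have R: "integrable lborel (?R k)" for k
    using forcing_L2(1)[OF w M] w by (intro L2_Re_integrable L2_diff L2_shift)
  let ?D = "\<lambda>k x. (cmod (w (x + k) - w x))\<^sup>2"
  have D: "integrable lborel (?D k)" for k using w by (intro L2_integrable L2_diff L2_shift)
  have main: "\<bar>LINT x|lborel. ?R k x\<bar> \<le> ?C * (norm (cls (\<lambda>x. w (x + k) - w x)))\<^sup>2" for k
  proof -
    have "(LINT x|lborel. ?V x - ?V (x + k)) = 0"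
      using V integrable_shift[OF V, of k] integral_shift[of ?V k] by simp
    then have "(LINT x|lborel. ?R k x) = (LINT x|lborel. ?R k x - (?V x - ?V (x + k)))"
      using R[of k] V integrable_shift[OF V, of k] by simp
    moreover have "\<bar>LINT x|lborel. ?R k x - (?V x - ?V (x + k))\<bar> \<le> (LINT x|lborel. \<bar>?R k x - (?V x - ?V (x + k))\<bar>)"
      using integral_norm_bound[of lborel "\<lambda>x. ?R k x - (?V x - ?V (x + k))"] by simp
    moreover have "(LINT x|lborel. \<bar>?R k x - (?V x - ?V (x + k))\<bar>) \<le> (LINT x|lborel. ?C * ?D k x)"
    proof (rule integral_mono_AE)
      show "integrable lborel (\<lambda>x. \<bar>?R k x - (?V x - ?V (x + k))\<bar>)"
        using R[of k] V integrable_shift[OF V, of k] by (intro integrable_abs Bochner_Integration.integrable_diff) auto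
      show "integrable lborel (\<lambda>x. ?C * ?D k x)" using D[of k] by simp
      have "AE x in lborel. cmod (w (x + k)) \<le> M" by (rule AE_shift[OF M]) measurable
      with M show "AE x in lborel. \<bar>?R k x - (?V x - ?V (x + k))\<bar> \<le> ?C * ?D k x"
        by eventually_elim (rule forcing_potential)
    qed
    moreover have "(LINT x|lborel. ?C * ?D k x) = ?C * (norm (cls (\<lambda>x. w (x + k) - w x)))\<^sup>2"
      using w by (simp add: norm_cls_sq)
    ultimately show ?thesis by linarith
  qed
  have "norm (cls (\<lambda>x. w (x + - h) - w x)) = norm (cls (\<lambda>x. w (x + h) - w x))"
  proof -
    have "norm (cls (\<lambda>x. w (x + - h) - w x)) = norm (cls (\<lambda>x. w (x + h + - h) - w (x + h)))"
      using norm_cls_shift[of "\<lambda>x. w (x + - h) - w x" h] L2_diff[OF L2_shift[OF w] w, of "- h"] by simp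
    also have "\<dots> = norm (cls (\<lambda>x. w (x + h) - w x))"
      using w L2_shift[OF w, of h] by (simp add: cls_diff norm_minus_commute)
    finally show ?thesis .
  qed
  moreover have "inner (cls (\<lambda>x. forcing (w x))) (cls (\<lambda>x. w (x + h) - w (x + - h))) =
      (LINT x|lborel. ?R h x) - (LINT x|lborel. ?R (- h) x)"
  proof -
    have "inner (cls (\<lambda>x. forcing (w x))) (cls (\<lambda>x. w (x + h) - w (x + - h))) =
        (LINT x|lborel. Re (forcing (w x) * cnj (w (x + h) - w (x + - h))))"
      by (intro inner_cls forcing_L2(1)[OF w M] L2_diff L2_shift w)
    also have "\<dots> = (LINT x|lborel. ?R h x - ?R (- h) x)"
      by (intro Bochner_Integration.integral_cong refl) (simp add: algebra_simps)
    also have "\<dots> = (LINT x|lborel. ?R h x) - (LINT x|lborel. ?R (- h) x)"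
      by (rule Bochner_Integration.integral_diff[OF R R])
    finally show ?thesis .
  qed
  ultimately show ?thesis
    using main[of h] main[of "- h"] by (simp only:)
qed

section \<open>Variation of a quadratic form along a gauge integral\<close>

abbreviation riemann_sum :: "(real \<times> real set) set \<Rightarrow> (real \<Rightarrow> 'a::real_vector) \<Rightarrow> 'a" where
  "riemann_sum D \<phi> \<equiv> \<Sum>(\<tau>, K)\<in>D. Henstock_Kurzweil_Integration.content K *\<^sub>R \<phi> \<tau>"

lemma riemann_sum_bound:
  fixes \<phi> :: "real \<Rightarrow> 'a :: real_normed_vector"
  assumes D: "D tagged_division_of {a..b}" and "a \<le> b" and \<phi>: "\<And>\<tau>. \<tau> \<in> {a..b} \<Longrightarrow> norm (\<phi> \<tau>) \<le> c"
  shows "norm (riemann_sum D \<phi>) \<le> c * (b - a)"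
proof -
  have "norm (riemann_sum D \<phi>)
      \<le> c * Henstock_Kurzweil_Integration.content (cbox a b)"
    by (rule rsum_bound) (use D \<phi> in auto)
  then show ?thesis using \<open>a \<le> b\<close> by simp
qed

text \<open>
  The hypotheses say that \<open>v t - v0\<close> is the gauge integral of \<open>g\<close> over \<open>[t0, t]\<close>, in terms of Riemann
  sums. Formally
  \<open>q(x) = inner (A x) x\<close> satisfies \<open>d/dt q(v t) = 2 * inner (A (g t)) (v t)\<close>. Instead of differentiating,
  one expands \<open>q (v b) - q (v a) = inner (A (v b - v a)) (v a + v b)\<close>, inserts a Riemann sum for
  \<open>v b - v a\<close>, and compares \<open>v a + v b\<close> with \<open>2 * v \<tau>\<close> at every tag. As \<open>v\<close> is Lipschitz, the error is
  quadratic in \<open>b - a\<close>, and it disappears after subdividing \<open>[t0, T]\<close> into many intervals.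
\<close>

theorem quadratic_form_variation:
  fixes A :: "'a::real_inner \<Rightarrow> 'a" and g v :: "real \<Rightarrow> 'a" and v0 :: 'a
  assumes A: "bounded_linear A" and sym: "\<And>x y. inner (A x) y = inner x (A y)"
    and T: "t0 \<le> T"
    and M: "\<And>\<tau>. \<tau> \<in> {t0..T} \<Longrightarrow> norm (g \<tau>) \<le> M"
    and int: "\<And>t e. t \<in> {t0..T} \<Longrightarrow> e > 0 \<Longrightarrow> \<exists>\<gamma>. gauge \<gamma> \<and>
      (\<forall>D. D tagged_division_of {t0..t} \<and> \<gamma> fine D \<longrightarrow>
        norm (riemann_sum D g - (v t - v0)) < e)"
    and \<kappa>: "\<And>\<tau>. \<tau> \<in> {t0..T} \<Longrightarrow> \<bar>inner (A (g \<tau>)) (v \<tau>)\<bar> \<le> \<kappa>"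
  shows "\<bar>inner (A (v T)) (v T) - inner (A v0) v0\<bar> \<le> 2 * \<kappa> * (T - t0)"
proof -
  let ?s = "\<lambda>D. riemann_sum D g"
  define q where "q x = inner (A x) x" for x
  define m where "m = onorm A"
  have m: "norm (A x) \<le> m * norm x" for x unfolding m_def by (rule onorm[OF A])
  have m0: "m \<ge> 0" unfolding m_def by (rule onorm_pos_le[OF A])
  have M0: "M \<ge> 0" using order_trans[OF norm_ge_zero M[of t0]] T by simp
  have riemann: "\<exists>D. D tagged_division_of {a..b} \<and> norm (?s D - (v b - v a)) < e"
    if ab: "t0 \<le> a" "a \<le> b" "b \<le> T" and e: "e > 0" for a b e
  proof -
    obtain \<gamma>a where ga: "gauge \<gamma>a" "\<And>D. D tagged_division_of {t0..a} \<Longrightarrow> \<gamma>a fine D \<Longrightarrow> norm (?s D - (v a - v0)) < e/2"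
      using int[of a "e/2"] ab e by auto
    obtain \<gamma>b where gb: "gauge \<gamma>b" "\<And>D. D tagged_division_of {t0..b} \<Longrightarrow> \<gamma>b fine D \<Longrightarrow> norm (?s D - (v b - v0)) < e/2"
      using int[of b "e/2"] ab e by auto
    obtain D1 where D1: "D1 tagged_division_of {t0..a}" "(\<lambda>x. \<gamma>a x \<inter> \<gamma>b x) fine D1"
      using fine_division_exists_real[OF gauge_Int[OF ga(1) gb(1)], of t0 a] by blast
    obtain D2 where D2: "D2 tagged_division_of {a..b}" "\<gamma>b fine D2"
      using fine_division_exists_real[OF gb(1), of a b] by blast
    \<comment> \<open>a fine division of \<open>[t0, a]\<close> extended to \<open>[t0, b]\<close>: the integral over \<open>[a, b]\<close> is a difference\<close>
    have "(D1 \<union> D2) tagged_division_of {t0..b}"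
    proof (rule tagged_division_Un_interval_real[of D1 t0 b 1 a D2])
      have "{t0..b} \<inter> {x. x \<bullet> 1 \<le> a} = {t0..a}" "{t0..b} \<inter> {x. a \<le> x \<bullet> 1} = {a..b}" using ab by auto
      then show "D1 tagged_division_of {t0..b} \<inter> {x. x \<bullet> 1 \<le> a}" "D2 tagged_division_of {t0..b} \<inter> {x. a \<le> x \<bullet> 1}"
        using D1(1) D2(1) by simp_all
    qed simp
    then have 1: "norm (?s (D1 \<union> D2) - (v b - v0)) < e/2"
      using D1(2) D2(2) by (intro gb(2)) (auto simp: fine_Un fine_Int)
    have 2: "norm (?s D1 - (v a - v0)) < e/2" using D1 by (intro ga(2)) (auto simp: fine_Int)
    have fin: "finite D1" "finite D2" using D1(1) D2(1) by (auto dest: tagged_division_of_finite)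
    \<comment> \<open>the two divisions can share only degenerate intervals\<close>
    have "Henstock_Kurzweil_Integration.content K = 0" if K: "(\<tau>, K) \<in> D1 \<inter> D2" for \<tau> K
    proof -
      have sub: "K \<subseteq> {t0..a}" "K \<subseteq> {a..b}"
        using K tagged_division_ofD(3)[OF D1(1), of \<tau> K] tagged_division_ofD(3)[OF D2(1), of \<tau> K] by auto
      obtain c d where cd: "K = {c..d}"
        using K tagged_division_ofD(4)[OF D1(1), of \<tau> K] by auto
      have "d \<le> c"
      proof (rule ccontr)
        assume "\<not> d \<le> c"
        then have "c \<in> K" "d \<in> K" by (auto simp: cd)
        then have "a \<le> c" "d \<le> a" using sub by auto
        then show False using \<open>\<not> d \<le> c\<close> by simp
      qed
      then show ?thesis by (simp add: cd content_real_if)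
    qed
    then have "?s (D1 \<union> D2) = ?s D1 + ?s D2"
      using fin by (intro sum.union_inter_neutral) auto
    then have "?s D2 - (v b - v a) = (?s (D1 \<union> D2) - (v b - v0)) - (?s D1 - (v a - v0))" by simp
    then have "norm (?s D2 - (v b - v a)) = norm ((?s (D1 \<union> D2) - (v b - v0)) - (?s D1 - (v a - v0)))"
      by (rule arg_cong)
    then have "norm (?s D2 - (v b - v a)) < e"
      using norm_triangle_ineq4[of "?s (D1 \<union> D2) - (v b - v0)" "?s D1 - (v a - v0)"] 1 2 by linarith
    then show ?thesis using D2(1) by blast
  qed
  have lip: "norm (v b - v a) \<le> M * (b - a)" if ab: "t0 \<le> a" "a \<le> b" "b \<le> T" for a b
  proof (rule field_le_epsilon)
    fix e :: real assume "e > 0"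
    then obtain D where D: "D tagged_division_of {a..b}" "norm (?s D - (v b - v a)) < e"
      using riemann[OF ab] by blast
    have "norm (?s D) \<le> M * (b - a)" using D(1) ab by (intro riemann_sum_bound M) auto
    then show "norm (v b - v a) \<le> M * (b - a) + e"
      using D(2) norm_triangle_ineq2[of "v b - v a" "?s D"] by (simp add: norm_minus_commute)
  qed
  have step: "\<bar>q (v b) - q (v a)\<bar> \<le> 2 * \<kappa> * (b - a) + m * M\<^sup>2 * (b - a)\<^sup>2"
    if ab: "t0 \<le> a" "a \<le> b" "b \<le> T" for a b
  proof (rule field_le_epsilon)
    fix e' :: real assume e': "e' > 0"
    define e where "e = e' / (m * norm (v a + v b) + 1)"
    have den: "m * norm (v a + v b) + 1 > 0" using m0 by (simp add: add_nonneg_pos)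
    have e: "e > 0" using e' den by (simp add: e_def)
    then obtain D where D: "D tagged_division_of {a..b}" "norm (?s D - (v b - v a)) < e"
      using riemann[OF ab] by blast
    have tag_bound: "\<bar>inner (A (g \<tau>)) (v a + v b)\<bar> \<le> 2 * \<kappa> + m * M\<^sup>2 * (b - a)" if \<tau>: "\<tau> \<in> {a..b}" for \<tau>
    proof -
      have split: "inner (A (g \<tau>)) (v a + v b) =
          2 * inner (A (g \<tau>)) (v \<tau>) + inner (A (g \<tau>)) ((v b - v \<tau>) - (v \<tau> - v a))"
        by (simp add: inner_add_right inner_diff_right)
      \<comment> \<open>the two increments of \<open>v\<close> together are Lipschitz-small, whatever the position of the tag\<close>
      have "\<bar>inner (A (g \<tau>)) ((v b - v \<tau>) - (v \<tau> - v a))\<bar> \<le> norm (A (g \<tau>)) * norm ((v b - v \<tau>) - (v \<tau> - v a))"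
        by (rule Cauchy_Schwarz_ineq2)
      also have "\<dots> \<le> (m * M) * (M * (b - a))"
      proof (intro mult_mono)
        have "norm (A (g \<tau>)) \<le> m * norm (g \<tau>)" by (rule m)
        also have "\<dots> \<le> m * M" using M[of \<tau>] \<tau> ab m0 by (intro mult_left_mono) auto
        finally show "norm (A (g \<tau>)) \<le> m * M" .
        have "norm ((v b - v \<tau>) - (v \<tau> - v a)) \<le> M * (b - \<tau>) + M * (\<tau> - a)"
          using norm_triangle_ineq4[of "v b - v \<tau>" "v \<tau> - v a"] lip[of \<tau> b] lip[of a \<tau>] \<tau> ab by simp
        then show "norm ((v b - v \<tau>) - (v \<tau> - v a)) \<le> M * (b - a)" by (simp add: algebra_simps)
      qed (use m0 M0 in auto)
      finally have "\<bar>inner (A (g \<tau>)) ((v b - v \<tau>) - (v \<tau> - v a))\<bar> \<le> m * M\<^sup>2 * (b - a)"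
        by (simp add: power2_eq_square mult_ac)
      moreover have "\<bar>inner (A (g \<tau>)) (v \<tau>)\<bar> \<le> \<kappa>" using \<tau> ab by (intro \<kappa>) auto
      ultimately show ?thesis unfolding split by linarith
    qed
    have "q (v b) - q (v a) = inner (A (v b - v a)) (v a + v b)"
    proof -
      have "inner (A (v b)) (v a) = inner (A (v a)) (v b)" by (subst sym) (rule inner_commute)
      then show ?thesis
        by (simp add: q_def inner_add_right inner_diff_left linear_diff[OF bounded_linear.linear[OF A]])
    qed
    also have "\<dots> = inner (A (?s D)) (v a + v b) - inner (A (?s D - (v b - v a))) (v a + v b)"
      by (simp add: inner_diff_left linear_diff[OF bounded_linear.linear[OF A]])
    also have "inner (A (?s D)) (v a + v b) = riemann_sum D (\<lambda>\<tau>. inner (A (g \<tau>)) (v a + v b))"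
      by (simp add: linear_sum[OF bounded_linear.linear[OF A]] inner_sum_left case_prod_beta
          linear_cmul[OF bounded_linear.linear[OF A]])
    finally have eq: "q (v b) - q (v a) = riemann_sum D (\<lambda>\<tau>. inner (A (g \<tau>)) (v a + v b))
        - inner (A (?s D - (v b - v a))) (v a + v b)" .
    have 1: "\<bar>riemann_sum D (\<lambda>\<tau>. inner (A (g \<tau>)) (v a + v b))\<bar> \<le> (2 * \<kappa> + m * M\<^sup>2 * (b - a)) * (b - a)"
      using riemann_sum_bound[OF D(1) ab(2), of "\<lambda>\<tau>. inner (A (g \<tau>)) (v a + v b)"] tag_bound by simp
    have "\<bar>inner (A (?s D - (v b - v a))) (v a + v b)\<bar> \<le> norm (A (?s D - (v b - v a))) * norm (v a + v b)"
      by (rule Cauchy_Schwarz_ineq2)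
    also have "\<dots> \<le> (m * e) * norm (v a + v b)"
      by (intro mult_right_mono order_trans[OF m[of "?s D - (v b - v a)"]] mult_left_mono)
         (use D(2) m0 in auto)
    also have "\<dots> = e * (m * norm (v a + v b))" by (simp add: mult_ac)
    also have "\<dots> \<le> e * (m * norm (v a + v b) + 1)" using e by (intro mult_left_mono) auto
    also have "\<dots> = e'" using den by (simp add: e_def)
    finally have 2: "\<bar>inner (A (?s D - (v b - v a))) (v a + v b)\<bar> \<le> e'" .
    have "\<bar>q (v b) - q (v a)\<bar> \<le> (2 * \<kappa> + m * M\<^sup>2 * (b - a)) * (b - a) + e'"
      unfolding eq using 1 2 by linarith
    then show "\<bar>q (v b) - q (v a)\<bar> \<le> 2 * \<kappa> * (b - a) + m * M\<^sup>2 * (b - a)\<^sup>2 + e'"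
      by (simp add: power2_eq_square algebra_simps)
  qed
  \<comment> \<open>integration over a single point\<close>
  have start: "v t0 = v0"
  proof -
    have "norm (v t0 - v0) \<le> 0"
    proof (rule field_le_epsilon)
      fix e :: real assume "e > 0"
      then obtain \<gamma> where g: "gauge \<gamma>" "\<And>D. D tagged_division_of {t0..t0} \<Longrightarrow> \<gamma> fine D \<Longrightarrow> norm (?s D - (v t0 - v0)) < e"
        using int[of t0 e] T by auto
      obtain D where D: "D tagged_division_of {t0..t0}" "\<gamma> fine D"
        using fine_division_exists_real[OF g(1), of t0 t0] by blast
      have "norm (?s D) \<le> M * (t0 - t0)" using D(1) T by (intro riemann_sum_bound M) auto
      then show "norm (v t0 - v0) \<le> 0 + e" using g(2)[OF D] by (simp add: norm_minus_commute)
    qed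
    then show ?thesis by simp
  qed
  have "\<bar>q (v T) - q (v t0)\<bar> \<le> 2 * \<kappa> * (T - t0) + m * M\<^sup>2 * (T - t0)\<^sup>2 * (1 / real (Suc N))" for N
  proof -
    let ?n = "Suc N"
    \<comment> \<open>the quadratic errors of the steps sum up to \<open>O(1 / ?n)\<close>\<close>
    define \<Delta> where "\<Delta> = (T - t0) / real ?n"
    have \<Delta>: "\<Delta> \<ge> 0" "real ?n * \<Delta> = T - t0" using T by (auto simp: \<Delta>_def)
    have "\<bar>q (v (t0 + real k * \<Delta>)) - q (v t0)\<bar> \<le> real k * (2 * \<kappa> * \<Delta> + m * M\<^sup>2 * \<Delta>\<^sup>2)" if "k \<le> ?n" for k
      using that
    proof (induction k)
      case (Suc k)
      have "real (Suc k) * \<Delta> \<le> real ?n * \<Delta>" using Suc.prems \<Delta>(1) by (intro mult_right_mono) auto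
      then have le: "t0 + real (Suc k) * \<Delta> \<le> T" using \<Delta>(2) by simp
      have "\<bar>q (v (t0 + real (Suc k) * \<Delta>)) - q (v (t0 + real k * \<Delta>))\<bar> \<le> 2 * \<kappa> * \<Delta> + m * M\<^sup>2 * \<Delta>\<^sup>2"
        using step[of "t0 + real k * \<Delta>" "t0 + real (Suc k) * \<Delta>"] le \<Delta>(1) by (simp add: algebra_simps)
      moreover have "\<bar>q (v (t0 + real k * \<Delta>)) - q (v t0)\<bar> \<le> real k * (2 * \<kappa> * \<Delta> + m * M\<^sup>2 * \<Delta>\<^sup>2)"
        using Suc by simp
      moreover have "real (Suc k) * (2 * \<kappa> * \<Delta> + m * M\<^sup>2 * \<Delta>\<^sup>2) = real k * (2 * \<kappa> * \<Delta> + m * M\<^sup>2 * \<Delta>\<^sup>2) + (2 * \<kappa> * \<Delta> + m * M\<^sup>2 * \<Delta>\<^sup>2)"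
        by (simp add: algebra_simps)
      ultimately show ?case by linarith
    qed simp
    from this[of ?n] have "\<bar>q (v T) - q (v t0)\<bar> \<le> real ?n * (2 * \<kappa> * \<Delta> + m * M\<^sup>2 * \<Delta>\<^sup>2)"
      unfolding \<Delta>(2) by simp
    also have "\<dots> = 2 * \<kappa> * (real ?n * \<Delta>) + m * M\<^sup>2 * ((real ?n * \<Delta>) * \<Delta>)"
      by (simp only: power2_eq_square distrib_left mult_ac)
    also have "\<dots> = 2 * \<kappa> * (T - t0) + m * M\<^sup>2 * (T - t0)\<^sup>2 * (1 / real ?n)"
      unfolding \<Delta>(2) by (simp add: \<Delta>_def power2_eq_square)
    finally show ?thesis .
  qed
  moreover have "(\<lambda>N. 2 * \<kappa> * (T - t0) + m * M\<^sup>2 * (T - t0)\<^sup>2 * (1 / real (Suc N))) \<longlonglongrightarrow> 2 * \<kappa> * (T - t0) + m * M\<^sup>2 * (T - t0)\<^sup>2 * 0"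
    by (intro tendsto_intros LIMSEQ_Suc[OF lim_1_over_n])
  ultimately have "\<bar>q (v T) - q (v t0)\<bar> \<le> 2 * \<kappa> * (T - t0) + m * M\<^sup>2 * (T - t0)\<^sup>2 * 0"
    by (intro LIMSEQ_le_const) auto
  then show ?thesis by (simp add: q_def start)
qed

section \<open>Conservation of momentum\<close>

definition fourier_multiplier :: "(real \<Rightarrow> complex) \<Rightarrow> l2 \<Rightarrow> l2" where
  "fourier_multiplier m x = cls (\<lambda>\<xi>. m \<xi> * rep_l2 x \<xi>)"

lemma fourier_multiplier_cls:
  assumes "f \<in> L2" "m \<in> borel_measurable borel" "\<And>\<xi>. cmod (m \<xi>) \<le> C"
  shows "fourier_multiplier m (cls f) = cls (\<lambda>\<xi>. m \<xi> * f \<xi>)"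
proof -
  have L2: "(\<lambda>\<xi>. m \<xi> * g \<xi>) \<in> L2" if "g \<in> L2" for g
    by (rule L2_mult_bounded[OF that assms(2), of C]) (simp add: assms(3))
  have "AE \<xi> in lborel. m \<xi> * rep_l2 (cls f) \<xi> = m \<xi> * f \<xi>"
    using rep_cls_AE[OF assms(1)] by eventually_elim simp
  then show ?thesis unfolding fourier_multiplier_def by (simp add: cls_eq_iff L2 assms(1))
qed

lemma bounded_linear_fourier_multiplier:
  assumes m: "m \<in> borel_measurable borel" "\<And>\<xi>. cmod (m \<xi>) \<le> C"
  shows "bounded_linear (fourier_multiplier m)"
proof (rule bounded_linear_intro[where K = C])
  have L2: "(\<lambda>\<xi>. m \<xi> * g \<xi>) \<in> L2" if "g \<in> L2" for g
    by (rule L2_mult_bounded[OF that m(1), of C]) (simp add: m(2))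
  note [simp] = fourier_multiplier_cls[OF _ m] L2
  fix x y :: l2 and r :: real
  show "fourier_multiplier m (x + y) = fourier_multiplier m x + fourier_multiplier m y"
    by (cases x, cases y) (simp add: distrib_left flip: cls_add)
  show "fourier_multiplier m (r *\<^sub>R x) = r *\<^sub>R fourier_multiplier m x"
    by (cases x) (simp flip: cls_scaleR)
  show "norm (fourier_multiplier m x) \<le> norm x * C"
  proof (cases x)
    case (cls f)
    have C: "C \<ge> 0" using order_trans[OF norm_ge_zero m(2)[of 0]] .
    have "norm (cls (\<lambda>\<xi>. m \<xi> * f \<xi>)) \<le> norm (cls (\<lambda>\<xi>. complex_of_real C * f \<xi>))"
      using cls(1) C m(2) by (intro norm_cls_le) (auto simp: norm_mult intro!: mult_right_mono)
    then show ?thesis using cls C by (simp add: norm_cls_cmult mult.commute)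
  qed
qed

lemma is_fourier_schroedinger_group:
  assumes "f \<in> L2"
  shows "is_fourier (schroedinger_group t f) (\<lambda>\<xi>. cis (- (t * \<xi>\<^sup>2)) * fourier f \<xi>)"
  unfolding schroedinger_group_def
  by (rule someI_ex[of "\<lambda>h. is_fourier h (\<lambda>\<xi>. cis (- (t * \<xi>\<^sup>2)) * fourier f \<xi>)"])
     (use assms in \<open>auto intro!: is_fourier_exists\<close>)

definition momentum :: "(real \<Rightarrow> complex) \<Rightarrow> real" where
  "momentum f = (LINT \<xi>|lborel. \<xi> * (cmod (fourier f \<xi>))\<^sup>2)"

text \<open>
  The symbol \<open>sin (h * \<xi>) / h\<close> tends to \<open>\<xi>\<close> as \<open>h\<close> tends to \<open>0\<close>. Being bounded, it acts on square-integrable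
  functions, and in physical space it is a combination of the translations by \<open>h\<close> and \<open>- h\<close>.
\<close>

definition momentum_at_scale :: "real \<Rightarrow> (real \<Rightarrow> complex) \<Rightarrow> real" where
  "momentum_at_scale h f = (LINT \<xi>|lborel. sin (h * \<xi>) / h * (cmod (fourier f \<xi>))\<^sup>2)"

lemma abs_le_bracket_powr: "s \<ge> 1/2 \<Longrightarrow> \<bar>\<xi>::real\<bar> \<le> (1 + \<xi>\<^sup>2) powr s"
proof -
  assume s: "s \<ge> 1/2"
  have "\<bar>\<xi>\<bar> \<le> sqrt (1 + \<xi>\<^sup>2)" by (rule real_le_rsqrt) simp
  also have "\<dots> = (1 + \<xi>\<^sup>2) powr (1/2)" by (simp add: powr_half_sqrt)
  also have "\<dots> \<le> (1 + \<xi>\<^sup>2) powr s" using s by (intro powr_mono) auto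
  finally show ?thesis .
qed

lemma abs_sin_div_le: "h > 0 \<Longrightarrow> \<bar>sin (h * \<xi>) / h\<bar> \<le> \<bar>\<xi>::real\<bar>"
  using abs_sin_x_le_abs_x[of "h * \<xi>"] by (simp add: abs_mult field_simps)

lemma momentum_le:
  assumes "f \<in> sobolev s" "s \<ge> 1/2"
  shows "\<bar>momentum f\<bar> \<le> sobolev_energy s f"
  using multiplier_energy_le(2)[OF is_fourier_fourier[OF sobolev_L2[OF assms(1)]] assms(1), of "\<lambda>\<xi>. \<xi>" 1]
    abs_le_bracket_powr[OF assms(2)]
  by (simp add: momentum_def)

lemma momentum_at_scale_tendsto:
  assumes f: "f \<in> sobolev s" and s: "s \<ge> 1/2"
  shows "(\<lambda>n. momentum_at_scale (1 / real (Suc n)) f) \<longlonglongrightarrow> momentum f"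
proof -
  have [measurable]: "fourier f \<in> borel_measurable borel"
    by (rule L2_measurable[OF fourier_L2[OF sobolev_L2[OF f]]])
  show ?thesis unfolding momentum_at_scale_def momentum_def
  proof (rule integral_dominated_convergence[where w = "\<lambda>\<xi>. \<bar>\<xi>\<bar> * (cmod (fourier f \<xi>))\<^sup>2"])
    show "integrable lborel (\<lambda>\<xi>. \<bar>\<xi>\<bar> * (cmod (fourier f \<xi>))\<^sup>2)"
      by (rule multiplier_energy_le(1)[OF is_fourier_fourier[OF sobolev_L2[OF f]] f, of _ 1])
         (use abs_le_bracket_powr[OF s] in auto)
    show "AE \<xi> in lborel. (\<lambda>n. sin (1 / real (Suc n) * \<xi>) / (1 / real (Suc n)) * (cmod (fourier f \<xi>))\<^sup>2) \<longlonglongrightarrow> \<xi> * (cmod (fourier f \<xi>))\<^sup>2"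
    proof (intro AE_I2 tendsto_intros)
      fix \<xi> :: real
      have "((\<lambda>h. sin (h * \<xi>) / h) \<longlongrightarrow> \<xi>) (at 0)"
      proof -
        have "((\<lambda>h. sin (h * \<xi>)) has_real_derivative \<xi>) (at 0)"
          by (auto intro!: derivative_eq_intros)
        then show ?thesis by (simp add: has_field_derivative_iff)
      qed
      moreover have "filterlim (\<lambda>n. 1 / real (Suc n)) (at 0) sequentially"
        using LIMSEQ_Suc[OF lim_1_over_n] by (intro filterlim_atI) auto
      ultimately show "(\<lambda>n. sin (1 / real (Suc n) * \<xi>) / (1 / real (Suc n))) \<longlonglongrightarrow> \<xi>"
        by (rule filterlim_compose)
    qed
    show "AE \<xi> in lborel. norm (sin (1 / real (Suc n) * \<xi>) / (1 / real (Suc n)) * (cmod (fourier f \<xi>))\<^sup>2) \<le> \<bar>\<xi>\<bar> * (cmod (fourier f \<xi>))\<^sup>2" for n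
      using abs_sin_div_le[of "1 / real (Suc n)"]
      by (intro AE_I2) (simp only: real_norm_def abs_mult abs_power2, simp add: mult_right_mono del: of_nat_Suc times_divide_eq_left)
    show "(\<lambda>\<xi>. sin (1 / real (Suc n) * \<xi>) / (1 / real (Suc n)) * (cmod (fourier f \<xi>))\<^sup>2) \<in> borel_measurable lborel" for n
      by measurable
  qed measurable
qed

text \<open>
  Multiplying the transform of \<open>w t\<close> by \<open>cis (t * \<xi>\<^sup>2)\<close> removes the free evolution: the profile
  \<open>v t = cis (t * \<xi>\<^sup>2) * fourier (w t) \<xi>\<close> is the gauge integral of an integrand that no longer depends on
  the final time \<open>t\<close>, which Duhamel's formula hides. The map \<open>U\<close> in the proof takes the functions of
  Duhamel's formula at time \<open>t\<close> to these profiles. It is an isometry, so smallness of the Riemann sum error in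
  \<open>H\<^sup>s\<close>, and hence in \<open>L\<^sup>2\<close>, is inherited.
\<close>

lemma duhamel_profile_riemann_sums:
  assumes sol: "duhamel_solution s UNIV t0 w0 w" and w0: "w0 \<in> L2" and s: "s \<ge> 0"
    and f: "\<And>\<tau>. \<tau> \<in> {t0..t} \<Longrightarrow> (\<lambda>x. forcing (w \<tau> x)) \<in> L2" and t: "t0 \<le> t" and e: "e > 0"
  shows "\<exists>\<gamma>. gauge \<gamma> \<and> (\<forall>D. D tagged_division_of {t0..t} \<and> \<gamma> fine D \<longrightarrow>
    norm (riemann_sum D (\<lambda>\<tau>. cls (\<lambda>\<xi>. - \<i> * (cis (\<tau> * \<xi>\<^sup>2) * fourier (\<lambda>x. forcing (w \<tau> x)) \<xi>)))
      - (cls (\<lambda>\<xi>. cis (t * \<xi>\<^sup>2) * fourier (w t) \<xi>) - cls (\<lambda>\<xi>. cis (t0 * \<xi>\<^sup>2) * fourier w0 \<xi>))) < e)"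
proof -
  define F where "F \<tau> = schroedinger_group (t - \<tau>) (\<lambda>x. forcing (w \<tau> x))" for \<tau>
  have F_eq: "F = (\<lambda>\<tau>. schroedinger_group (t - \<tau>) (\<lambda>x. G (w \<tau> x) - complex_of_real (2 * Re (w \<tau> x))))"
    by (simp add: F_def forcing_def fun_eq_iff)
  define g where "g \<tau> = cls (\<lambda>\<xi>. - \<i> * (cis (\<tau> * \<xi>\<^sup>2) * fourier (\<lambda>x. forcing (w \<tau> x)) \<xi>))" for \<tau>
  define v where "v = cls (\<lambda>\<xi>. cis (t * \<xi>\<^sup>2) * fourier (w t) \<xi>)"
  define v0 where "v0 = cls (\<lambda>\<xi>. cis (t0 * \<xi>\<^sup>2) * fourier w0 \<xi>)"
  have "\<exists>J. has_oriented_sobolev_integral s F J t0 t \<and>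
      (AE x in lborel. w t x = schroedinger_group (t - t0) w0 x - \<i> * J x)"
    using sol[unfolded duhamel_solution_def, THEN conjunct2, THEN conjunct2, THEN conjunct2, THEN conjunct2, THEN bspec, OF UNIV_I, of t]
    unfolding F_eq .
  then obtain J where J: "has_sobolev_integral s F J t0 t"
      "AE x in lborel. w t x = schroedinger_group (t - t0) w0 x - \<i> * J x"
    using t by (auto simp: has_oriented_sobolev_integral_def)
  have wt: "w t \<in> L2" using sol by (auto simp: duhamel_solution_def intro: sobolev_L2)
  have J2: "J \<in> L2" using J(1) by (auto simp: has_sobolev_integral_def intro: sobolev_L2)
  \<comment> \<open>the symbol of \<open>U\<close>: it undoes the free evolution and contains the factor \<open>- \<i>\<close> of Duhamel's formula\<close>
  let ?m = "\<lambda>\<xi>. - \<i> * cis (t * \<xi>\<^sup>2)"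
  define U where "U x = fourier_multiplier ?m (L2_fourier x)" for x
  have m: "?m \<in> borel_measurable borel" "\<And>\<xi>. cmod (?m \<xi>) \<le> 1" by (measurable, simp add: norm_mult)
  have U: "bounded_linear U" unfolding U_def
    by (rule bounded_linear_compose[OF bounded_linear_fourier_multiplier[OF m] bounded_linear_L2_fourier])
  have U_cls: "U (cls k) = cls (\<lambda>\<xi>. ?m \<xi> * l \<xi>)" if "is_fourier k l" for k l
    using that fourier_multiplier_cls[OF _ m] by (simp add: U_def is_fourier_iff)
  have normU: "norm (U x) = norm x" for x
  proof (cases x)
    case (cls k)
    have k: "is_fourier k (fourier k)" using cls(1) by (rule is_fourier_fourier)
    have "norm (U x) = norm (cls (\<lambda>\<xi>. - \<i> * (cis (t * \<xi>\<^sup>2) * fourier k \<xi>)))"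
      unfolding cls(2) U_cls[OF k] by (simp add: mult.assoc)
    also have "\<dots> = norm (cls (fourier k))"
      using fourier_L2[OF cls(1)] norm_cls_cmult[of "\<lambda>\<xi>. cis (t * \<xi>\<^sup>2) * fourier k \<xi>" "- \<i>"]
      by (simp add: norm_cls_unimodular)
    also have "\<dots> = norm x" using norm_L2_fourier[of x] cls by (simp add: L2_fourier_cls)
    finally show ?thesis .
  qed
  have UF: "U (cls (F \<tau>)) = g \<tau>" if "\<tau> \<in> {t0..t}" for \<tau>
  proof -
    have "cis (t * \<xi>\<^sup>2) * cis (- ((t - \<tau>) * \<xi>\<^sup>2)) = cis (\<tau> * \<xi>\<^sup>2)" for \<xi>
      by (simp add: cis_mult algebra_simps)
    then have e: "?m \<xi> * (cis (- ((t - \<tau>) * \<xi>\<^sup>2)) * z) = - \<i> * (cis (\<tau> * \<xi>\<^sup>2) * z)" for \<xi> z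
      by (metis mult.assoc)
    show ?thesis
      unfolding F_def g_def U_cls[OF is_fourier_schroedinger_group[OF f[OF that], of "t - \<tau>"]] by (simp only: e)
  qed
  have UJ: "U (cls J) = v - v0"
  proof -
    have wJ: "is_fourier (\<lambda>x. schroedinger_group (t - t0) w0 x - \<i> * J x)
        (\<lambda>\<xi>. cis (- ((t - t0) * \<xi>\<^sup>2)) * fourier w0 \<xi> - \<i> * fourier J \<xi>)"
      by (intro is_fourier_diff is_fourier_cmult is_fourier_schroedinger_group is_fourier_fourier w0 J2)
    then have "cls (w t) = cls (\<lambda>x. schroedinger_group (t - t0) w0 x - \<i> * J x)"
      using J(2) wt by (subst cls_eq_iff) (auto simp: is_fourier_iff)
    then have "cls (fourier (w t)) = cls (\<lambda>\<xi>. cis (- ((t - t0) * \<xi>\<^sup>2)) * fourier w0 \<xi> - \<i> * fourier J \<xi>)"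
      using wJ L2_fourier_cls[OF wt] by (simp add: is_fourier_iff)
    then have "AE \<xi> in lborel. fourier (w t) \<xi> = cis (- ((t - t0) * \<xi>\<^sup>2)) * fourier w0 \<xi> - \<i> * fourier J \<xi>"
      using wJ wt by (subst (asm) cls_eq_iff) (auto simp: is_fourier_iff)
    then have "AE \<xi> in lborel. ?m \<xi> * fourier J \<xi> = cis (t * \<xi>\<^sup>2) * fourier (w t) \<xi> - cis (t0 * \<xi>\<^sup>2) * fourier w0 \<xi>"
    proof eventually_elim
      case (elim \<xi>)
      have "cis (t * \<xi>\<^sup>2) * cis (- ((t - t0) * \<xi>\<^sup>2)) = cis (t0 * \<xi>\<^sup>2)"
        by (simp add: cis_mult algebra_simps)
      then have "cis (t * \<xi>\<^sup>2) * (cis (- ((t - t0) * \<xi>\<^sup>2)) * fourier w0 \<xi>) = cis (t0 * \<xi>\<^sup>2) * fourier w0 \<xi>"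
        by (metis mult.assoc)
      then show ?case unfolding elim by (simp add: right_diff_distrib mult_ac)
    qed
    moreover have "(\<lambda>\<xi>. ?m \<xi> * fourier J \<xi>) \<in> L2"
      by (rule L2_mult_bounded[OF fourier_L2[OF J2] m(1), of 1]) (use m(2) in simp)
    ultimately have "cls (\<lambda>\<xi>. ?m \<xi> * fourier J \<xi>) = cls (\<lambda>\<xi>. cis (t * \<xi>\<^sup>2) * fourier (w t) \<xi> - cis (t0 * \<xi>\<^sup>2) * fourier w0 \<xi>)"
      using wt w0 by (subst cls_eq_iff) auto
    then show ?thesis
      using wt w0 by (simp add: U_cls[OF is_fourier_fourier[OF J2]] v_def v0_def cls_diff)
  qed
  obtain \<gamma> where \<gamma>: "gauge \<gamma>" "\<And>D. D tagged_division_of {t0..t} \<Longrightarrow> \<gamma> fine D \<Longrightarrow>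
      sobolev_norm s (\<lambda>x. riemann_sum D (\<lambda>\<tau>. F \<tau> x) - J x) < ennreal e"
    using exE[OF J(1)[unfolded has_sobolev_integral_def, THEN conjunct2, THEN conjunct2, THEN spec, THEN mp, OF e]]
    by (metis (no_types))
  have F2: "F \<tau> \<in> L2" if "\<tau> \<in> {t0..t}" for \<tau>
    using J(1) that by (auto simp: has_sobolev_integral_def intro: sobolev_L2)
  show ?thesis
  proof (intro exI[of _ \<gamma>] conjI allI impI \<gamma>(1))
    fix D assume D: "D tagged_division_of {t0..t} \<and> \<gamma> fine D"
    have tag: "\<tau> \<in> {t0..t}" if "(\<tau>, K) \<in> D" for \<tau> K
      using D that tagged_division_ofD(2,3)[of D "{t0..t}" \<tau> K] by auto
    let ?r = "\<lambda>x. riemann_sum D (\<lambda>\<tau>. F \<tau> x) - J x"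
    have r: "?r \<in> sobolev s" "sobolev_energy s ?r < e\<^sup>2"
      using \<gamma>(2)[of D] D e by (simp_all add: sobolev_norm_less_iff)
    have "(norm (cls ?r))\<^sup>2 < e\<^sup>2" using norm_cls_le_sobolev_energy[OF r(1) s] r(2) by simp
    then have small: "norm (cls ?r) < e" by (rule power2_less_imp_less) (use e in simp)
    have "cls ?r = riemann_sum D (\<lambda>\<tau>. cls (F \<tau>)) - cls J"
    proof -
      have i: "(\<lambda>x. case i of (\<tau>, K) \<Rightarrow> Henstock_Kurzweil_Integration.content K *\<^sub>R F \<tau> x) \<in> L2" if "i \<in> D" for i
        using that tag F2 by (cases i) auto
      have "cls ?r = cls (\<lambda>x. \<Sum>i\<in>D. case i of (\<tau>, K) \<Rightarrow> Henstock_Kurzweil_Integration.content K *\<^sub>R F \<tau> x) - cls J"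
        by (intro cls_diff L2_sum i J2)
      also have "cls (\<lambda>x. \<Sum>i\<in>D. case i of (\<tau>, K) \<Rightarrow> Henstock_Kurzweil_Integration.content K *\<^sub>R F \<tau> x) =
          (\<Sum>i\<in>D. cls (\<lambda>x. case i of (\<tau>, K) \<Rightarrow> Henstock_Kurzweil_Integration.content K *\<^sub>R F \<tau> x))"
        by (rule cls_sum[OF i])
      also have "\<dots> = riemann_sum D (\<lambda>\<tau>. cls (F \<tau>))"
        by (intro sum.cong refl) (use tag F2 in \<open>auto simp: cls_scaleR\<close>)
      finally show ?thesis .
    qed
    then have "U (cls ?r) = riemann_sum D (\<lambda>\<tau>. U (cls (F \<tau>))) - U (cls J)"
      by (simp add: linear_diff[OF bounded_linear.linear[OF U]] linear_sum[OF bounded_linear.linear[OF U]]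
          linear_cmul[OF bounded_linear.linear[OF U]] case_prod_beta)
    also have "riemann_sum D (\<lambda>\<tau>. U (cls (F \<tau>))) =
        riemann_sum D g"
      by (intro sum.cong refl) (use tag UF in auto)
    finally have "norm (riemann_sum D g - (v - v0)) = norm (cls ?r)"
      using normU[of "cls ?r"] by (simp add: UJ)
    then show "norm (riemann_sum D (\<lambda>\<tau>. cls (\<lambda>\<xi>. - \<i> * (cis (\<tau> * \<xi>\<^sup>2) * fourier (\<lambda>x. forcing (w \<tau> x)) \<xi>)))
      - (cls (\<lambda>\<xi>. cis (t * \<xi>\<^sup>2) * fourier (w t) \<xi>) - cls (\<lambda>\<xi>. cis (t0 * \<xi>\<^sup>2) * fourier w0 \<xi>))) < e"
      using small by (simp only: g_def v_def v0_def)
  qed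
qed

lemma cis_diff_eq: "cis \<theta> - cis (- \<theta>) = 2 * \<i> * complex_of_real (sin \<theta>)"
  by (simp add: complex_eq_iff)

text \<open>
  The quadratic form with symbol \<open>sin (h * \<xi>) / h\<close> takes the same value on the profile as on the solution. Its
  pairing with the integrand of Duhamel's formula becomes, by the isometry and the shift rule, the pairing
  of the forcing with \<open>w (x + h) - w (x - h)\<close> divided by \<open>2 * h\<close>.
\<close>

lemma momentum_at_scale_variation:
  assumes sol: "duhamel_solution s UNIV t0 w0 w" and w0: "w0 \<in> L2"
    and \<sigma>: "0 < \<sigma>" "\<sigma> \<le> 1" "\<sigma> \<le> s" and s: "s > 1/2" and T: "t0 \<le> T" and h: "h > 0"
    and E: "\<And>t. t \<in> {t0..T} \<Longrightarrow> sobolev_energy s (w t) \<le> E"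
    and M: "M = sqrt (sobolev_constant s * E)"
  shows "\<bar>momentum_at_scale h (w T) - momentum_at_scale h w0\<bar>
    \<le> 8 * ((2 + M) * M + (2 + 4 * M)\<^sup>2) * E * (h powr (2 * \<sigma>) / h) * (T - t0)"
proof -
  let ?C = "(2 + M) * M + (2 + 4 * M)\<^sup>2"
  let ?f = "\<lambda>\<tau> x. forcing (w \<tau> x)"
  have w: "w t \<in> sobolev s" for t using sol by (auto simp: duhamel_solution_def)
  have w2: "w t \<in> L2" for t by (rule sobolev_L2[OF w])
  have sc: "0 \<le> sobolev_constant s" by (simp add: sobolev_constant_def integral_nonneg_AE)
  have E0: "0 \<le> E" using order_trans[OF sobolev_energy_nonneg E[of t0]] T by simp
  have M0: "M \<ge> 0" using sc E0 by (simp add: M)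
  have bound: "AE x in lborel. cmod (w t x) \<le> M" if t: "t \<in> {t0..T}" for t
  proof -
    have "sqrt (sobolev_constant s * sobolev_energy s (w t)) \<le> M"
      unfolding M using E[OF t] sc by (intro real_sqrt_le_mono mult_left_mono)
    with sobolev_embedding[OF w s, of t] show ?thesis by (auto elim!: eventually_mono)
  qed
  have f: "?f \<tau> \<in> L2" "norm (cls (?f \<tau>)) \<le> (2 + M) * (1 + M) * norm (cls (w \<tau>))" if "\<tau> \<in> {t0..T}" for \<tau>
    using forcing_L2[OF w2 bound[OF that]] by auto
  let ?g = "\<lambda>\<tau>. cls (\<lambda>\<xi>. - \<i> * (cis (\<tau> * \<xi>\<^sup>2) * fourier (?f \<tau>) \<xi>))"
  let ?v = "\<lambda>\<tau>. cls (\<lambda>\<xi>. cis (\<tau> * \<xi>\<^sup>2) * fourier (w \<tau>) \<xi>)"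
  let ?init = "cls (\<lambda>\<xi>. cis (t0 * \<xi>\<^sup>2) * fourier w0 \<xi>)"
  let ?m = "\<lambda>\<xi>. complex_of_real (sin (h * \<xi>) / h)"
  have m: "?m \<in> borel_measurable borel" "\<And>\<xi>. cmod (?m \<xi>) \<le> 1 / h"
    using h by (measurable, simp add: norm_divide divide_right_mono)
  have mL2: "(\<lambda>\<xi>. ?m \<xi> * k \<xi>) \<in> L2" if "k \<in> L2" for k
    by (rule L2_mult_bounded[OF that m(1), of "1 / h"]) (use m(2) in simp)
  let ?A = "fourier_multiplier ?m"
  note A_cls = fourier_multiplier_cls[OF _ m]
  have q: "inner (?A (cls (\<lambda>\<xi>. cis (t * \<xi>\<^sup>2) * fourier k \<xi>))) (cls (\<lambda>\<xi>. cis (t * \<xi>\<^sup>2) * fourier k \<xi>)) = momentum_at_scale h k"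
    if k: "k \<in> L2" for k t
  proof -
    have 1: "(\<lambda>\<xi>. cis (t * \<xi>\<^sup>2) * fourier k \<xi>) \<in> L2" using fourier_L2[OF k] by (rule L2_cis_mult) measurable
    have "Re (?m \<xi> * (cis a * z) * cnj (cis a * z)) = sin (h * \<xi>) / h * (cmod z)\<^sup>2" for \<xi> a z
    proof -
      have "?m \<xi> * (cis a * z) * cnj (cis a * z) = ?m \<xi> * complex_of_real ((cmod (cis a * z))\<^sup>2)"
        by (simp only: complex_norm_square mult.assoc)
      then show ?thesis by (simp only: of_real_mult[symmetric] Re_complex_of_real norm_mult norm_cis mult_1)
    qed
    then show ?thesis
      unfolding A_cls[OF 1] inner_cls[OF mL2[OF 1] 1] momentum_at_scale_def by (simp only:)
  qed
  have "\<bar>inner (?A (?v T)) (?v T) - inner (?A ?init) ?init\<bar> \<le> 2 * (4 * ?C * E * (h powr (2 * \<sigma>) / h)) * (T - t0)"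
  proof (rule quadratic_form_variation[where g = ?g and M = "(2 + M) * (1 + M) * sqrt E"])
    show "bounded_linear ?A" by (rule bounded_linear_fourier_multiplier[OF m])
    show "inner (?A x) y = inner x (?A y)" for x y
    proof (cases x, cases y)
      fix k l assume *: "k \<in> L2" "x = cls k" "l \<in> L2" "y = cls l"
      show ?thesis
        unfolding *(2,4) A_cls[OF *(1)] A_cls[OF *(3)] inner_cls[OF mL2[OF *(1)] *(3)] inner_cls[OF *(1) mL2[OF *(3)]]
        by (intro Bochner_Integration.integral_cong refl)
           (simp only: complex_cnj_mult complex_cnj_complex_of_real mult_ac)
    qed
    show "t0 \<le> T" by (rule T)
    show "norm (?g \<tau>) \<le> (2 + M) * (1 + M) * sqrt E" if \<tau>: "\<tau> \<in> {t0..T}" for \<tau>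
    proof -
      have F: "fourier (?f \<tau>) \<in> L2" by (rule fourier_L2[OF f(1)[OF \<tau>]])
      have "norm (?g \<tau>) = norm (cls (fourier (?f \<tau>)))"
        using norm_cls_cmult[OF L2_cis_mult[OF F, of "\<lambda>\<xi>. \<tau> * \<xi>\<^sup>2"], of "- \<i>"] norm_cls_unimodular[OF F, of "\<lambda>\<xi>. \<tau> * \<xi>\<^sup>2"]
        by simp
      also have "\<dots> = norm (cls (?f \<tau>))"
        using norm_L2_fourier[of "cls (?f \<tau>)"] L2_fourier_cls[OF f(1)[OF \<tau>]] by simp
      also have "\<dots> \<le> (2 + M) * (1 + M) * norm (cls (w \<tau>))" by (rule f(2)[OF \<tau>])
      also have "\<dots> \<le> (2 + M) * (1 + M) * sqrt E"
      proof (intro mult_left_mono real_le_rsqrt)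
        show "(norm (cls (w \<tau>)))\<^sup>2 \<le> E"
          using norm_cls_le_sobolev_energy[OF w, of \<tau>] E[OF \<tau>] s by simp
      qed (use M0 in auto)
      finally show ?thesis .
    qed
    show "\<exists>\<gamma>. gauge \<gamma> \<and> (\<forall>D. D tagged_division_of {t0..t} \<and> \<gamma> fine D \<longrightarrow>
        norm (riemann_sum D ?g - (?v t - ?init)) < e)"
      if "t \<in> {t0..T}" "e > 0" for t e
      by (rule duhamel_profile_riemann_sums[OF sol w0]) (use that s f in auto)
    show "\<bar>inner (?A (?g \<tau>)) (?v \<tau>)\<bar> \<le> 4 * ?C * E * (h powr (2 * \<sigma>) / h)" if \<tau>: "\<tau> \<in> {t0..T}" for \<tau>
    proof -
      let ?F = "fourier (?f \<tau>)" and ?W = "fourier (w \<tau>)"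
      have F: "?F \<in> L2" "?W \<in> L2" using fourier_L2 f(1)[OF \<tau>] w2 by auto
      have gv: "(\<lambda>\<xi>. - \<i> * (cis (\<tau> * \<xi>\<^sup>2) * ?F \<xi>)) \<in> L2" "(\<lambda>\<xi>. cis (\<tau> * \<xi>\<^sup>2) * ?W \<xi>) \<in> L2"
        by (intro L2_cmult L2_cis_mult F; measurable)+
      let ?d = "\<lambda>x. w \<tau> (x + h) - w \<tau> (x + - h)"
      let ?D = "\<lambda>\<xi>. cis (\<xi> * h) * ?W \<xi> - cis (\<xi> * - h) * ?W \<xi>"
      have dD: "is_fourier ?d ?D"
        by (intro is_fourier_diff is_fourier_shift is_fourier_fourier w2)
      have "inner (cls (?f \<tau>)) (cls ?d) = inner (cls ?F) (cls ?D)"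
        using inner_L2_fourier[of "cls (?f \<tau>)" "cls ?d"] dD L2_fourier_cls[OF f(1)[OF \<tau>]]
        by (simp add: is_fourier_iff)
      also have "\<dots> = (LINT \<xi>|lborel. Re (?F \<xi> * cnj (?D \<xi>)))"
        using dD F by (intro inner_cls) (auto simp: is_fourier_iff)
      also have "\<dots> = (LINT \<xi>|lborel. 2 * h * Re (?m \<xi> * (- \<i> * (cis (\<tau> * \<xi>\<^sup>2) * ?F \<xi>)) * cnj (cis (\<tau> * \<xi>\<^sup>2) * ?W \<xi>)))"
      proof (intro Bochner_Integration.integral_cong refl)
        fix \<xi>
        have D: "?D \<xi> = 2 * \<i> * complex_of_real (sin (h * \<xi>)) * ?W \<xi>"
        proof -
          have "?D \<xi> = (cis (h * \<xi>) - cis (- (h * \<xi>))) * ?W \<xi>"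
            by (simp add: left_diff_distrib mult.commute[of \<xi>])
          then show ?thesis unfolding cis_diff_eq .
        qed
        have c: "cis (\<tau> * \<xi>\<^sup>2) * cnj (cis (\<tau> * \<xi>\<^sup>2)) = 1" by (simp add: cis_cnj cis_mult)
        have "?m \<xi> * (- \<i> * (cis (\<tau> * \<xi>\<^sup>2) * ?F \<xi>)) * cnj (cis (\<tau> * \<xi>\<^sup>2) * ?W \<xi>) =
            (cis (\<tau> * \<xi>\<^sup>2) * cnj (cis (\<tau> * \<xi>\<^sup>2))) * (- \<i> * ?m \<xi> * ?F \<xi> * cnj (?W \<xi>))"
          by (simp only: complex_cnj_mult mult_ac)
        also have "\<dots> = - \<i> * ?m \<xi> * ?F \<xi> * cnj (?W \<xi>)" unfolding c by simp
        finally have 1: "?m \<xi> * (- \<i> * (cis (\<tau> * \<xi>\<^sup>2) * ?F \<xi>)) * cnj (cis (\<tau> * \<xi>\<^sup>2) * ?W \<xi>) = - \<i> * ?m \<xi> * ?F \<xi> * cnj (?W \<xi>)" .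
        have "complex_of_real (2 * h) * (- \<i> * ?m \<xi> * ?F \<xi> * cnj (?W \<xi>)) = ?F \<xi> * cnj (?D \<xi>)"
          unfolding D using h by simp
        then have "Re (?F \<xi> * cnj (?D \<xi>)) = Re (complex_of_real (2 * h) * (- \<i> * ?m \<xi> * ?F \<xi> * cnj (?W \<xi>)))"
          by (rule arg_cong[OF sym])
        then show "Re (?F \<xi> * cnj (?D \<xi>)) = 2 * h * Re (?m \<xi> * (- \<i> * (cis (\<tau> * \<xi>\<^sup>2) * ?F \<xi>)) * cnj (cis (\<tau> * \<xi>\<^sup>2) * ?W \<xi>))"
          unfolding 1 by (simp only: Re_complex_of_real Im_complex_of_real times_complex.sel mult_zero_left diff_zero)
      qed
      also have "\<dots> = 2 * h * inner (?A (?g \<tau>)) (?v \<tau>)"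
        unfolding A_cls[OF gv(1)] inner_cls[OF mL2[OF gv(1)] gv(2)] by (rule integral_mult_right_zero)
      finally have "2 * h * \<bar>inner (?A (?g \<tau>)) (?v \<tau>)\<bar> = \<bar>inner (cls (?f \<tau>)) (cls ?d)\<bar>"
        using h by (simp add: abs_mult)
      also have "\<dots> \<le> 2 * ?C * (norm (cls (\<lambda>x. w \<tau> (x + h) - w \<tau> x)))\<^sup>2"
        by (rule momentum_flux_bound[OF w2 bound[OF \<tau>]])
      also have "\<dots> \<le> 2 * ?C * (4 * h powr (2 * \<sigma>) * E)"
      proof (intro mult_left_mono)
        have "(norm (cls (\<lambda>x. w \<tau> (x + h) - w \<tau> x)))\<^sup>2 \<le> 4 * h powr (2 * \<sigma>) * sobolev_energy s (w \<tau>)"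
          using shift_diff_sobolev[OF w \<sigma>, of \<tau> h] h by simp
        also have "\<dots> \<le> 4 * h powr (2 * \<sigma>) * E" using E[OF \<tau>] by (intro mult_left_mono) auto
        finally show "(norm (cls (\<lambda>x. w \<tau> (x + h) - w \<tau> x)))\<^sup>2 \<le> 4 * h powr (2 * \<sigma>) * E" .
      qed (use M0 in auto)
      finally show ?thesis using h by (simp add: field_simps)
    qed
  qed
  moreover have "2 * (4 * a * E * b) * d = 8 * a * E * b * d" for a b d :: real by simp
  ultimately show ?thesis unfolding q[OF w2] q[OF w0] by (simp only:)
qed

text \<open>
  The variation at scale \<open>h\<close> is of order \<open>h powr (2 * \<sigma> - 1)\<close> with \<open>\<sigma> > 1/2\<close>.
\<close>

theorem momentum_conserved:
  assumes sol: "duhamel_solution s UNIV t0 w0 w" and w0: "w0 \<in> sobolev s" and s: "s > 1/2" and T: "t0 \<le> T"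
    and E: "\<And>t. t \<in> {t0..T} \<Longrightarrow> sobolev_energy s (w t) \<le> E"
  shows "momentum (w T) = momentum w0"
proof -
  define \<sigma> where "\<sigma> = min s 1"
  have \<sigma>: "1/2 < \<sigma>" "0 < \<sigma>" "\<sigma> \<le> 1" "\<sigma> \<le> s" using s by (auto simp: \<sigma>_def)
  define M where "M = sqrt (sobolev_constant s * E)"
  let ?h = "\<lambda>n. 1 / real (Suc n)"
  let ?K = "8 * ((2 + M) * M + (2 + 4 * M)\<^sup>2) * E"
  have w: "w T \<in> sobolev s" using sol by (auto simp: duhamel_solution_def)
  have "((\<lambda>h::real. h powr (2 * \<sigma>) / h) \<longlongrightarrow> 0) (at_right 0)"
    using \<sigma>(1) by real_asymp
  moreover have "filterlim ?h (at_right 0) sequentially"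
    using LIMSEQ_Suc[OF lim_1_over_n] by (intro tendsto_imp_filterlim_at_right) auto
  ultimately have "(\<lambda>n. ?h n powr (2 * \<sigma>) / ?h n) \<longlonglongrightarrow> 0" by (rule filterlim_compose)
  then have "(\<lambda>n. ?K * (?h n powr (2 * \<sigma>) / ?h n) * (T - t0)) \<longlonglongrightarrow> ?K * 0 * (T - t0)"
    by (intro tendsto_intros)
  moreover have "(\<lambda>n. \<bar>momentum_at_scale (?h n) (w T) - momentum_at_scale (?h n) w0\<bar>) \<longlonglongrightarrow> \<bar>momentum (w T) - momentum w0\<bar>"
    using s by (intro tendsto_intros momentum_at_scale_tendsto[of _ s] w w0) auto
  moreover have "\<bar>momentum_at_scale (?h n) (w T) - momentum_at_scale (?h n) w0\<bar> \<le> ?K * (?h n powr (2 * \<sigma>) / ?h n) * (T - t0)" for n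
    by (rule momentum_at_scale_variation[OF sol sobolev_L2[OF w0] \<sigma>(2-4) s T _ E M_def]) auto
  ultimately have "\<bar>momentum (w T) - momentum w0\<bar> \<le> ?K * 0 * (T - t0)"
    by (intro LIMSEQ_le) auto
  then show ?thesis by simp
qed

section \<open>The Peregrine breather\<close>

text \<open>
  The perturbation part of the breather at time \<open>t\<close> is a Lorentzian profile of this width.
\<close>

definition peregrine_width :: "real \<Rightarrow> real" where
  "peregrine_width t = sqrt ((1 + 4 * t\<^sup>2) / 2)"

lemma peregrine_width_sq: "2 * (peregrine_width t)\<^sup>2 = 1 + 4 * t\<^sup>2"
  by (simp add: peregrine_width_def)

lemma peregrine_width_ge: "1 / 2 \<le> peregrine_width t"
  unfolding peregrine_width_def by (rule real_le_rsqrt) (simp add: power2_eq_square)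

lemma peregrine_width_pos [simp]: "0 < peregrine_width t"
  using peregrine_width_ge[of t] by linarith

lemma perturbation_part_peregrine:
  "perturbation_part peregrine t x = - 2 * (1 + 2 * \<i> * complex_of_real t) / complex_of_real ((peregrine_width t)\<^sup>2 + x\<^sup>2)"
proof -
  have D: "1 + 4 * t\<^sup>2 + 2 * x\<^sup>2 = 2 * ((peregrine_width t)\<^sup>2 + x\<^sup>2)"
    using peregrine_width_sq[of t] by simp
  have c: "cis (- t) * (cis t * z) = z" for z by (simp add: cis_mult flip: mult.assoc)
  have "perturbation_part peregrine t x = - (4 * (1 + 2 * \<i> * complex_of_real t) / complex_of_real (1 + 4 * t\<^sup>2 + 2 * x\<^sup>2))"
    unfolding perturbation_part_def peregrine_def c by simp
  also have "\<dots> = - 2 * (1 + 2 * \<i> * complex_of_real t) / complex_of_real ((peregrine_width t)\<^sup>2 + x\<^sup>2)"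
  proof -
    have "- (4 * y / (complex_of_real 2 * d)) = - 2 * y / d" for y d by simp
    then show ?thesis unfolding D of_real_mult .
  qed
  finally show ?thesis .
qed

text \<open>
  The value at frequency \<open>0\<close> of the transform of the perturbation part; the square root is the constant in
  \<open>fourier_integral_exp_abs\<close>.
\<close>

definition peregrine_amplitude :: "real \<Rightarrow> complex" where
  "peregrine_amplitude t = - 2 * (1 + 2 * \<i> * complex_of_real t) / complex_of_real (sqrt (2 / pi) * peregrine_width t)"

text \<open>
  That the modulus does not depend on time is what makes the \<open>H\<^sup>s\<close> norm depend on the width alone,
  and decay as the width grows.
\<close>

lemma cmod_peregrine_amplitude: "(cmod (peregrine_amplitude t))\<^sup>2 = 4 * pi"
proof -
  have "(cmod (1 + 2 * \<i> * complex_of_real t))\<^sup>2 = 2 * (peregrine_width t)\<^sup>2"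
    unfolding peregrine_width_sq by (simp add: cmod_power2)
  then show ?thesis
    unfolding peregrine_amplitude_def norm_divide norm_mult power_divide power_mult_distrib norm_of_real power2_abs
    by (simp add: field_simps less_imp_neq[OF peregrine_width_pos, symmetric])
qed

lemma exp_abs_L1_L2:
  assumes "b > 0"
  shows "integrable lborel (\<lambda>\<xi>. complex_of_real (exp (- b * \<bar>\<xi>\<bar>)))" "(\<lambda>\<xi>. complex_of_real (exp (- b * \<bar>\<xi>\<bar>))) \<in> L2"
proof -
  show "integrable lborel (\<lambda>\<xi>. complex_of_real (exp (- b * \<bar>\<xi>\<bar>)))"
    using integrable_exp_abs[OF assms] by simp
  have "(exp (- b * \<bar>\<xi>\<bar>))\<^sup>2 = exp (- (2 * b) * \<bar>\<xi>\<bar>)" for \<xi>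
    by (simp add: power2_eq_square flip: exp_add)
  then show "(\<lambda>\<xi>. complex_of_real (exp (- b * \<bar>\<xi>\<bar>))) \<in> L2"
    using integrable_exp_abs[of "2 * b"] assms by (simp add: L2_def)
qed

lemma is_fourier_peregrine:
  "is_fourier (\<lambda>x. perturbation_part peregrine t (x + h))
     (\<lambda>\<xi>. cis (\<xi> * h) * (peregrine_amplitude t * complex_of_real (exp (- peregrine_width t * \<bar>\<xi>\<bar>))))"
proof -
  let ?b = "peregrine_width t"
  let ?g = "\<lambda>\<xi>. complex_of_real (exp (- ?b * \<bar>\<xi>\<bar>))"
  have "is_fourier (\<lambda>x. complex_of_real (sqrt (2 / pi) * (?b / (?b\<^sup>2 + x\<^sup>2)))) ?g"
    using is_fourier_inverse_integral[OF exp_abs_L1_L2[OF peregrine_width_pos[of t]]]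
    unfolding complex_cnj_complex_of_real fourier_integral_exp_abs[OF peregrine_width_pos[of t]] .
  from is_fourier_cmult[OF this, of "peregrine_amplitude t"]
  have "is_fourier (perturbation_part peregrine t) (\<lambda>\<xi>. peregrine_amplitude t * ?g \<xi>)"
  proof (rule back_subst[of "\<lambda>f. is_fourier f _"], intro ext)
    fix x
    have "complex_of_real (sqrt (2 / pi) * (?b / (?b\<^sup>2 + x\<^sup>2))) = complex_of_real (sqrt (2 / pi) * ?b) / complex_of_real (?b\<^sup>2 + x\<^sup>2)"
      by simp
    moreover have "complex_of_real (sqrt (2 / pi) * ?b) \<noteq> 0"
      by (simp add: less_imp_neq[OF peregrine_width_pos, symmetric])
    ultimately show "peregrine_amplitude t * complex_of_real (sqrt (2 / pi) * (?b / (?b\<^sup>2 + x\<^sup>2))) = perturbation_part peregrine t x"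
      unfolding perturbation_part_peregrine peregrine_amplitude_def by (simp del: of_real_mult)
  qed
  then show ?thesis by (rule is_fourier_shift)
qed

text \<open>
  The exponential decay of the transform beats every Sobolev weight.
\<close>

lemma bracket_powr_le_exp:
  assumes b: "b > 0" and s: "s > 0"
  obtains K where "\<And>\<xi>::real. (1 + \<xi>\<^sup>2) powr s \<le> K * exp (b * \<bar>\<xi>\<bar>)"
proof
  fix \<xi> :: real
  \<comment> \<open>the rate that becomes \<open>b\<close> after squaring and raising to the power \<open>s\<close>\<close>
  let ?c = "b / (2 * s)" let ?K = "1 + 1 / ?c"
  have c: "?c > 0" using assms by simp
  have "1 + a \<le> (1 + 1 / c) * (1 + c * a)" if "c > 0" "a \<ge> 0" for a c :: real
    using that by (simp add: algebra_simps)
  from this[OF c, of "\<bar>\<xi>\<bar>"] have "1 + \<bar>\<xi>\<bar> \<le> ?K * (1 + ?c * \<bar>\<xi>\<bar>)"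
    by (simp only: abs_ge_zero)
  also have "\<dots> \<le> ?K * exp (?c * \<bar>\<xi>\<bar>)"
    by (rule mult_left_mono[OF exp_ge_add_one_self]) (use c in \<open>simp only: add_nonneg_nonneg zero_le_one zero_le_divide_1_iff less_imp_le\<close>)
  finally have 1: "1 + \<bar>\<xi>\<bar> \<le> ?K * exp (?c * \<bar>\<xi>\<bar>)" .
  have "(1 + \<xi>\<^sup>2) powr s \<le> ((1 + \<bar>\<xi>\<bar>)\<^sup>2) powr s"
    using s by (intro powr_mono2) (auto simp: power2_sum)
  also have "\<dots> \<le> ((?K * exp (?c * \<bar>\<xi>\<bar>))\<^sup>2) powr s"
    using s 1 by (intro powr_mono2 power_mono) auto
  also have "\<dots> = (?K\<^sup>2) powr s * (exp (2 * ?c * \<bar>\<xi>\<bar>)) powr s"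
  proof -
    have "(exp (?c * \<bar>\<xi>\<bar>))\<^sup>2 = exp (2 * ?c * \<bar>\<xi>\<bar>)"
      unfolding mult.assoc by (rule exp_double[symmetric])
    then show ?thesis by (simp only: power_mult_distrib powr_mult zero_le_power2 exp_ge_zero)
  qed
  also have "(exp (2 * ?c * \<bar>\<xi>\<bar>)) powr s = exp (b * \<bar>\<xi>\<bar>)"
    using s by (simp add: powr_def)
  finally show "(1 + \<xi>\<^sup>2) powr s \<le> (?K\<^sup>2) powr s * exp (b * \<bar>\<xi>\<bar>)" .
qed

text \<open>
  The Sobolev energy of any function whose transform has modulus \<open>2 sqrt pi exp (- b \<bar>\<xi>\<bar>)\<close>, such as all translates of the
  perturbation part of the breather.
\<close>

definition exponential_energy :: "real \<Rightarrow> real \<Rightarrow> real" where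
  "exponential_energy s b = (LINT \<xi>|lborel. (1 + \<xi>\<^sup>2) powr s * (4 * pi * exp (- (2 * b) * \<bar>\<xi>\<bar>)))"

lemma exponential_energy_integrable:
  assumes b: "b > 0" and s: "s > 0"
  shows "integrable lborel (\<lambda>\<xi>::real. (1 + \<xi>\<^sup>2) powr s * (4 * pi * exp (- (2 * b) * \<bar>\<xi>\<bar>)))"
proof -
  obtain K where K: "\<And>\<xi>::real. (1 + \<xi>\<^sup>2) powr s \<le> K * exp (b * \<bar>\<xi>\<bar>)"
    using bracket_powr_le_exp[OF b s] by blast
  show ?thesis
  proof (rule Bochner_Integration.integrable_bound)
    show "integrable lborel (\<lambda>\<xi>. 4 * pi * K * exp (- b * \<bar>\<xi>\<bar>))"
      using integrable_exp_abs[OF b] by (intro integrable_mult_right)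
    have le: "(1 + \<xi>\<^sup>2) powr s * (4 * pi * exp (- (2 * b) * \<bar>\<xi>\<bar>)) \<le> 4 * pi * K * exp (- b * \<bar>\<xi>\<bar>)" for \<xi>
    proof -
      have "(1 + \<xi>\<^sup>2) powr s * (4 * pi * exp (- (2 * b) * \<bar>\<xi>\<bar>)) \<le> (K * exp (b * \<bar>\<xi>\<bar>)) * (4 * pi * exp (- (2 * b) * \<bar>\<xi>\<bar>))"
        by (intro mult_right_mono K) simp
      also have "\<dots> = 4 * pi * K * (exp (b * \<bar>\<xi>\<bar>) * exp (- (2 * b) * \<bar>\<xi>\<bar>))" by simp
      also have "exp (b * \<bar>\<xi>\<bar>) * exp (- (2 * b) * \<bar>\<xi>\<bar>) = exp (- b * \<bar>\<xi>\<bar>)"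
        unfolding exp_add[symmetric] by (simp add: algebra_simps)
      finally show ?thesis .
    qed
    show "AE \<xi> in lborel. norm ((1 + \<xi>\<^sup>2) powr s * (4 * pi * exp (- (2 * b) * \<bar>\<xi>\<bar>))) \<le> norm (4 * pi * K * exp (- b * \<bar>\<xi>\<bar>))"
    proof (intro AE_I2)
      fix \<xi> :: real
      have "norm ((1 + \<xi>\<^sup>2) powr s * (4 * pi * exp (- (2 * b) * \<bar>\<xi>\<bar>))) = (1 + \<xi>\<^sup>2) powr s * (4 * pi * exp (- (2 * b) * \<bar>\<xi>\<bar>))"
        by (simp add: abs_mult)
      also note le
      also note abs_ge_self
      finally show "norm ((1 + \<xi>\<^sup>2) powr s * (4 * pi * exp (- (2 * b) * \<bar>\<xi>\<bar>))) \<le> norm (4 * pi * K * exp (- b * \<bar>\<xi>\<bar>))"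
        unfolding real_norm_def .
    qed
  qed measurable
qed

lemma peregrine_sobolev:
  assumes s: "s > 0"
  shows "(\<lambda>x. perturbation_part peregrine t (x - x0)) \<in> sobolev s"
    and "sobolev_energy s (\<lambda>x. perturbation_part peregrine t (x - x0)) = exponential_energy s (peregrine_width t)"
proof -
  have sq: "(exp (- b * \<bar>\<xi>\<bar>))\<^sup>2 = exp (- (2 * b) * \<bar>\<xi>\<bar>)" for b \<xi> :: real
    by (simp add: power2_eq_square flip: exp_add)
  have F: "is_fourier (\<lambda>x. perturbation_part peregrine t (x - x0))
     (\<lambda>\<xi>. cis (\<xi> * - x0) * (peregrine_amplitude t * complex_of_real (exp (- peregrine_width t * \<bar>\<xi>\<bar>))))"
    using is_fourier_peregrine[of t "- x0"] by simp
  have m: "(cmod (cis (\<xi> * - x0) * (peregrine_amplitude t * complex_of_real (exp (- peregrine_width t * \<bar>\<xi>\<bar>)))))\<^sup>2 =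
      4 * pi * exp (- (2 * peregrine_width t) * \<bar>\<xi>\<bar>)" for \<xi>
    unfolding norm_mult norm_cis power_mult_distrib cmod_peregrine_amplitude norm_of_real power2_abs sq by simp
  show "(\<lambda>x. perturbation_part peregrine t (x - x0)) \<in> sobolev s"
    unfolding sobolev_is_fourier(1)[OF F] m by (rule exponential_energy_integrable[OF peregrine_width_pos s])
  show "sobolev_energy s (\<lambda>x. perturbation_part peregrine t (x - x0)) = exponential_energy s (peregrine_width t)"
    unfolding sobolev_is_fourier(2)[OF F] m exponential_energy_def ..
qed

lemma exponential_energy_le:
  assumes "0 < b" "b \<le> c" "s > 0"
  shows "exponential_energy s c \<le> exponential_energy s b"
  unfolding exponential_energy_def
  by (rule integral_mono[OF exponential_energy_integrable exponential_energy_integrable])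
     (use assms in \<open>auto intro!: mult_left_mono mult_right_mono\<close>)

lemma peregrine_energy_decay:
  assumes s: "s > 0"
  shows "(\<lambda>n. exponential_energy s (peregrine_width (real n))) \<longlonglongrightarrow> 0"
proof -
  have "(\<lambda>n. exponential_energy s (peregrine_width (real n))) \<longlonglongrightarrow> (LINT (\<xi>::real)|lborel. 0)"
    unfolding exponential_energy_def
  proof (rule integral_dominated_convergence[where w = "\<lambda>\<xi>. (1 + \<xi>\<^sup>2) powr s * (4 * pi * exp (- (2 * (1 / 2)) * \<bar>\<xi>\<bar>))"])
    show "integrable lborel (\<lambda>\<xi>. (1 + \<xi>\<^sup>2) powr s * (4 * pi * exp (- (2 * (1 / 2)) * \<bar>\<xi>\<bar>)))"
      by (rule exponential_energy_integrable) (use s in auto)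
    have "AE \<xi> in lborel. \<xi> \<noteq> (0::real)" by (rule AE_lborel_singleton)
    then show "AE \<xi> in lborel. (\<lambda>n. (1 + \<xi>\<^sup>2) powr s * (4 * pi * exp (- (2 * peregrine_width (real n)) * \<bar>\<xi>\<bar>))) \<longlonglongrightarrow> 0"
    proof eventually_elim
      case (elim \<xi>)
      define a where "a = \<bar>\<xi>\<bar>"
      have "a > 0" using elim by (simp add: a_def)
      then have "(\<lambda>n. exp (- (2 * sqrt ((1 + 4 * (real n)\<^sup>2) / 2)) * a)) \<longlonglongrightarrow> 0"
        by real_asymp
      then have "(\<lambda>n. (1 + \<xi>\<^sup>2) powr s * (4 * pi * exp (- (2 * peregrine_width (real n)) * a))) \<longlonglongrightarrow> (1 + \<xi>\<^sup>2) powr s * (4 * pi * 0)"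
        unfolding peregrine_width_def by (intro tendsto_intros)
      then show ?case by (simp add: a_def)
    qed
    show "AE \<xi> in lborel. norm ((1 + \<xi>\<^sup>2) powr s * (4 * pi * exp (- (2 * peregrine_width (real n)) * \<bar>\<xi>\<bar>))) \<le>
        (1 + \<xi>\<^sup>2) powr s * (4 * pi * exp (- (2 * (1 / 2)) * \<bar>\<xi>\<bar>))" for n
    proof (intro AE_I2)
      fix \<xi> :: real
      have "- (2 * peregrine_width (real n)) * \<bar>\<xi>\<bar> \<le> - (2 * (1 / 2)) * \<bar>\<xi>\<bar>"
        using peregrine_width_ge[of "real n"] by (intro mult_right_mono) auto
      then show "norm ((1 + \<xi>\<^sup>2) powr s * (4 * pi * exp (- (2 * peregrine_width (real n)) * \<bar>\<xi>\<bar>))) \<le>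
          (1 + \<xi>\<^sup>2) powr s * (4 * pi * exp (- (2 * (1 / 2)) * \<bar>\<xi>\<bar>))"
        unfolding real_norm_def abs_mult by (simp add: mult_left_mono)
    qed
  qed measurable
  then show ?thesis by simp
qed

definition half_line_momentum :: "real \<Rightarrow> real" where
  "half_line_momentum b = (LINT \<xi>:{0<..}|lborel. \<xi> * (4 * pi * exp (- (2 * b) * \<bar>\<xi>\<bar>)))"

lemma exponential_momentum_integrable:
  assumes b: "b > 0"
  shows "integrable lborel (\<lambda>\<xi>::real. \<xi> * (4 * pi * exp (- (2 * b) * \<bar>\<xi>\<bar>)))"
proof (rule Bochner_Integration.integrable_bound[OF exponential_energy_integrable[OF b, of 1]])
  show "AE \<xi> in lborel. norm (\<xi> * (4 * pi * exp (- (2 * b) * \<bar>\<xi>\<bar>))) \<le> norm ((1 + \<xi>\<^sup>2) powr 1 * (4 * pi * exp (- (2 * b) * \<bar>\<xi>\<bar>)))"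
    using abs_le_bracket_powr[of 1] by (intro AE_I2) (auto simp: abs_mult intro!: mult_right_mono)
qed auto

text \<open>
  This momentum is the constant \<open>c\<close> by which a perturbation on positive frequencies is felt to first order.
\<close>

lemma half_line_momentum_pos:
  assumes b: "b > 0" shows "half_line_momentum b > 0"
proof -
  let ?f = "\<lambda>\<xi>::real. indicator {0<..} \<xi> *\<^sub>R (\<xi> * (4 * pi * exp (- (2 * b) * \<bar>\<xi>\<bar>)))"
  have i: "integrable lborel ?f"
    by (rule integrable_mult_indicator[OF _ exponential_momentum_integrable[OF b]]) simp
  have nn: "AE \<xi> in lborel. 0 \<le> ?f \<xi>" by (intro AE_I2) (simp add: indicator_def)
  have "half_line_momentum b \<noteq> 0"
  proof
    assume "half_line_momentum b = 0"
    then have "AE \<xi> in lborel. ?f \<xi> = 0"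
      using integral_nonneg_eq_0_iff_AE[OF i nn] by (simp add: half_line_momentum_def set_lebesgue_integral_def)
    then have "AE \<xi> in lborel. \<xi> \<notin> {1..2::real}"
      by eventually_elim (auto simp: indicator_def)
    then have "{1..2::real} \<in> null_sets lborel" by (subst (asm) AE_iff_null_sets[symmetric]) auto
    then show False by (auto simp: null_sets_def emeasure_lborel_Icc_eq)
  qed
  moreover have "half_line_momentum b \<ge> 0"
    unfolding half_line_momentum_def set_lebesgue_integral_def by (rule integral_nonneg_AE[OF nn])
  ultimately show ?thesis by simp
qed

text \<open>
  The positive frequencies of the breather are amplified by \<open>1 + \<delta>\<close>. Inversion yields a function with this
  transform. The momentum of the breather itself cancels between \<open>\<xi>\<close> and \<open>- \<xi>\<close>, which leaves
  \<open>(1 + \<delta>)\<^sup>2 - 1\<close> times the momentum carried by the half-line.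
\<close>

lemma asymmetric_perturbation:
  assumes s: "s > 0" and \<delta>: "\<delta> > 0"
  obtains w0 where "w0 \<in> sobolev s"
    and "(\<lambda>x. w0 x - perturbation_part peregrine t x) \<in> sobolev s"
    and "sobolev_energy s (\<lambda>x. w0 x - perturbation_part peregrine t x) \<le> \<delta>\<^sup>2 * exponential_energy s (peregrine_width t)"
    and "momentum w0 \<ge> 2 * \<delta> * half_line_momentum (peregrine_width t)"
proof -
  let ?b = "peregrine_width t"
  let ?p = "\<lambda>\<xi>. peregrine_amplitude t * complex_of_real (exp (- ?b * \<bar>\<xi>\<bar>))"
  let ?j = "\<lambda>\<xi>. complex_of_real (\<delta> * indicator {0<..} \<xi>)"
  let ?e = "\<lambda>\<xi>. 4 * pi * exp (- (2 * ?b) * \<bar>\<xi>\<bar>)"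
  have sq: "(exp (- b * \<bar>\<xi>\<bar>))\<^sup>2 = exp (- (2 * b) * \<bar>\<xi>\<bar>)" for b \<xi> :: real
    by (simp add: power2_eq_square flip: exp_add)
  have W: "is_fourier (perturbation_part peregrine t) ?p"
    using is_fourier_peregrine[of t 0] by simp
  then have p: "?p \<in> L2" by (simp add: is_fourier_iff)
  have p2: "(cmod (?p \<xi>))\<^sup>2 = ?e \<xi>" for \<xi>
    unfolding norm_mult power_mult_distrib cmod_peregrine_amplitude norm_of_real power2_abs sq ..
  have jp: "(\<lambda>\<xi>. ?j \<xi> * ?p \<xi>) \<in> L2"
    by (rule L2_mult_bounded[OF p, of _ \<delta>]) (use \<delta> in \<open>auto simp: norm_mult indicator_def\<close>)
  obtain w0 where w0: "is_fourier w0 (\<lambda>\<xi>. ?p \<xi> + ?j \<xi> * ?p \<xi>)"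
    using is_fourier_exists[OF L2_add[OF p jp]] by blast
  have d: "is_fourier (\<lambda>x. w0 x - perturbation_part peregrine t x) (\<lambda>\<xi>. ?j \<xi> * ?p \<xi>)"
    using is_fourier_diff[OF w0 W] by simp
  have jp2: "(cmod (?j \<xi> * ?p \<xi>))\<^sup>2 = \<delta>\<^sup>2 * (indicator {0<..} \<xi> * ?e \<xi>)" for \<xi>
    unfolding norm_mult[of "?j \<xi>"] power_mult_distrib p2 by (simp add: indicator_def norm_mult)
  note ei = exponential_energy_integrable[OF peregrine_width_pos[of t] s]
  have ii: "integrable lborel (\<lambda>\<xi>. (1 + \<xi>\<^sup>2) powr s * (cmod (?j \<xi> * ?p \<xi>))\<^sup>2)"
    unfolding jp2
    by (rule Bochner_Integration.integrable_bound[OF integrable_mult_right[OF ei, of "\<delta>\<^sup>2"]])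
       (auto simp: indicator_def abs_mult)
  then have ds: "(\<lambda>x. w0 x - perturbation_part peregrine t x) \<in> sobolev s"
    by (simp only: sobolev_is_fourier(1)[OF d])
  have Ws: "perturbation_part peregrine t \<in> sobolev s"
    using peregrine_sobolev(1)[OF s, of t 0] by simp
  have w0s: "w0 \<in> sobolev s" using sobolev_add(1)[OF ds Ws] by simp
  have "sobolev_energy s (\<lambda>x. w0 x - perturbation_part peregrine t x) \<le> (LINT \<xi>|lborel. \<delta>\<^sup>2 * ((1 + \<xi>\<^sup>2) powr s * ?e \<xi>))"
    unfolding sobolev_is_fourier(2)[OF d]
  proof (rule integral_mono[OF ii integrable_mult_right[OF ei]])
    show "(1 + \<xi>\<^sup>2) powr s * (cmod (?j \<xi> * ?p \<xi>))\<^sup>2 \<le> \<delta>\<^sup>2 * ((1 + \<xi>\<^sup>2) powr s * ?e \<xi>)" for \<xi>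
      unfolding jp2 by (simp add: indicator_def)
  qed
  then have en: "sobolev_energy s (\<lambda>x. w0 x - perturbation_part peregrine t x) \<le> \<delta>\<^sup>2 * exponential_energy s ?b"
    by (simp add: exponential_energy_def)
  have g2: "(cmod (?p \<xi> + ?j \<xi> * ?p \<xi>))\<^sup>2 = (1 + \<delta> * indicator {0<..} \<xi>)\<^sup>2 * ?e \<xi>" for \<xi>
  proof -
    have "?p \<xi> + ?j \<xi> * ?p \<xi> = complex_of_real (1 + \<delta> * indicator {0<..} \<xi>) * ?p \<xi>"
      by (simp add: distrib_right)
    then show ?thesis
      by (simp only: norm_mult[of "complex_of_real _" "?p \<xi>"] power_mult_distrib p2 norm_of_real power2_abs)
  qed
  have wL2: "w0 \<in> L2" using w0 by (simp add: is_fourier_iff)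
  note [measurable] = L2_measurable[OF fourier_L2[OF wL2]]
  have "momentum w0 = (LINT \<xi>|lborel. \<xi> * (cmod (?p \<xi> + ?j \<xi> * ?p \<xi>))\<^sup>2)"
    unfolding momentum_def
  proof (rule integral_cong_AE)
    show "AE \<xi> in lborel. \<xi> * (cmod (fourier w0 \<xi>))\<^sup>2 = \<xi> * (cmod (?p \<xi> + ?j \<xi> * ?p \<xi>))\<^sup>2"
      using is_fourier_AE[OF w0] by eventually_elim simp
  qed measurable
  also have "\<dots> = (LINT \<xi>|lborel. \<xi> * ((1 + \<delta> * indicator {0<..} \<xi>)\<^sup>2 * ?e \<xi>))" by (simp only: g2)
  also have "\<dots> = (LINT \<xi>:{0<..}|lborel. \<xi> * ((1 + \<delta> * indicator {0<..} \<xi>)\<^sup>2 * ?e \<xi>) + - \<xi> * ((1 + \<delta> * indicator {0<..} (- \<xi>))\<^sup>2 * ?e (- \<xi>)))"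
  proof (rule integral_half_line)
    show "integrable lborel (\<lambda>\<xi>. \<xi> * ((1 + \<delta> * indicator {0<..} \<xi>)\<^sup>2 * ?e \<xi>))"
    proof (rule Bochner_Integration.integrable_bound)
      show "integrable lborel (\<lambda>\<xi>. (1 + \<delta>)\<^sup>2 * (\<xi> * ?e \<xi>))"
        by (rule integrable_mult_right[OF exponential_momentum_integrable]) simp
      show "AE \<xi> in lborel. norm (\<xi> * ((1 + \<delta> * indicator {0<..} \<xi>)\<^sup>2 * ?e \<xi>)) \<le> norm ((1 + \<delta>)\<^sup>2 * (\<xi> * ?e \<xi>))"
      proof (intro AE_I2)
        fix \<xi> :: real
        have "(1 + \<delta> * indicator {0<..} \<xi>)\<^sup>2 * (\<bar>\<xi>\<bar> * ?e \<xi>) \<le> (1 + \<delta>)\<^sup>2 * (\<bar>\<xi>\<bar> * ?e \<xi>)"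
          using \<delta> by (intro mult_right_mono power_mono) (auto simp: indicator_def)
        then show "norm (\<xi> * ((1 + \<delta> * indicator {0<..} \<xi>)\<^sup>2 * ?e \<xi>)) \<le> norm ((1 + \<delta>)\<^sup>2 * (\<xi> * ?e \<xi>))"
          by (simp add: abs_mult mult_ac)
      qed
    qed measurable
  qed
  also have "\<dots> = (LINT \<xi>:{0<..}|lborel. (2 * \<delta> + \<delta>\<^sup>2) * (\<xi> * ?e \<xi>))"
    by (rule set_lebesgue_integral_cong) (auto simp: power2_eq_square algebra_simps)
  also have "\<dots> = (2 * \<delta> + \<delta>\<^sup>2) * half_line_momentum ?b"
    unfolding half_line_momentum_def by (rule set_integral_mult_right)
  finally have mom: "momentum w0 = (2 * \<delta> + \<delta>\<^sup>2) * half_line_momentum ?b" .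
  have "2 * \<delta> * half_line_momentum ?b \<le> momentum w0"
    unfolding mom using half_line_momentum_pos[OF peregrine_width_pos[of t]] by (intro mult_right_mono) auto
  then show ?thesis by (rule that[OF w0s ds en])
qed

text \<open>
  Stability bounds the Sobolev energy of \<open>w t\<close> by \<open>2 * (C0 * \<epsilon>)\<^sup>2\<close> plus twice that of the translated
  perturbation part, which does not depend on the translation and tends to \<open>0\<close>. Hence the conserved momentum, which is
  of first order in \<open>\<delta>\<close>, would be bounded by a multiple of \<open>\<delta>\<^sup>2\<close>.
\<close>

theorem peregrine_not_orbitally_stable:
  assumes s: "s > 1/2"
  shows "\<not> orbitally_stable s t0 peregrine"
proof
  let ?W = "perturbation_part peregrine"
  let ?N = "\<lambda>t. exponential_energy s (peregrine_width t)"
  have s0: "s > 0" using s by simp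
  assume "orbitally_stable s t0 peregrine"
  then obtain C0 \<epsilon>0 where C0: "C0 > 0" and \<epsilon>0: "\<epsilon>0 > 0"
    and stable: "\<And>\<epsilon> w0. 0 < \<epsilon> \<Longrightarrow> \<epsilon> < \<epsilon>0 \<Longrightarrow> w0 \<in> sobolev s \<Longrightarrow>
      sobolev_norm s (\<lambda>x. w0 x - ?W t0 x) < ennreal \<epsilon> \<Longrightarrow>
      \<exists>w. duhamel_solution s UNIV t0 w0 w \<and> (\<exists>x0. (SUP t. sobolev_norm s (\<lambda>x. w t x - ?W t (x - x0 t))) < ennreal (C0 * \<epsilon>))"
    unfolding orbitally_stable_def by blast
  \<comment> \<open>the summand \<open>1\<close> makes the data strictly closer than \<open>\<delta> * S\<close>\<close>
  define S where "S = sqrt (?N t0) + 1"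
  define c where "c = half_line_momentum (peregrine_width t0)"
  have N0: "?N t0 \<ge> 0" by (simp add: exponential_energy_def integral_nonneg_AE)
  have S: "S > 0" "?N t0 < S\<^sup>2"
  proof -
    have "0 \<le> sqrt (?N t0)" using N0 by simp
    moreover have "S\<^sup>2 = ?N t0 + 2 * sqrt (?N t0) + 1" using N0 by (simp add: S_def power2_sum)
    ultimately show "S > 0" "?N t0 < S\<^sup>2" unfolding S_def by linarith+
  qed
  have c: "c > 0" unfolding c_def by (rule half_line_momentum_pos) simp
  \<comment> \<open>the first bound keeps \<open>\<epsilon>\<close> admissible, the second defeats the quadratic term\<close>
  define \<delta> where "\<delta> = min (\<epsilon>0 / (2 * S)) (c / (2 * C0\<^sup>2 * S\<^sup>2))"
  have \<delta>: "\<delta> > 0" using \<epsilon>0 S c C0 by (simp add: \<delta>_def)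
  define \<epsilon> where "\<epsilon> = \<delta> * S"
  have \<epsilon>: "0 < \<epsilon>" using \<delta> S by (simp add: \<epsilon>_def)
  have "\<delta> * S \<le> \<epsilon>0 / (2 * S) * S" using S by (intro mult_right_mono) (auto simp: \<delta>_def)
  then have \<epsilon>_less: "\<epsilon> < \<epsilon>0" using S \<epsilon>0 by (simp add: \<epsilon>_def)
  obtain w0 where w0: "w0 \<in> sobolev s" "(\<lambda>x. w0 x - ?W t0 x) \<in> sobolev s"
      "sobolev_energy s (\<lambda>x. w0 x - ?W t0 x) \<le> \<delta>\<^sup>2 * ?N t0" "momentum w0 \<ge> 2 * \<delta> * c"
    unfolding c_def using asymmetric_perturbation[OF s0 \<delta>, of t0] by blast
  have "\<delta>\<^sup>2 * ?N t0 < \<epsilon>\<^sup>2" using S \<delta> by (simp add: \<epsilon>_def power_mult_distrib)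
  then have "sobolev_norm s (\<lambda>x. w0 x - ?W t0 x) < ennreal \<epsilon>"
    using w0 \<epsilon> by (simp add: sobolev_norm_less_iff)
  from stable[OF \<epsilon> \<epsilon>_less w0(1) this] obtain w x0 where sol: "duhamel_solution s UNIV t0 w0 w"
    and sup: "(SUP t. sobolev_norm s (\<lambda>x. w t x - ?W t (x - x0 t))) < ennreal (C0 * \<epsilon>)" by blast
  have energy: "sobolev_energy s (w t) \<le> 2 * (C0 * \<epsilon>)\<^sup>2 + 2 * ?N t" for t
  proof -
    have "sobolev_norm s (\<lambda>x. w t x - ?W t (x - x0 t)) < ennreal (C0 * \<epsilon>)"
      by (rule le_less_trans[OF SUP_upper sup]) simp
    then have d: "(\<lambda>x. w t x - ?W t (x - x0 t)) \<in> sobolev s" "sobolev_energy s (\<lambda>x. w t x - ?W t (x - x0 t)) < (C0 * \<epsilon>)\<^sup>2"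
      using C0 \<epsilon> by (simp_all add: sobolev_norm_less_iff)
    show ?thesis
      using sobolev_add(2)[OF d(1) peregrine_sobolev(1)[OF s0, of t "x0 t"]] d(2) peregrine_sobolev(2)[OF s0, of t "x0 t"]
      by simp
  qed
  have bounded: "sobolev_energy s (w t) \<le> 2 * (C0 * \<epsilon>)\<^sup>2 + 2 * exponential_energy s (1/2)" for t
    using energy[of t] exponential_energy_le[OF _ peregrine_width_ge s0, of t] by simp
  have "2 * \<delta> * c \<le> 2 * (C0 * \<epsilon>)\<^sup>2 + 2 * ?N (real n)" if n: "t0 \<le> real n" for n
  proof -
    have w: "w (real n) \<in> sobolev s" using sol by (auto simp: duhamel_solution_def)
    have "2 * \<delta> * c \<le> momentum w0" by (rule w0(4))
    also have "\<dots> = momentum (w (real n))"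
      by (rule momentum_conserved[OF sol w0(1) s n bounded, symmetric])
    also have "\<dots> \<le> sobolev_energy s (w (real n))" using momentum_le[OF w] s by simp
    also have "\<dots> \<le> 2 * (C0 * \<epsilon>)\<^sup>2 + 2 * ?N (real n)" by (rule energy)
    finally show ?thesis .
  qed
  then have "\<forall>\<^sub>F n in sequentially. 2 * \<delta> * c \<le> 2 * (C0 * \<epsilon>)\<^sup>2 + 2 * ?N (real n)"
    using real_arch_simple[of t0] unfolding eventually_sequentially by (meson of_nat_mono order_trans)
  moreover have "(\<lambda>n. 2 * (C0 * \<epsilon>)\<^sup>2 + 2 * ?N (real n)) \<longlonglongrightarrow> 2 * (C0 * \<epsilon>)\<^sup>2 + 2 * 0"
    by (intro tendsto_intros peregrine_energy_decay s0)
  ultimately have "2 * \<delta> * c \<le> 2 * (C0 * \<epsilon>)\<^sup>2 + 2 * 0"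
    by (intro tendsto_lowerbound) auto
  then have "\<delta> * c \<le> \<delta> * (\<delta> * (C0\<^sup>2 * S\<^sup>2))"
    by (simp add: \<epsilon>_def power2_eq_square mult_ac)
  then have "c \<le> \<delta> * (C0\<^sup>2 * S\<^sup>2)" using \<delta> by simp
  also have "\<dots> \<le> c / (2 * C0\<^sup>2 * S\<^sup>2) * (C0\<^sup>2 * S\<^sup>2)"
    by (intro mult_right_mono) (auto simp: \<delta>_def)
  also have "\<dots> = c / 2" using C0 S by simp
  finally show False using c by simp
qed

text \<open>
  With \<open>r = 1 / (1 + 4 t\<^sup>2 + 2 x\<^sup>2)\<close> all derivatives are polynomials in \<open>t\<close>, \<open>x\<close>, \<open>r\<close> times \<open>cis t\<close>. In the equation
  \<open>x\<close> occurs only through \<open>x\<^sup>2 r\<close>, which is affine in \<open>r\<close>; what remains is a polynomial identity in \<open>t\<close> and \<open>r\<close>.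
\<close>

theorem nls_classical_solution_peregrine: "nls_classical_solution peregrine"
proof -
  define z where "z t = 1 + 2 * \<i> * complex_of_real t" for t
  define r where "r t x = 1 / (1 + 4 * t\<^sup>2 + 2 * x\<^sup>2)" for t x :: real
  define c where "c t x = complex_of_real (r t x)" for t x
  have pos: "1 + 4 * t\<^sup>2 + 2 * x\<^sup>2 > 0" for t x :: real by (simp add: add_pos_nonneg)
  have U: "peregrine t x = cis t * (1 - 4 * z t * c t x)" for t x
    by (simp add: peregrine_def z_def c_def r_def)
  have rt: "((\<lambda>\<tau>. r \<tau> x) has_real_derivative - 8 * t * (r t x)\<^sup>2) (at t)" for t x
    unfolding r_def
    by (rule derivative_eq_intros refl | use pos[of t x] in \<open>simp add: power2_eq_square\<close>)+
  have rx: "(r t has_real_derivative - 4 * x * (r t x)\<^sup>2) (at x)" for t x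
    unfolding r_def[abs_def]
    by (rule derivative_eq_intros refl | use pos[of t x] in \<open>simp add: power2_eq_square\<close>)+
  have vec: "((\<lambda>y. complex_of_real (f y)) has_vector_derivative complex_of_real f') (at y)"
    if "(f has_real_derivative f') (at y)" for f f' y
    by (rule bounded_linear.has_vector_derivative[OF bounded_linear_of_real])
       (use that in \<open>simp add: has_real_derivative_iff_has_vector_derivative\<close>)
  let ?Ut = "\<lambda>t x. cis t * (\<i> * (1 - 4 * z t * c t x) - 8 * \<i> * c t x + 32 * complex_of_real t * z t * (c t x)\<^sup>2)"
  let ?Ux = "\<lambda>t x. 16 * cis t * z t * complex_of_real (x * (r t x)\<^sup>2)"
  let ?Uxx = "\<lambda>t x. 16 * cis t * z t * complex_of_real ((r t x)\<^sup>2 - 8 * x\<^sup>2 * (r t x)^3)"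
  have dt: "((\<lambda>\<tau>. peregrine \<tau> x) has_vector_derivative ?Ut t x) (at t)" for t x
  proof -
    have 1: "(cis has_vector_derivative \<i> * cis t) (at t)"
      using has_derivative_cis[OF has_derivative_ident, of t UNIV] by (simp add: has_vector_derivative_def)
    have 2: "(z has_vector_derivative 2 * \<i>) (at t)"
    proof -
      have "((\<lambda>t. complex_of_real t) has_vector_derivative complex_of_real 1) (at t)"
        by (rule vec) simp
      from has_vector_derivative_add[OF has_vector_derivative_const has_vector_derivative_mult_right[OF this, of "2 * \<i>"]]
      show ?thesis unfolding z_def[abs_def] by simp
    qed
    have 3: "((\<lambda>\<tau>. c \<tau> x) has_vector_derivative complex_of_real (- 8 * t * (r t x)\<^sup>2)) (at t)"
      unfolding c_def by (rule vec[OF rt])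
    have "((\<lambda>\<tau>. cis \<tau> * (1 - 4 * (z \<tau> * c \<tau> x))) has_vector_derivative
        cis t * (0 - 4 * (z t * complex_of_real (- 8 * t * (r t x)\<^sup>2) + 2 * \<i> * c t x)) + \<i> * cis t * (1 - 4 * (z t * c t x))) (at t)"
      by (intro has_vector_derivative_mult 1 2 3 has_vector_derivative_diff has_vector_derivative_const has_vector_derivative_mult_right)
    moreover have "cis t * (0 - 4 * (z t * complex_of_real (- 8 * t * (r t x)\<^sup>2) + 2 * \<i> * c t x)) + \<i> * cis t * (1 - 4 * (z t * c t x)) = ?Ut t x"
      by (simp add: c_def algebra_simps)
    ultimately show ?thesis by (simp only: U mult.assoc)
  qed
  have dx: "(peregrine t has_vector_derivative ?Ux t x) (at x)" for t x
  proof -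
    have 3: "(c t has_vector_derivative complex_of_real (- 4 * x * (r t x)\<^sup>2)) (at x)"
      unfolding c_def[abs_def] by (rule vec[OF rx])
    have "((\<lambda>x. cis t - 4 * cis t * z t * c t x) has_vector_derivative 0 - 4 * cis t * z t * complex_of_real (- 4 * x * (r t x)\<^sup>2)) (at x)"
      by (intro has_vector_derivative_diff has_vector_derivative_const has_vector_derivative_mult_right 3)
    moreover have "peregrine t = (\<lambda>x. cis t - 4 * cis t * z t * c t x)"
      by (simp add: fun_eq_iff U algebra_simps)
    moreover have "0 - 4 * cis t * z t * complex_of_real (- 4 * x * (r t x)\<^sup>2) = ?Ux t x"
      by simp
    ultimately show ?thesis by (simp only:)
  qed
  have dxx: "(?Ux t has_vector_derivative ?Uxx t x) (at x)" for t x
  proof -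
    have "((\<lambda>x. x * (r t x)\<^sup>2) has_real_derivative (r t x)\<^sup>2 - 8 * x\<^sup>2 * (r t x)^3) (at x)"
      by (rule derivative_eq_intros rx refl | simp add: power2_eq_square power3_eq_cube)+
    from has_vector_derivative_mult_right[OF vec[OF this]] show ?thesis .
  qed
  have eq: "\<i> * ?Ut t x + ?Uxx t x + (complex_of_real (cmod (peregrine t x)))\<^sup>2 * peregrine t x = 0" for t x
  proof -
    let ?r = "r t x"
    have "2 * x\<^sup>2 * ?r = 1 - (1 + 4 * t\<^sup>2) * ?r"
      using pos[of t x] by (simp add: r_def field_simps)
    then have "8 * x\<^sup>2 * ?r^3 = 4 * ?r\<^sup>2 * (1 - (1 + 4 * t\<^sup>2) * ?r)"
      by (simp only: power3_eq_cube power2_eq_square) algebra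
    then have xx: "?r\<^sup>2 - 8 * x\<^sup>2 * ?r^3 = 4 * (1 + 4 * t\<^sup>2) * ?r^3 - 3 * ?r\<^sup>2"
      by (simp add: power3_eq_cube power2_eq_square algebra_simps)
    have "(cmod (1 - 4 * z t * c t x))\<^sup>2 = (1 - 4 * ?r)\<^sup>2 + 64 * t\<^sup>2 * ?r\<^sup>2"
      by (simp add: cmod_power2 z_def c_def power_mult_distrib)
    then have mod: "(complex_of_real (cmod (peregrine t x)))\<^sup>2 = complex_of_real ((1 - 4 * ?r)\<^sup>2 + 64 * t\<^sup>2 * ?r\<^sup>2)"
      unfolding of_real_power[symmetric] U norm_mult norm_cis mult_1 by simp
    have "\<i> * (\<i> * (1 - 4 * z t * c t x) - 8 * \<i> * c t x + 32 * complex_of_real t * z t * (c t x)\<^sup>2)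
        + 16 * z t * complex_of_real (4 * (1 + 4 * t\<^sup>2) * ?r^3 - 3 * ?r\<^sup>2)
        + complex_of_real ((1 - 4 * ?r)\<^sup>2 + 64 * t\<^sup>2 * ?r\<^sup>2) * (1 - 4 * z t * c t x) = 0"
      unfolding z_def c_def
      by (simp add: complex_eq_iff power2_eq_square power3_eq_cube) algebra
    then have "cis t * (\<i> * (\<i> * (1 - 4 * z t * c t x) - 8 * \<i> * c t x + 32 * complex_of_real t * z t * (c t x)\<^sup>2)
        + 16 * z t * complex_of_real (4 * (1 + 4 * t\<^sup>2) * ?r^3 - 3 * ?r\<^sup>2)
        + complex_of_real ((1 - 4 * ?r)\<^sup>2 + 64 * t\<^sup>2 * ?r\<^sup>2) * (1 - 4 * z t * c t x)) = 0"
      by simp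
    then show ?thesis
      unfolding mod xx unfolding U[of t x] by (simp only: distrib_left mult_ac)
  qed
  show ?thesis
    unfolding nls_classical_solution_def
    by (intro exI[of _ ?Ut] exI[of _ ?Ux] exI[of _ ?Uxx] allI conjI dt dx dxx eq)
qed

theorem theorem1p2:
  fixes s t0 :: real
  assumes "s > 1 / 2"
  shows "nls_classical_solution peregrine \<and> \<not> orbitally_stable s t0 peregrine"
  using nls_classical_solution_peregrine peregrine_not_orbitally_stable[OF assms] by blast

end
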